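(* Let $\overline{\mathcal{U}_q(sl_2)}$ be the quantum Weyl group of $sl_2$, with universal $R$-matrix $R$ and quantum Weyl element $w$. Let $\beta_0=1$, let $\beta_1$ be an arbitrary scalar, and define $\beta_m$ for $m\ge 2$ by the recursion $$\beta_{a+1}=\frac{\beta_a\beta_1+\beta_{a-1}(q^{-1}-1)q^{(1-a)/2}}{[a+1]},\qquad a\ge 1.$$ Then the element $$t=w\,q^{-H^2/8}\sum_{m=0}^\infty\beta_m\,q^{-Hm/4}\,Y^m$$ satisfies $$R_{2,1}\,t_2\,R\,t_1=t_1\,R_{2,1}\,t_2\,R .$$
   Context: Let $q=e^h$, and $[n]=\frac{q^{n/2}-q^{-n/2}}{q^{1/2}-q^{-1/2}}$, $[n]!=[1][2]\cdots[n]$, $[0]!=1$. The quantum group $\mathcal{U}_q(sl_2)$ is generated by $H,X,Y$ with relations $[H,X]=2X$, $[H,Y]=-2Y$, $[X,Y]=(K^2-K^{-2})/(q^{1/2}-q^{-1/2})$, where $K:=q^{H/4}$. Put $E:=KX$, $F:=K^{-1}Y$. The coproduct is $\Delta(X)=X\otimes K+K^{-1}\otimes X$, $\Delta(Y)=Y\otimes K+K^{-1}\otimes Y$, $\Delta(H)=H\otimes 1+1\otimes H$, the counit satisfies $\epsilon(H)=\epsilon(X)=\epsilon(Y)=0$, and the antipode is $S(H)=-H$, $S(X)=-q^{1/2}X$, $S(Y)=-q^{-1/2}Y$. The quantum Weyl group $\overline{\mathcal{U}_q(sl_2)}$ is the Hopf algebra extension of $\mathcal{U}_q(sl_2)$ by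 an additional invertible generator $w$ with relations $wX=-q^{1/2}Yw$, $wY=-q^{-1/2}Xw$, $wH=-Hw$, $w^2=v\varepsilon$, with $\Delta(w)=R^{-1}(w\otimes w)$ and $\epsilon(w)=1$. Here $v$ is the (central) ribbon element and $\varepsilon$ is the central element acting as $1$ in odd-dimensional and as $-1$ in even-dimensional irreducible representations of $\mathcal{U}_q(sl_2)$. The universal $R$-matrix of both $\mathcal{U}_q(sl_2)$ and $\overline{\mathcal{U}_q(sl_2)}$ is $$R=q^{H\otimes H/4}\sum_{n=0}^\infty\frac{(1-q^{-1})^n}{[n]!}\,q^{n(n-1)/4}\,E^n\otimes F^n .$$ It satisfies $R\Delta(x)=\Delta'(x)R$, where $\Delta'$ is the opposite coproduct, and $(w\otimes w)R=R_{2,1}(w\otimes w)$. Notation: $R_{2,1}$ is $R$ with its two tensor factors interchanged; for an element $x$, $x_1:=x\otimes 1$ and $x_2:=1\otimes x$. Infinite sums such as those in $R$ and $t$, and power series in $H$, are understood in the appropriate completions of the algebra and its tensor square; the sums become finite in every finite-dimensional representation. *)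

theory Defs
  imports
    "HOL-Computational_Algebra.Formal_Power_Series"
    "Jordan_Normal_Form.Matrix"
begin

text \<open>
  Conventions. The ground ring is \<open>k = \<complex>[[h]]\<close>, the type \<open>complex fps\<close> with \<open>h = fps_X\<close>, and
  \<open>q = e\<^sup>h\<close>. A finite-dimensional representation is an action on a free module \<open>k\<^sup>n\<close>. An element of
  the completed quantum Weyl group is a family of operators, one on each finite-dimensional
  representation, compatible with all intertwiners; an element of the completed tensor square is
  such a family indexed by pairs of representations.
\<close>

section \<open>Scalars\<close>

definition q_pow :: "complex \<Rightarrow> complex fps" where
  "q_pow c = fps_exp c"

text \<open>Both differences have order one in \<open>h\<close> for positive \<open>n\<close>; the division of power series is exact.\<close>

definition q_int :: "nat \<Rightarrow> complex fps" where
  "q_int n = (q_pow (of_nat n / 2) - q_pow (- of_nat n / 2)) / (q_pow (1/2) - q_pow (-1/2))"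

definition q_fact :: "nat \<Rightarrow> complex fps" where
  "q_fact n = (\<Prod>k = 1..n. q_int k)"

section \<open>Matrices over formal power series\<close>

text \<open>
  Infinite sums of matrices are taken entrywise in the \<open>h\<close>-adic topology, which is the topology of
  the type \<open>complex fps\<close>. Exponentials of \<open>h\<close> times a matrix converge; the sums over powers
  of the nilpotent operators \<open>E\<close>, \<open>F\<close>, \<open>Y\<close> are finite.
\<close>

definition mat_suminf :: "nat \<Rightarrow> (nat \<Rightarrow> complex fps mat) \<Rightarrow> complex fps mat" where
  "mat_suminf n f = mat n n (\<lambda>(i, j). \<Sum>m. f m $$ (i, j))"

text \<open>\<open>mat_qpow A\<close> is \<open>q\<^sup>A = exp (h A)\<close>.\<close>

definition mat_qpow :: "complex fps mat \<Rightarrow> complex fps mat" where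
  "mat_qpow A =
     mat_suminf (dim_row A) (\<lambda>m. (fps_const (1 / fact m) * fps_X ^ m) \<cdot>\<^sub>m (A ^\<^sub>m m))"

text \<open>Kronecker product; the basis vector \<open>e\<^sub>i \<otimes> e\<^sub>j\<close> of \<open>k\<^sup>m \<otimes> k\<^sup>n\<close> has index \<open>i * n + j\<close>.\<close>

definition kron :: "complex fps mat \<Rightarrow> complex fps mat \<Rightarrow> complex fps mat" (infixl \<open>\<otimes>\<^sub>m\<close> 70) where
  "A \<otimes>\<^sub>m B = mat (dim_row A * dim_row B) (dim_col A * dim_col B)
     (\<lambda>(i, j). A $$ (i div dim_row B, j div dim_col B) * B $$ (i mod dim_row B, j mod dim_col B))"

text \<open>The interchange \<open>k\<^sup>m \<otimes> k\<^sup>n \<rightarrow> k\<^sup>n \<otimes> k\<^sup>m\<close>.\<close>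

definition swap_mat :: "nat \<Rightarrow> nat \<Rightarrow> complex fps mat" where
  "swap_mat m n = mat (n * m) (m * n)
     (\<lambda>(i, j). if i div m = j mod n \<and> i mod m = j div n then 1 else 0)"

definition inv_mat :: "complex fps mat \<Rightarrow> complex fps mat" where
  "inv_mat A = (THE B. B \<in> carrier_mat (dim_row A) (dim_row A) \<and> inverts_mat A B \<and> inverts_mat B A)"

section \<open>Representations of the quantum group\<close>

record uq_rep =
  rdim :: nat
  opH :: "complex fps mat"
  opX :: "complex fps mat"
  opY :: "complex fps mat"

definition qH :: "'a uq_rep_scheme \<Rightarrow> complex \<Rightarrow> complex fps mat" where
  "qH V c = mat_qpow (fps_const c \<cdot>\<^sub>m opH V)"

definition opK :: "'a uq_rep_scheme \<Rightarrow> complex fps mat" where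
  "opK V = qH V (1/4)"

definition opK_inv :: "'a uq_rep_scheme \<Rightarrow> complex fps mat" where
  "opK_inv V = qH V (-1/4)"

definition opE :: "'a uq_rep_scheme \<Rightarrow> complex fps mat" where
  "opE V = opK V * opX V"

definition opF :: "'a uq_rep_scheme \<Rightarrow> complex fps mat" where
  "opF V = opK_inv V * opY V"

text \<open>
  The relation for \<open>[X, Y]\<close> is multiplied by its denominator, which is not a unit of \<open>k\<close> but is
  cancellable on a free \<open>k\<close>-module.
\<close>

definition is_uq_rep :: "'a uq_rep_scheme \<Rightarrow> bool" where
  "is_uq_rep V \<longleftrightarrow>
     opH V \<in> carrier_mat (rdim V) (rdim V) \<and>
     opX V \<in> carrier_mat (rdim V) (rdim V) \<and>
     opY V \<in> carrier_mat (rdim V) (rdim V) \<and>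
     opH V * opX V - opX V * opH V = 2 \<cdot>\<^sub>m opX V \<and>
     opH V * opY V - opY V * opH V = (-2) \<cdot>\<^sub>m opY V \<and>
     (q_pow (1/2) - q_pow (-1/2)) \<cdot>\<^sub>m (opX V * opY V - opY V * opX V) =
       opK V * opK V - opK_inv V * opK_inv V"

definition uq_hom :: "'a uq_rep_scheme \<Rightarrow> 'b uq_rep_scheme \<Rightarrow> complex fps mat \<Rightarrow> bool" where
  "uq_hom V W f \<longleftrightarrow>
     f \<in> carrier_mat (rdim W) (rdim V) \<and>
     f * opH V = opH W * f \<and> f * opX V = opX W * f \<and> f * opY V = opY W * f"

text \<open>
  Over \<open>k\<close> the submodules \<open>h\<^sup>m V\<close> are always invariant, so irreducibility refers to invariant
  submodules with torsion-free quotient. Equivalently, \<open>V\<close> becomes irreducible over the field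
  of Laurent series.
\<close>

definition uq_subrep :: "'a uq_rep_scheme \<Rightarrow> complex fps vec set \<Rightarrow> bool" where
  "uq_subrep V N \<longleftrightarrow>
     N \<subseteq> carrier_vec (rdim V) \<and>
     0\<^sub>v (rdim V) \<in> N \<and>
     (\<forall>x\<in>N. \<forall>y\<in>N. x + y \<in> N) \<and>
     (\<forall>c. \<forall>x\<in>N. c \<cdot>\<^sub>v x \<in> N) \<and>
     (\<forall>x\<in>N. opH V *\<^sub>v x \<in> N \<and> opX V *\<^sub>v x \<in> N \<and> opY V *\<^sub>v x \<in> N) \<and>
     (\<forall>x\<in>carrier_vec (rdim V). fps_X \<cdot>\<^sub>v x \<in> N \<longrightarrow> x \<in> N)"

definition uq_irreducible :: "'a uq_rep_scheme \<Rightarrow> bool" where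
  "uq_irreducible V \<longleftrightarrow>
     is_uq_rep V \<and> 0 < rdim V \<and>
     (\<forall>N. uq_subrep V N \<longrightarrow> N = {0\<^sub>v (rdim V)} \<or> N = carrier_vec (rdim V))"

text \<open>The action of \<open>\<epsilon>\<close>: by \<open>1\<close> (by \<open>-1\<close>) on every irreducible of odd (even) dimension mapping to \<open>V\<close>.\<close>

definition uq_eps :: "'a uq_rep_scheme \<Rightarrow> complex fps mat" where
  "uq_eps V = (THE C. C \<in> carrier_mat (rdim V) (rdim V) \<and>
     (\<forall>(W :: uq_rep) f. uq_irreducible W \<and> uq_hom W V f \<longrightarrow>
        C * f = (if odd (rdim W) then f else - f)))"

section \<open>The universal R-matrix and the ribbon element\<close>

definition R_coeff :: "nat \<Rightarrow> complex fps" where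
  "R_coeff n = (1 - q_pow (-1)) ^ n / q_fact n * q_pow (of_nat n * (of_nat n - 1) / 4)"

definition uq_R :: "'a uq_rep_scheme \<Rightarrow> 'b uq_rep_scheme \<Rightarrow> complex fps mat" where
  "uq_R V W = mat_qpow (fps_const (1/4) \<cdot>\<^sub>m (opH V \<otimes>\<^sub>m opH W)) *
     mat_suminf (rdim V * rdim W) (\<lambda>n. R_coeff n \<cdot>\<^sub>m ((opE V ^\<^sub>m n) \<otimes>\<^sub>m (opF W ^\<^sub>m n)))"

text \<open>\<open>S(F) = S(Y) S(K\<^sup>-\<^sup>1) = - q\<^sup>-\<^sup>1\<^sup>/\<^sup>2 Y K\<close>.\<close>

definition opSF :: "'a uq_rep_scheme \<Rightarrow> complex fps mat" where
  "opSF V = (- q_pow (-1/2)) \<cdot>\<^sub>m (opY V * opK V)"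

text \<open>
  The Drinfeld element \<open>u = \<Sum>\<^sub>i S(b\<^sub>i) a\<^sub>i\<close> for \<open>R = \<Sum>\<^sub>i a\<^sub>i \<otimes> b\<^sub>i\<close>. Expanding \<open>q\<^bsup>H \<otimes> H / 4\<^esup>\<close> and using
  \<open>S(H) = - H\<close>, the Cartan part of \<open>R\<close> contributes \<open>q\<^bsup>- H\<^sup>2 / 4\<^esup>\<close> between \<open>S(F)\<^sup>n\<close> and \<open>E\<^sup>n\<close>.
\<close>

definition uq_u :: "'a uq_rep_scheme \<Rightarrow> complex fps mat" where
  "uq_u V = mat_suminf (rdim V) (\<lambda>n. R_coeff n \<cdot>\<^sub>m
     ((opSF V ^\<^sub>m n) * mat_qpow (fps_const (-1/4) \<cdot>\<^sub>m (opH V * opH V)) * (opE V ^\<^sub>m n)))"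

text \<open>
  The ribbon element \<open>v = K\<^sup>-\<^sup>2 u\<close>, where \<open>K\<^sup>2\<close> is the group-like element implementing \<open>S\<^sup>2\<close>. On the
  irreducible of dimension \<open>n\<close> it is \<open>q\<^bsup>- (n\<^sup>2 - 1) / 4\<^esup>\<close>.
\<close>

definition uq_ribbon :: "'a uq_rep_scheme \<Rightarrow> complex fps mat" where
  "uq_ribbon V = opK_inv V * opK_inv V * uq_u V"

section \<open>Representations of the quantum Weyl group\<close>

record qw_rep = uq_rep +
  opW :: "complex fps mat"

definition is_qw_rep :: "qw_rep \<Rightarrow> bool" where
  "is_qw_rep V \<longleftrightarrow>
     is_uq_rep V \<and>
     opW V \<in> carrier_mat (rdim V) (rdim V) \<and> invertible_mat (opW V) \<and>
     opW V * opX V = (- q_pow (1/2)) \<cdot>\<^sub>m (opY V * opW V) \<and>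
     opW V * opY V = (- q_pow (-1/2)) \<cdot>\<^sub>m (opX V * opW V) \<and>
     opW V * opH V = - (opH V * opW V) \<and>
     opW V * opW V = uq_ribbon V * uq_eps V"

definition qw_reps :: "qw_rep set" where
  "qw_reps = {V. is_qw_rep V}"

definition qw_hom :: "qw_rep \<Rightarrow> qw_rep \<Rightarrow> complex fps mat \<Rightarrow> bool" where
  "qw_hom V W f \<longleftrightarrow> uq_hom V W f \<and> f * opW V = opW W * f"

section \<open>The completed quantum Weyl group and its completed tensor square\<close>

type_synonym qw_elem = "qw_rep \<Rightarrow> complex fps mat"
type_synonym qw_elem2 = "qw_rep \<times> qw_rep \<Rightarrow> complex fps mat"

definition qw_compl :: "qw_elem ring" where
  "qw_compl = \<lparr>
     carrier = {x \<in> (\<Pi>\<^sub>E V\<in>qw_reps. carrier_mat (rdim V) (rdim V)).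
       \<forall>V\<in>qw_reps. \<forall>W\<in>qw_reps. \<forall>f. qw_hom V W f \<longrightarrow> f * x V = x W * f},
     mult = (\<lambda>x y. \<lambda>V\<in>qw_reps. x V * y V),
     one = (\<lambda>V\<in>qw_reps. 1\<^sub>m (rdim V)),
     zero = (\<lambda>V\<in>qw_reps. 0\<^sub>m (rdim V) (rdim V)),
     add = (\<lambda>x y. \<lambda>V\<in>qw_reps. x V + y V)\<rparr>"

definition qw_compl2 :: "qw_elem2 ring" where
  "qw_compl2 = \<lparr>
     carrier = {x \<in> (\<Pi>\<^sub>E (V, W)\<in>qw_reps \<times> qw_reps.
                        carrier_mat (rdim V * rdim W) (rdim V * rdim W)).
       \<forall>V\<in>qw_reps. \<forall>V'\<in>qw_reps. \<forall>W\<in>qw_reps. \<forall>W'\<in>qw_reps. \<forall>f g.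
         qw_hom V V' f \<and> qw_hom W W' g \<longrightarrow> (f \<otimes>\<^sub>m g) * x (V, W) = x (V', W') * (f \<otimes>\<^sub>m g)},
     mult = (\<lambda>x y. \<lambda>P\<in>qw_reps \<times> qw_reps. x P * y P),
     one = (\<lambda>(V, W)\<in>qw_reps \<times> qw_reps. 1\<^sub>m (rdim V * rdim W)),
     zero = (\<lambda>(V, W)\<in>qw_reps \<times> qw_reps. 0\<^sub>m (rdim V * rdim W) (rdim V * rdim W)),
     add = (\<lambda>x y. \<lambda>P\<in>qw_reps \<times> qw_reps. x P + y P)\<rparr>"

definition leg1 :: "qw_elem \<Rightarrow> qw_elem2" where
  "leg1 x = (\<lambda>(V, W)\<in>qw_reps \<times> qw_reps. x V \<otimes>\<^sub>m 1\<^sub>m (rdim W))"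

definition leg2 :: "qw_elem \<Rightarrow> qw_elem2" where
  "leg2 x = (\<lambda>(V, W)\<in>qw_reps \<times> qw_reps. 1\<^sub>m (rdim V) \<otimes>\<^sub>m x W)"

definition flip2 :: "qw_elem2 \<Rightarrow> qw_elem2" where
  "flip2 x = (\<lambda>(V, W)\<in>qw_reps \<times> qw_reps.
     swap_mat (rdim W) (rdim V) * x (W, V) * swap_mat (rdim V) (rdim W))"

definition qw_R :: qw_elem2 where
  "qw_R = (\<lambda>(V, W)\<in>qw_reps \<times> qw_reps. uq_R V W)"

definition qw_t :: "(nat \<Rightarrow> complex fps) \<Rightarrow> qw_elem" where
  "qw_t \<beta> = (\<lambda>V\<in>qw_reps.
     opW V * mat_qpow (fps_const (-1/8) \<cdot>\<^sub>m (opH V * opH V)) *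
     mat_suminf (rdim V) (\<lambda>m. \<beta> m \<cdot>\<^sub>m (qH V (- of_nat m / 4) * (opY V ^\<^sub>m m))))"

text \<open>
  The bialgebra structure, which determines the antipode: the coproduct is evaluation on tensor
  products, with \<open>\<Delta>(w) = R\<^sup>-\<^sup>1 (w \<otimes> w)\<close>, and the counit is evaluation on the trivial representation.
\<close>

definition qw_tensor :: "qw_rep \<Rightarrow> qw_rep \<Rightarrow> qw_rep" where
  "qw_tensor V W = \<lparr>
     rdim = rdim V * rdim W,
     opH = opH V \<otimes>\<^sub>m 1\<^sub>m (rdim W) + 1\<^sub>m (rdim V) \<otimes>\<^sub>m opH W,
     opX = opX V \<otimes>\<^sub>m opK W + opK_inv V \<otimes>\<^sub>m opX W,
     opY = opY V \<otimes>\<^sub>m opK W + opK_inv V \<otimes>\<^sub>m opY W,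
     opW = inv_mat (uq_R V W) * (opW V \<otimes>\<^sub>m opW W)\<rparr>"

definition qw_triv :: qw_rep where
  "qw_triv = \<lparr>rdim = 1, opH = 0\<^sub>m 1 1, opX = 0\<^sub>m 1 1, opY = 0\<^sub>m 1 1, opW = 1\<^sub>m 1\<rparr>"

definition qw_coproduct :: "qw_elem \<Rightarrow> qw_elem2" where
  "qw_coproduct x = (\<lambda>(V, W)\<in>qw_reps \<times> qw_reps. x (qw_tensor V W))"

definition qw_counit :: "qw_elem \<Rightarrow> complex fps" where
  "qw_counit x = x qw_triv $$ (0, 0)"

end

theory Submission
  imports Defs "Jordan_Normal_Form.Determinant"
begin

text \<open>
  Write \<open>t = w T\<close>. Moving both copies of \<open>w\<close> to the left turns the claim into
  \<open>R T\<^sub>2 R' T\<^sub>1 = T\<^sub>1 R' T\<^sub>2 R\<close>, where \<open>R' = w\<^sub>1\<^sup>-\<^sup>1 R w\<^sub>1\<close> is a series in \<open>F \<otimes> F\<close>. Here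
  \<open>T = q\<^bsup>- H\<^sup>2 / 8\<^esup> b(F)\<close> with \<open>b(z) = \<Sum>\<^sub>m \<beta>\<^sub>m q\<^bsup>m (m - 1) / 4\<^esup> z\<^sup>m\<close>, because \<open>q\<^bsup>- H m / 4\<^esup> Y\<^sup>m\<close> is a scalar
  multiple of \<open>F\<^sup>m\<close>. After collecting the Cartan factors, which match, \<open>F\<^sub>2\<close> commutes with all that is
  left, and with \<open>\<theta>(z)\<close> the series of \<open>R\<close>, \<open>C = K\<^sub>1\<^sup>2 F\<^sub>2\<close>, \<open>D = K\<^sub>1\<^sup>-\<^sup>2 F\<^sub>2\<close>, the claim becomes
  \<open>\<theta>(E\<^sub>1 F\<^sub>2) b(D) \<theta>(- D F\<^sub>1) b(F\<^sub>1) = b(F\<^sub>1) \<theta>(- F\<^sub>1 C) b(C) \<theta>(E\<^sub>1 F\<^sub>2)\<close>.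
  The recursion for \<open>\<beta>\<close> gives the addition formula \<open>b(y) \<theta>(- y x) b(x) = b(x + y)\<close> whenever
  \<open>y x = q x y\<close>, and the commutator of \<open>E\<close> and \<open>F\<close> gives
  \<open>\<theta>(E\<^sub>1 F\<^sub>2) (F\<^sub>1 + D) = (F\<^sub>1 + C) \<theta>(E\<^sub>1 F\<^sub>2)\<close>. These two facts prove the claim.

  To calculate in a type of class \<^class>\<open>ring_1\<close>, matrices of all sizes are embedded in the
  ring of linear operators on sequences.
\<close>

section \<open>Linear operators on sequences of power series\<close>

text \<open>The exponent -1/8 in t is dictated by the Cartan part of R. Conjugation by w in one leg
  turns q^(H1 H2 / 4) into q^(- H1 H2 / 4), and together with q^(- H1^2 / 8) and q^(- H2^2 / 8) this
  is q^(- (H1 + H2)^2 / 8), which commutes with E1 F2. With p = q^(-1), the series of R is a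
  p-exponential, \<theta>(p z) = (1 - (1 - p)^2 z) \<theta>(z), and the recursion for \<beta>
  amounts to b(p z) = (1 - (1 - p) \<beta>1 z + (1 - p)^2 z^2) b(z).

  Three obstacles shape the proof. The scalar 1 - p is not a unit, so commutators are kept
  multiplied by 1 - p, a factor that the coefficients of R supply. A representation is given by
  relations alone, without a basis of weight vectors, so nilpotency of X and Y is derived from their
  commutators with H, and exchanges with Cartan elements are derived from exchanges with their
  exponents. The embedding of matrices is not unital, so exponentials are extended by the identity
  and a projection accompanies every embedded element until the end.\<close>

typedef linop = "{f :: (nat \<Rightarrow> complex fps) \<Rightarrow> nat \<Rightarrow> complex fps.
    (\<forall>u v. f (\<lambda>i. u i + v i) = (\<lambda>i. f u i + f v i)) \<and>
    (\<forall>c u. f (\<lambda>i. c * u i) = (\<lambda>i. c * f u i))}"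
  morphisms op_app Abs_linop
  by (rule exI[of _ "\<lambda>u. u"]) auto

setup_lifting type_definition_linop

lemma op_app_scale: "op_app A (\<lambda>i. c * u i) = (\<lambda>i. c * op_app A u i)"
  using op_app[of A] by auto

lemma linop_eqI: "(\<And>u i. op_app A u i = op_app B u i) \<Longrightarrow> A = B"
  by (metis op_app_inject ext)

instantiation linop :: ring_1
begin

lift_definition zero_linop :: linop is "\<lambda>u i. 0" by auto
lift_definition one_linop :: linop is "\<lambda>u. u" by auto
lift_definition plus_linop :: "linop \<Rightarrow> linop \<Rightarrow> linop" is "\<lambda>f g u i. f u i + g u i"
  by (auto simp: algebra_simps fun_eq_iff)
lift_definition minus_linop :: "linop \<Rightarrow> linop \<Rightarrow> linop" is "\<lambda>f g u i. f u i - g u i"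
  by (auto simp: algebra_simps fun_eq_iff)
lift_definition uminus_linop :: "linop \<Rightarrow> linop" is "\<lambda>f u i. - f u i"
  by (auto simp: algebra_simps fun_eq_iff)
lift_definition times_linop :: "linop \<Rightarrow> linop \<Rightarrow> linop" is "\<lambda>f g u. f (g u)"
  by auto

instance
proof
  fix a b c :: linop
  show "a * b * c = a * (b * c)" by transfer auto
  show "1 * a = a" "a * 1 = a" by (transfer; auto)+
  show "a + b + c = a + (b + c)" by transfer (auto simp: add.assoc)
  show "a + b = b + a" by transfer (auto simp: add.commute)
  show "0 + a = a" by transfer auto
  show "- a + a = 0" by transfer auto
  show "a - b = a + - b" by transfer auto
  show "(a + b) * c = a * c + b * c" by transfer auto
  show "a * (b + c) = a * b + a * c" by transfer (auto simp: fun_eq_iff)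
  show "(0 :: linop) \<noteq> 1" by transfer (metis zero_neq_one)
qed

end

lift_definition scl :: "complex fps \<Rightarrow> linop \<Rightarrow> linop" is "\<lambda>c f u i. c * f u i"
  by (auto simp: algebra_simps fun_eq_iff)

lemma op_app_simps:
  "op_app 0 u i = 0" "op_app 1 u i = u i" "op_app (A + B) u i = op_app A u i + op_app B u i"
  "op_app (A - B) u i = op_app A u i - op_app B u i" "op_app (- A) u i = - op_app A u i"
  "op_app (A * B) u i = op_app A (op_app B u) i" "op_app (scl c A) u i = c * op_app A u i"
  by (transfer; simp)+

lemma scl_scl [simp]: "scl c (scl d A) = scl (c * d) A"
  and scl_mult_left [simp]: "scl c A * B = scl c (A * B)"
  and scl_one [simp]: "scl 1 A = A"
  and scl_zero_left [simp]: "scl 0 A = 0"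
  and scl_zero_right [simp]: "scl c 0 = 0"
  and scl_add_right: "scl c (A + B) = scl c A + scl c B"
  and scl_add_left: "scl (c + d) A = scl c A + scl d A"
  and scl_diff_right: "scl c (A - B) = scl c A - scl c B"
  and scl_diff_left: "scl (c - d) A = scl c A - scl d A"
  and scl_minus_right: "scl c (- A) = - scl c A"
  and scl_minus_left: "scl (- c) A = - scl c A"
  by (rule linop_eqI; simp add: op_app_simps algebra_simps)+

lemma scl_mult_right [simp]: "A * scl c B = scl c (A * B)"
  by (rule linop_eqI) (simp add: op_app_simps op_app_scale flip: op_app_inject,
    metis (no_types, lifting) ext op_app_scale op_app_simps(7))

lemma scl_eq_0_iff: "scl c A = 0 \<longleftrightarrow> c = 0 \<or> A = 0"
proof -
  have "A = 0" if "scl c A = 0" "c \<noteq> 0"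
  proof (rule linop_eqI)
    fix u i
    have "c * op_app A u i = 0" using that(1) by (metis op_app_simps(1,7))
    then show "op_app A u i = op_app 0 u i" using that(2) by (simp add: op_app_simps)
  qed
  then show ?thesis by auto
qed

lemma scl_power [simp]: "scl c A ^ n = scl (c ^ n) (A ^ n)"
  by (induction n) (simp_all add: mult_ac)

lemma scl_sum_right: "scl c (\<Sum>i\<in>S. f i) = (\<Sum>i\<in>S. scl c (f i))"
  by (induction S rule: infinite_finite_induct) (auto simp: scl_add_right)

lemma scl_sum_left: "scl (\<Sum>i\<in>S. f i) A = (\<Sum>i\<in>S. scl (f i) A)"
  by (induction S rule: infinite_finite_induct) (auto simp: scl_add_left)

text \<open>Power series are separated in the h-adic topology. This replaces limits of operators in
  what follows.\<close>

lemma eq_zero_if_X_divisible: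
  assumes "\<And>N. \<exists>R. A = scl (fps_X ^ N) R"
  shows "A = 0"
proof (rule linop_eqI)
  fix u i
  show "op_app A u i = op_app 0 u i"
  proof (rule fps_ext)
    fix k
    obtain R where "A = scl (fps_X ^ Suc k) R" using assms by blast
    then show "fps_nth (op_app A u i) k = fps_nth (op_app 0 u i) k"
      by (simp add: op_app_simps fps_X_power_mult_nth del: power_Suc)
  qed
qed

section \<open>Exponentials\<close>

definition exp_coeff :: "nat \<Rightarrow> complex fps" where
  "exp_coeff m = fps_const (1 / fact m) * fps_X ^ m"

text \<open>\<open>Q\<close> is exp (h A), specified by its truncations modulo every power of h,
  because \<open>linop\<close> carries no topology in which to sum the series.\<close>

definition is_qexp :: "linop \<Rightarrow> linop \<Rightarrow> bool" where
  "is_qexp A Q \<longleftrightarrow>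
    (\<forall>N. \<exists>R. Q = (\<Sum>m<N. scl (exp_coeff m) (A ^ m)) + scl (fps_X ^ N) R)"

lemma power_intertwine: "S * A = B * S \<Longrightarrow> S * A ^ m = B ^ m * (S :: 'a :: monoid_mult)"
  by (induction m) (simp, metis mult.assoc power_Suc)

text \<open>The truncated sums are intertwined term by term, and a difference divisible by every
  power of h vanishes. The case B = A, S = 1 is uniqueness of the exponential.\<close>

lemma is_qexp_intertwine:
  assumes "is_qexp A Q" "is_qexp B Q'" "S * A = B * S"
  shows "S * Q = Q' * S"
proof -
  have "S * Q - Q' * S = 0"
  proof (rule eq_zero_if_X_divisible)
    fix N
    obtain R where R: "Q = (\<Sum>m<N. scl (exp_coeff m) (A ^ m)) + scl (fps_X ^ N) R"
      using assms(1) unfolding is_qexp_def by blast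
    obtain R' where R': "Q' = (\<Sum>m<N. scl (exp_coeff m) (B ^ m)) + scl (fps_X ^ N) R'"
      using assms(2) unfolding is_qexp_def by blast
    have "S * (\<Sum>m<N. scl (exp_coeff m) (A ^ m)) = (\<Sum>m<N. scl (exp_coeff m) (B ^ m)) * S"
      by (simp add: sum_distrib_left sum_distrib_right power_intertwine[OF assms(3)])
    then have "S * Q - Q' * S = scl (fps_X ^ N) (S * R - R' * S)"
      unfolding R R' by (simp add: algebra_simps scl_diff_right)
    then show "\<exists>R. S * Q - Q' * S = scl (fps_X ^ N) R" by blast
  qed
  then show ?thesis by simp
qed

lemma is_qexp_unique: "is_qexp A Q \<Longrightarrow> is_qexp A Q' \<Longrightarrow> Q = Q'"
  using is_qexp_intertwine[of A Q A Q' 1] by simp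

lemma scl_cancel: "c \<noteq> 0 \<Longrightarrow> scl c A = scl c B \<Longrightarrow> A = B"
  using scl_eq_0_iff[of c "A - B"] by (simp add: scl_diff_right)

section \<open>Binomial expansion for q-commuting operators\<close>

lemma q_commute_power:
  assumes "x * y = scl p (y * x)"
  shows "x * y ^ i = scl (p ^ i) (y ^ i * x)"
proof (induction i)
  case (Suc i)
  have "x * y ^ Suc i = x * y ^ i * y" by (simp add: power_Suc2 mult.assoc del: power_Suc)
  also have "\<dots> = scl (p ^ i) (y ^ i * (x * y))" by (simp add: Suc mult.assoc)
  also have "\<dots> = scl (p ^ Suc i) (y ^ i * y * x)" by (simp add: assms mult.assoc mult_ac)
  finally show ?case by (simp add: power_Suc2 del: power_Suc)
qed simp

text \<open>
  The \<open>q\<close>-binomial theorem in terms of divided powers: \<open>br k\<close> is the \<open>p\<close>-integer \<open>k\<close> and \<open>\<iota> k\<close> is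
  \<open>z\<^sup>k\<close> over the \<open>p\<close>-factorial of \<open>k\<close>.
\<close>

lemma q_binomial:
  fixes br \<iota> :: "nat \<Rightarrow> complex fps"
  assumes comm: "x * y = scl p (y * x)"
    and br0: "br 0 = 0" and br_add: "\<And>i j. br (i + j) = br i + p ^ i * br j"
    and br_nz: "\<And>k. br (Suc k) \<noteq> 0"
    and \<iota>0: "\<iota> 0 = 1" and \<iota>: "\<And>k. br (Suc k) * \<iota> (Suc k) = z * \<iota> k"
  shows "scl (\<iota> n) ((y + x) ^ n) = (\<Sum>i\<le>n. scl (\<iota> i * \<iota> (n - i)) (y ^ i * x ^ (n - i)))"
proof (induction n)
  case 0
  then show ?case by (simp add: \<iota>0)
next
  case (Suc n)
  let ?u = "\<lambda>i. scl (z * \<iota> i * \<iota> (n - i)) (y ^ Suc i * x ^ (n - i))"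
  let ?v = "\<lambda>i. scl (z * p ^ i * \<iota> i * \<iota> (n - i)) (y ^ i * x ^ (Suc n - i))"
  \<comment> \<open>Both sides are multiplied by \<open>br (Suc n)\<close>. On the left a factor y +
    x is split off, whose x picks up p ^ i on its way past y ^ i; on the right \<open>br_add\<close>
    splits the scalar. The two halves then match after an index shift in the first.\<close>
  have L: "scl (br (Suc n)) (scl (\<iota> (Suc n)) ((y + x) ^ Suc n)) = (\<Sum>i\<le>n. ?u i) + (\<Sum>i\<le>n. ?v i)"
  proof -
    have "scl (br (Suc n)) (scl (\<iota> (Suc n)) ((y + x) ^ Suc n)) =
        scl z ((y + x) * scl (\<iota> n) ((y + x) ^ n))"
      by (simp add: \<iota>)
    also have "\<dots> = (\<Sum>i\<le>n. scl (z * \<iota> i * \<iota> (n - i)) ((y + x) * (y ^ i * x ^ (n - i))))"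
      by (simp add: Suc sum_distrib_left scl_sum_right mult.assoc)
    also have "\<dots> = (\<Sum>i\<le>n. ?u i + ?v i)"
    proof (rule sum.cong[OF refl])
      fix i assume "i \<in> {..n}"
      then have "x ^ (Suc n - i) = x * x ^ (n - i)" by (simp add: Suc_diff_le)
      moreover have "x * (y ^ i * x ^ (n - i)) = scl (p ^ i) (y ^ i * x) * x ^ (n - i)"
        by (simp add: mult.assoc[symmetric] q_commute_power[OF comm])
      ultimately show "scl (z * \<iota> i * \<iota> (n - i)) ((y + x) * (y ^ i * x ^ (n - i))) = ?u i + ?v i"
        by (simp add: distrib_right scl_add_right mult.assoc mult_ac)
    qed
    finally show ?thesis by (simp add: sum.distrib)
  qed
  let ?w = "\<lambda>c i. scl (c * \<iota> i * \<iota> (Suc n - i)) (y ^ i * x ^ (Suc n - i))"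
  have "scl (br (Suc n)) (\<Sum>i\<le>Suc n. scl (\<iota> i * \<iota> (Suc n - i)) (y ^ i * x ^ (Suc n - i)))
      = (\<Sum>i\<le>Suc n. ?w (br i) i + ?w (p ^ i * br (Suc n - i)) i)"
    unfolding scl_sum_right
  proof (rule sum.cong[OF refl])
    fix i assume "i \<in> {..Suc n}"
    then have "br (Suc n) = br i + p ^ i * br (Suc n - i)" using br_add[of i "Suc n - i"] by simp
    then show "scl (br (Suc n)) (scl (\<iota> i * \<iota> (Suc n - i)) (y ^ i * x ^ (Suc n - i))) =
        ?w (br i) i + ?w (p ^ i * br (Suc n - i)) i"
      by (simp add: scl_add_left[symmetric] algebra_simps)
  qed
  also have "\<dots> = (\<Sum>i\<le>Suc n. ?w (br i) i) + (\<Sum>i\<le>Suc n. ?w (p ^ i * br (Suc n - i)) i)"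
    by (rule sum.distrib)
  also have "(\<Sum>i\<le>Suc n. ?w (br i) i) = (\<Sum>i\<le>n. ?u i)"
    by (subst sum.atMost_Suc_shift) (simp add: br0 \<iota> mult.assoc[symmetric])
  also have "(\<Sum>i\<le>Suc n. ?w (p ^ i * br (Suc n - i)) i) = (\<Sum>i\<le>n. ?v i)"
  proof -
    have "?w (p ^ i * br (Suc n - i)) i = ?v i" if "i \<le> n" for i
    proof -
      have "br (Suc n - i) * \<iota> (Suc n - i) = z * \<iota> (n - i)"
        using \<iota>[of "n - i"] that by (simp add: Suc_diff_le)
      then have "p ^ i * br (Suc n - i) * \<iota> i * \<iota> (Suc n - i) = z * p ^ i * \<iota> i * \<iota> (n - i)"
        by (metis (no_types, opaque_lifting) mult.assoc mult.commute)
      then show ?thesis by (simp only:)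
    qed
    then show ?thesis by (simp add: br0)
  qed
  finally show ?case using scl_cancel[OF br_nz[of n]] L by metis
qed

lemma exp_coeff_Suc: "of_nat (Suc k) * exp_coeff (Suc k) = fps_X * exp_coeff k"
  unfolding exp_coeff_def fps_of_nat[symmetric]
  by (simp add: mult.assoc[symmetric] del: of_nat_Suc)

lemma exp_coeff_mult_X_power: "i \<le> n \<Longrightarrow> exp_coeff i * fps_X ^ (n - i) = fps_X ^ n * fps_const (1 / fact i)"
  by (simp add: exp_coeff_def mult_ac flip: power_add)

lemma is_qexp_add:
  assumes "is_qexp A Q" "is_qexp B Q'" and comm: "A * B = B * A"
  shows "is_qexp (A + B) (Q * Q')"
  unfolding is_qexp_def
proof
  fix N
  obtain R where R: "Q = (\<Sum>m<N. scl (exp_coeff m) (A ^ m)) + scl (fps_X ^ N) R"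
    using assms(1) unfolding is_qexp_def by blast
  \<comment> \<open>A remainder is needed for every truncation order: the term of degree i in A,
    divisible by h^i, is paired with the truncation of Q' at N - i. Then all remainders are
    divisible by h^N, and the main terms fill the triangle i + j < N.\<close>
  obtain R' where R': "\<And>k. Q' = (\<Sum>m<k. scl (exp_coeff m) (B ^ m)) + scl (fps_X ^ k) (R' k)"
    using assms(2) unfolding is_qexp_def by metis
  \<comment> \<open>The case p = 1, in which the divided powers are h^k / k!.\<close>
  have binom: "scl (exp_coeff n) ((A + B) ^ n) =
      (\<Sum>i\<le>n. scl (exp_coeff i * exp_coeff (n - i)) (A ^ i * B ^ (n - i)))" for n
    by (rule q_binomial[where p = 1 and br = of_nat and z = fps_X])
      (simp_all add: comm exp_coeff_Suc del: of_nat_Suc, simp add: exp_coeff_def)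
  have "(\<Sum>i<N. scl (exp_coeff i) (A ^ i)) * Q' =
      (\<Sum>i<N. scl (exp_coeff i) (A ^ i) * ((\<Sum>j<N - i. scl (exp_coeff j) (B ^ j)) + scl (fps_X ^ (N - i)) (R' (N - i))))"
    unfolding sum_distrib_right by (intro sum.cong refl arg_cong2[where f = "(*)"] R')
  also have "\<dots> = (\<Sum>i<N. \<Sum>j<N - i. scl (exp_coeff i * exp_coeff j) (A ^ i * B ^ j)) +
      (\<Sum>i<N. scl (exp_coeff i * fps_X ^ (N - i)) (A ^ i * R' (N - i)))"
    by (simp add: distrib_left sum_distrib_left sum.distrib mult_ac)
  also have "(\<Sum>i<N. \<Sum>j<N - i. scl (exp_coeff i * exp_coeff j) (A ^ i * B ^ j)) =
      (\<Sum>(i, j)\<in>{(i, j). i + j < N}. scl (exp_coeff i * exp_coeff j) (A ^ i * B ^ j))"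
    by (subst sum.Sigma) (auto intro!: sum.cong)
  also have "\<dots> = (\<Sum>n<N. scl (exp_coeff n) ((A + B) ^ n))"
    unfolding binom by (rule sum.triangle_reindex)
  also have "(\<Sum>i<N. scl (exp_coeff i * fps_X ^ (N - i)) (A ^ i * R' (N - i))) =
      scl (fps_X ^ N) (\<Sum>i<N. scl (fps_const (1 / fact i)) (A ^ i * R' (N - i)))"
    by (simp add: scl_sum_right exp_coeff_mult_X_power)
  finally have "Q * Q' = (\<Sum>n<N. scl (exp_coeff n) ((A + B) ^ n)) +
      scl (fps_X ^ N) ((\<Sum>i<N. scl (fps_const (1 / fact i)) (A ^ i * R' (N - i))) + R * Q')"
    by (subst R) (simp add: distrib_right scl_add_right)
  then show "\<exists>R. Q * Q' = (\<Sum>n<N. scl (exp_coeff n) ((A + B) ^ n)) + scl (fps_X ^ N) R"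
    by blast
qed

lemma fps_nth_sum_X_power:
  "fps_nth (\<Sum>m<N. fps_X ^ m * c m) k = (\<Sum>m<N. if m \<le> k then fps_nth (c m) (k - m) else 0)"
  by (simp add: fps_sum_nth fps_X_power_mult_nth) (rule sum.cong; auto)

lemma is_qexp_scalar: "is_qexp (scl (fps_const c) 1) (scl (fps_exp c) 1)"
  unfolding is_qexp_def
proof
  fix N
  have "fps_exp c = (\<Sum>m<N. fps_X ^ m * (fps_const (1 / fact m) * fps_const c ^ m)) +
      fps_X ^ N * fps_shift N (fps_exp c)"
  proof (rule fps_ext)
    fix k
    have "(\<Sum>m<N. if m \<le> k then fps_nth (fps_const (c ^ m / fact m)) (k - m) else 0) =
        (\<Sum>m<N. if m = k then c ^ k / fact k else 0)"
      by (rule sum.cong) auto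
    then show "fps_nth (fps_exp c) k = fps_nth ((\<Sum>m<N. fps_X ^ m *
        (fps_const (1 / fact m) * fps_const c ^ m)) + fps_X ^ N * fps_shift N (fps_exp c)) k"
      by (simp add: fps_nth_sum_X_power fps_X_power_mult_nth)
  qed
  then show "\<exists>R. scl (fps_exp c) 1 =
      (\<Sum>m<N. scl (exp_coeff m) (scl (fps_const c) 1 ^ m)) + scl (fps_X ^ N) R"
    by (intro exI[of _ "scl (fps_shift N (fps_exp c)) 1"])
      (simp add: exp_coeff_def mult_ac scl_add_left[symmetric] scl_sum_left[symmetric])
qed

section \<open>Matrices as operators\<close>

text \<open>This embedding is not unital: \<open>emb n (1\<^sub>m n)\<close> is the projection to the first \<open>n\<close> coordinates.\<close>

definition emb :: "nat \<Rightarrow> complex fps mat \<Rightarrow> linop" where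
  "emb n A = Abs_linop (\<lambda>u i. if i < n then \<Sum>j<n. A $$ (i, j) * u j else 0)"

lemma emb_app: "op_app (emb n A) u i = (if i < n then \<Sum>j<n. A $$ (i, j) * u j else 0)"
  unfolding emb_def
  by (subst Abs_linop_inverse)
    (auto simp: fun_eq_iff distrib_left sum.distrib sum_distrib_left mult.left_commute)

lemma mat_mult_index:
  assumes "A \<in> carrier_mat n n" "B \<in> carrier_mat n n" "i < n" "j < n"
  shows "(A * B) $$ (i, j) = (\<Sum>k<n. A $$ (i, k) * B $$ (k, j))"
proof -
  have d: "dim_row A = n" "dim_col A = n" "dim_row B = n" "dim_col B = n"
    using assms by simp_all
  have "(A * B) $$ (i, j) = row A i \<bullet> col B j" using assms(3,4) d by simp
  also have "\<dots> = (\<Sum>k<n. row A i $ k * col B j $ k)"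
    by (simp add: scalar_prod_def d atLeast0LessThan)
  also have "\<dots> = (\<Sum>k<n. A $$ (i, k) * B $$ (k, j))"
    using assms(3,4) d by (intro sum.cong) auto
  finally show ?thesis .
qed

lemma emb_mult:
  assumes "A \<in> carrier_mat n n" "B \<in> carrier_mat n n"
  shows "emb n (A * B) = emb n A * emb n B"
proof (rule linop_eqI)
  fix u i
  have "(\<Sum>j<n. (\<Sum>k<n. A $$ (i, k) * B $$ (k, j)) * u j) = (\<Sum>j<n. \<Sum>k<n. A $$ (i, k) * (B $$ (k, j) * u j))"
    by (simp only: sum_distrib_right mult.assoc)
  also have "\<dots> = (\<Sum>k<n. \<Sum>j<n. A $$ (i, k) * (B $$ (k, j) * u j))"
    by (rule sum.swap)
  finally have *: "(\<Sum>j<n. (\<Sum>k<n. A $$ (i, k) * B $$ (k, j)) * u j) = (\<Sum>k<n. A $$ (i, k) * (\<Sum>j<n. B $$ (k, j) * u j))"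
    by (simp only: sum_distrib_left)
  show "op_app (emb n (A * B)) u i = op_app (emb n A * emb n B) u i"
  proof (cases "i < n")
    case True
    have "op_app (emb n (A * B)) u i = (\<Sum>j<n. (\<Sum>k<n. A $$ (i, k) * B $$ (k, j)) * u j)"
      unfolding emb_app using True by (simp add: mat_mult_index[OF assms] del: index_mult_mat)
    then show ?thesis unfolding * using True by (simp add: emb_app op_app_simps(6))
  qed (simp add: emb_app op_app_simps(6))
qed

lemma emb_diff:
  "A \<in> carrier_mat n n \<Longrightarrow> B \<in> carrier_mat n n \<Longrightarrow> emb n (A - B) = emb n A - emb n B"
  by (rule linop_eqI) (simp add: emb_app op_app_simps left_diff_distrib sum_subtractf)

lemma emb_smult: "A \<in> carrier_mat n n \<Longrightarrow> emb n (c \<cdot>\<^sub>m A) = scl c (emb n A)"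
  by (rule linop_eqI) (simp add: emb_app op_app_simps sum_distrib_left mult.assoc)

lemma emb_uminus: "A \<in> carrier_mat n n \<Longrightarrow> emb n (- A) = - emb n A"
  by (rule linop_eqI) (simp add: emb_app op_app_simps sum_negf)

lemma emb_zero: "emb n (0\<^sub>m n n) = 0"
  by (rule linop_eqI) (simp add: emb_app op_app_simps)

lemma emb_inject:
  assumes "A \<in> carrier_mat n n" "B \<in> carrier_mat n n" "emb n A = emb n B"
  shows "A = B"
proof (rule eq_matI)
  fix i j assume "i < dim_row B" "j < dim_col B"
  then have ij: "i < n" "j < n" using assms by auto
  have "op_app (emb n M) (\<lambda>k. if k = j then 1 else 0) i = M $$ (i, j)" for M
  proof -
    have "(\<Sum>k<n. M $$ (i, k) * (if k = j then 1 else 0)) = (\<Sum>k<n. if k = j then M $$ (i, j) else 0)"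
      by (rule sum.cong) auto
    then show ?thesis using ij by (simp add: emb_app)
  qed
  then show "A $$ (i, j) = B $$ (i, j)" using assms(3) by metis
qed (simp_all only: carrier_matD[OF assms(1)] carrier_matD[OF assms(2)])

lemma emb_one_mult:
  assumes "A \<in> carrier_mat n n"
  shows "emb n (1\<^sub>m n) * emb n A = emb n A" "emb n A * emb n (1\<^sub>m n) = emb n A"
  using emb_mult[OF one_carrier_mat assms] emb_mult[OF assms one_carrier_mat] assms by simp_all

text \<open>The projection on the right matters only for k = 0, where the matrix power is
  \<open>1\<^sub>m n\<close> but the power in the ring is 1.\<close>

lemma emb_pow:
  assumes "A \<in> carrier_mat n n"
  shows "emb n (A ^\<^sub>m k) = emb n A ^ k * emb n (1\<^sub>m n)"
proof (induction k)
  case 0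
  then show ?case using assms by simp
next
  case (Suc k)
  have "emb n (A ^\<^sub>m Suc k) = emb n A ^ k * (emb n (1\<^sub>m n) * emb n A)"
    using assms by (simp add: emb_mult Suc mult.assoc)
  also have "\<dots> = emb n A ^ Suc k * emb n (1\<^sub>m n)"
    using assms by (simp add: emb_one_mult mult.assoc power_Suc2 del: power_Suc)
  finally show ?case .
qed

lemma emb_pow_Suc:
  assumes "A \<in> carrier_mat n n"
  shows "emb n (A ^\<^sub>m Suc k) = emb n A ^ Suc k"
  using assms by (simp add: emb_pow emb_one_mult mult.assoc power_Suc2 del: power_Suc pow_mat.simps)

lemma mat_suminf_finite:
  assumes "\<And>m. f m \<in> carrier_mat n n" "\<And>m. m \<ge> M \<Longrightarrow> f m = 0\<^sub>m n n"
  shows "emb n (mat_suminf n f) = (\<Sum>m<M. emb n (f m))"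
proof -
  have entry: "mat_suminf n f $$ (i, j) = (\<Sum>m<M. f m $$ (i, j))" if "i < n" "j < n" for i j
  proof -
    have "(\<Sum>m. f m $$ (i, j)) = (\<Sum>m<M. f m $$ (i, j))"
      using that by (intro suminf_finite) (simp_all add: assms(2))
    then show ?thesis using that by (simp add: mat_suminf_def)
  qed
  have app: "op_app (\<Sum>m<M'. emb n (f m)) u i = (\<Sum>m<M'. op_app (emb n (f m)) u i)" for M' u i
    by (induction M') (simp_all add: op_app_simps)
  show ?thesis
  proof (rule linop_eqI)
    fix u i
    have "(\<Sum>j<n. (\<Sum>m<M. f m $$ (i, j)) * u j) = (\<Sum>m<M. \<Sum>j<n. f m $$ (i, j) * u j)"
      by (simp add: sum_distrib_right) (rule sum.swap)
    then show "op_app (emb n (mat_suminf n f)) u i = op_app (\<Sum>m<M. emb n (f m)) u i"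
      by (auto simp: emb_app app entry)
  qed
qed

lemma mat_suminf_carrier [simp]: "mat_suminf n f \<in> carrier_mat n n"
  by (simp add: mat_suminf_def)

lemma mat_qpow_carrier [simp]: "A \<in> carrier_mat n n \<Longrightarrow> mat_qpow A \<in> carrier_mat n n"
  by (simp add: mat_qpow_def)

text \<open>The factor h^m in \<open>exp_coeff m\<close> makes each coefficient of the series a
  finite sum, so the series converges h-adically; its tail from N on is a multiple of h^N for the
  same reason.\<close>

lemma suminf_exp_coeff:
  "\<exists>r. (\<Sum>m. exp_coeff m * c m) = (\<Sum>m<N. exp_coeff m * c m) + fps_X ^ N * r"
proof -
  let ?f = "\<lambda>m. exp_coeff m * c m"
  define F where "F = Abs_fps (\<lambda>k. \<Sum>m<Suc k. fps_nth (?f m) k)"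
  have nth: "fps_nth (\<Sum>m<M. ?f m) k = fps_nth F k" if "k < M" for M k
  proof -
    have "(\<Sum>m<M. fps_nth (?f m) k) = (\<Sum>m<Suc k. fps_nth (?f m) k)"
      using that by (intro sum.mono_neutral_right)
        (auto simp: exp_coeff_def mult.assoc fps_X_power_mult_nth)
    then show ?thesis by (simp add: fps_sum_nth F_def)
  qed
  have "?f sums F"
    unfolding sums_def
  proof (rule tendsto_fpsI)
    fix k
    show "\<forall>\<^sub>F M in sequentially. fps_nth (\<Sum>m<M. ?f m) k = fps_nth F k"
      by (rule eventually_sequentiallyI[of "Suc k"]) (simp add: nth)
  qed
  then have "(\<Sum>m. ?f m) = F" by (rule sums_unique[symmetric])
  moreover have "F = (\<Sum>m<N. ?f m) + fps_X ^ N * fps_shift N (F - (\<Sum>m<N. ?f m))"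
    by (rule fps_ext) (auto simp: fps_X_power_mult_nth nth)
  ultimately show ?thesis by metis
qed

text \<open>The exponential of \<open>emb n A\<close> in the operator ring has constant term 1,
  whereas the embedded matrix exponential vanishes off the first n coordinates; the second summand
  makes up the difference.\<close>

definition qexp_op :: "nat \<Rightarrow> complex fps mat \<Rightarrow> linop" where
  "qexp_op n A = emb n (mat_qpow A) + (1 - emb n (1\<^sub>m n))"

lemma emb_mat_qpow:
  assumes "A \<in> carrier_mat n n"
  shows "emb n (mat_qpow A) = emb n (1\<^sub>m n) * qexp_op n A"
    and "emb n (mat_qpow A) = qexp_op n A * emb n (1\<^sub>m n)"
  using assms by (simp_all add: qexp_op_def algebra_simps emb_one_mult)

lemma is_qexp_qexp_op:
  assumes A: "A \<in> carrier_mat n n"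
  shows "is_qexp (emb n A) (qexp_op n A)"
  unfolding is_qexp_def
proof
  fix N
  show "\<exists>R. qexp_op n A = (\<Sum>m<N. scl (exp_coeff m) (emb n A ^ m)) + scl (fps_X ^ N) R"
  proof (cases N)
    \<comment> \<open>The summand \<open>1 - emb n (1\<^sub>m n)\<close> is absorbed by the term m =
      0, which the empty sum lacks.\<close>
    case 0
    then show ?thesis by auto
  next
    case (Suc N')
    have "\<exists>r. mat_qpow A $$ (i, j) =
        (\<Sum>m<N. exp_coeff m * (A ^\<^sub>m m) $$ (i, j)) + fps_X ^ N * r" if "i < n" "j < n" for i j
    proof -
      have "mat_qpow A $$ (i, j) = (\<Sum>m. exp_coeff m * (A ^\<^sub>m m) $$ (i, j))"
        using that A by (simp add: mat_qpow_def mat_suminf_def exp_coeff_def)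
      then show ?thesis using suminf_exp_coeff by metis
    qed
    then obtain r where r: "\<And>i j. i < n \<Longrightarrow> j < n \<Longrightarrow> mat_qpow A $$ (i, j) =
        (\<Sum>m<N. exp_coeff m * (A ^\<^sub>m m) $$ (i, j)) + fps_X ^ N * r i j"
      by metis
    let ?R = "emb n (mat n n (\<lambda>(i, j). r i j))"
    have app: "op_app (\<Sum>m<M. scl (exp_coeff m) (emb n (A ^\<^sub>m m))) u i =
        (\<Sum>m<M. exp_coeff m * op_app (emb n (A ^\<^sub>m m)) u i)" for M u i
      by (induction M) (simp_all add: op_app_simps)
    have 1: "emb n (mat_qpow A) =
        (\<Sum>m<N. scl (exp_coeff m) (emb n (A ^\<^sub>m m))) + scl (fps_X ^ N) ?R"
    proof (rule linop_eqI)
      fix u i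
      have "(\<Sum>j<n. ((\<Sum>m<N. exp_coeff m * (A ^\<^sub>m m) $$ (i, j)) + fps_X ^ N * r i j) * u j) =
          (\<Sum>j<n. \<Sum>m<N. exp_coeff m * (A ^\<^sub>m m) $$ (i, j) * u j) + fps_X ^ N * (\<Sum>j<n. r i j * u j)"
        by (simp add: distrib_right sum.distrib sum_distrib_left sum_distrib_right mult.assoc)
      also have "(\<Sum>j<n. \<Sum>m<N. exp_coeff m * (A ^\<^sub>m m) $$ (i, j) * u j) =
          (\<Sum>m<N. exp_coeff m * (\<Sum>j<n. (A ^\<^sub>m m) $$ (i, j) * u j))"
        by (subst sum.swap) (simp add: sum_distrib_left mult.assoc)
      finally show "op_app (emb n (mat_qpow A)) u i =
          op_app ((\<Sum>m<N. scl (exp_coeff m) (emb n (A ^\<^sub>m m))) + scl (fps_X ^ N) ?R) u i"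
        by (auto simp: op_app_simps(3,7) app emb_app r)
    qed
    have "(\<Sum>m<N. scl (exp_coeff m) (emb n A ^ m)) =
        (\<Sum>m<N. scl (exp_coeff m) (emb n (A ^\<^sub>m m))) + (1 - emb n (1\<^sub>m n))"
      unfolding Suc sum.lessThan_Suc_shift using A
      by (simp add: emb_pow_Suc exp_coeff_def del: power_Suc pow_mat.simps(2))
    then show ?thesis unfolding qexp_op_def 1 by (intro exI[of _ ?R]) (simp add: algebra_simps)
  qed
qed

section \<open>Nilpotency\<close>

lemma commutator_power:
  fixes H a :: linop
  assumes "H * a - a * H = scl c a"
  shows "H * a ^ m - a ^ m * H = scl (of_nat m * c) (a ^ m)"
proof (induction m)
  case (Suc m)
  have "H * a ^ Suc m - a ^ Suc m * H = (H * a - a * H) * a ^ m + a * (H * a ^ m - a ^ m * H)"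
    by (simp add: algebra_simps)
  also have "\<dots> = scl (of_nat (Suc m) * c) (a ^ Suc m)"
    unfolding Suc assms by (simp add: scl_add_left[symmetric] algebra_simps)
  finally show ?case .
qed simp

text \<open>The powers of \<open>a\<close> are eigenvectors of \<open>ad H\<close> for distinct eigenvalues.\<close>

lemma commutator_powers_independent:
  fixes H a :: linop
  assumes ca: "H * a - a * H = scl c a" and c: "c \<noteq> 0"
    and "finite S" "(\<Sum>m\<in>S. scl (v m) (a ^ m)) = 0" "m \<in> S"
  shows "scl (v m) (a ^ m) = 0"
  using assms(3-)
proof (induction S arbitrary: v m rule: finite_induct)
  case (insert k S)
  let ?s = "\<lambda>S. (\<Sum>m\<in>S. scl (v m) (a ^ m))"
  have "0 = H * ?s (insert k S) - ?s (insert k S) * H - scl (of_nat k * c) (?s (insert k S))"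
    using insert.prems(1) by simp
  also have "\<dots> = (\<Sum>m\<in>insert k S. scl (v m) (H * a ^ m - a ^ m * H) - scl (of_nat k * c * v m) (a ^ m))"
    by (simp only: sum_distrib_left sum_distrib_right scl_sum_right flip: sum_subtractf)
      (simp add: scl_diff_right)
  also have "\<dots> = (\<Sum>m\<in>insert k S. scl ((of_nat m - of_nat k) * c * v m) (a ^ m))"
    by (simp add: commutator_power[OF ca] scl_diff_left[symmetric] algebra_simps)
  also have "\<dots> = (\<Sum>m\<in>S. scl ((of_nat m - of_nat k) * c * v m) (a ^ m))"
    using insert.hyps by simp
  finally have *: "(\<Sum>m\<in>S. scl ((of_nat m - of_nat k) * c * v m) (a ^ m)) = 0" by simp
  have S: "scl (v m) (a ^ m) = 0" if "m \<in> S" for m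
  proof -
    have "m \<noteq> k" using that insert.hyps by auto
    then have "(of_nat m - of_nat k :: complex fps) \<noteq> 0" by simp
    then show ?thesis using insert.IH[OF * that] c by (auto simp: scl_eq_0_iff)
  qed
  then have "?s S = 0" by simp
  then have "scl (v k) (a ^ k) = 0" using insert.prems(1) insert.hyps by simp
  then show ?case using S insert.prems(2) by auto
qed simp

text \<open>The powers of A with exponents from 1 to n^2 + 1 lie in a module of rank n^2 and are
  linearly dependent; by \<open>commutator_powers_independent\<close> one of them with a nonzero
  coefficient must vanish.\<close>

lemma nilpotent_if_commutator:
  fixes A H :: "complex fps mat"
  assumes A: "A \<in> carrier_mat n n" and H: "H \<in> carrier_mat n n"
    and comm: "H * A - A * H = c \<cdot>\<^sub>m A" and c: "c \<noteq> 0"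
  shows "\<exists>M. \<forall>k\<ge>M. A ^\<^sub>m k = 0\<^sub>m n n"
proof -
  define d where "d = Suc (n * n)"
  \<comment> \<open>Column k lists the entries of A^(k + 1). The last row is padding by zeros, which
    makes the matrix square and its determinant zero.\<close>
  define M where "M = mat d d (\<lambda>(r, k). if r < n * n then (A ^\<^sub>m Suc k) $$ (r div n, r mod n) else 0)"
  have M: "M \<in> carrier_mat d d" by (simp add: M_def)
  have "row M (n * n) = 0\<^sub>v d" by (rule eq_vecI) (auto simp: M_def d_def)
  then have "M = mat\<^sub>r d d (\<lambda>i. if i = n * n then 0\<^sub>v d else row M i)"
    by (intro eq_matI) (auto simp: M_def d_def)
  moreover have "det (mat\<^sub>r d d (\<lambda>i. if i = n * n then 0\<^sub>v d else row M i)) = 0"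
    by (rule det_row_0) (auto simp: M_def d_def)
  ultimately have "det M = 0" by simp
  then obtain v where v: "v \<in> carrier_vec d" "v \<noteq> 0\<^sub>v d" "M *\<^sub>v v = 0\<^sub>v d"
    using det_0_iff_vec_prod_zero[OF M] by auto
  have entry: "(\<Sum>k<d. (A ^\<^sub>m Suc k) $$ (i, j) * v $ k) = 0" if "i < n" "j < n" for i j
  proof -
    have r: "i * n + j < n * n" using that
      by (metis add.commute add_less_cancel_right less_le_trans mult.commute mult_Suc mult_le_mono1 Suc_leI nat_add_left_cancel_less)
    have "(M *\<^sub>v v) $ (i * n + j) = (\<Sum>k<d. (A ^\<^sub>m Suc k) $$ (i, j) * v $ k)"
      using r that v(1) by (auto simp: M_def d_def scalar_prod_def atLeast0LessThan simp del: pow_mat.simps intro!: sum.cong)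
    then show ?thesis using v(3) r by (simp add: d_def)
  qed
  let ?a = "emb n A"
  have app: "op_app (\<Sum>k<D. scl (v $ k) (emb n (A ^\<^sub>m Suc k))) u i =
      (\<Sum>k<D. v $ k * op_app (emb n (A ^\<^sub>m Suc k)) u i)" for D u i
    by (induction D) (simp_all add: op_app_simps)
  have "(\<Sum>k<d. scl (v $ k) (emb n (A ^\<^sub>m Suc k))) = 0"
  proof (rule linop_eqI)
    fix u i
    have "(\<Sum>k<d. v $ k * (\<Sum>j<n. (A ^\<^sub>m Suc k) $$ (i, j) * u j)) =
        (\<Sum>j<n. (\<Sum>k<d. (A ^\<^sub>m Suc k) $$ (i, j) * v $ k) * u j)"
      by (simp add: sum_distrib_left sum_distrib_right mult_ac del: pow_mat.simps) (rule sum.swap)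
    then show "op_app (\<Sum>k<d. scl (v $ k) (emb n (A ^\<^sub>m Suc k))) u i = op_app 0 u i"
      by (cases "i < n") (simp_all add: app emb_app op_app_simps(1) entry del: pow_mat.simps)
  qed
  then have sum0: "(\<Sum>m\<in>Suc ` {..<d}. scl (v $ (m - 1)) (?a ^ m)) = 0"
    by (simp add: sum.reindex emb_pow_Suc[OF A] del: pow_mat.simps power_Suc)
  obtain k where k: "k < d" "v $ k \<noteq> 0" using v(1,2) by (auto simp: vec_eq_iff)
  have "emb n H * ?a - ?a * emb n H = scl c ?a"
    using A H arg_cong[OF comm, of "emb n"] by (simp add: emb_mult emb_diff emb_smult)
  from commutator_powers_independent[OF this c _ sum0, of "Suc k"] k
  have "?a ^ Suc k = 0" by (simp add: scl_eq_0_iff del: power_Suc)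
  then have "emb n (A ^\<^sub>m Suc k) = emb n (0\<^sub>m n n)"
    by (simp only: emb_pow_Suc[OF A] emb_zero)
  then have "A ^\<^sub>m Suc k = 0\<^sub>m n n" using A by (intro emb_inject) auto
  have "A ^\<^sub>m (Suc k + l) = 0\<^sub>m n n" for l
  proof (induction l)
    case (Suc l)
    then show ?case using A by simp
  qed (use \<open>A ^\<^sub>m Suc k = _\<close> in simp)
  then show ?thesis by (metis le_Suc_ex)
qed

section \<open>Scalars\<close>

lemma q_pow_add: "q_pow (a + b) = q_pow a * q_pow b"
  by (simp add: q_pow_def fps_exp_add_mult)

lemma q_pow_0 [simp]: "q_pow 0 = 1"
  by (simp add: q_pow_def)

lemma q_pow_nth_0 [simp]: "fps_nth (q_pow c) 0 = 1"
  by (simp add: q_pow_def)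

lemma q_pow_nonzero [simp]: "q_pow c \<noteq> 0"
  by (simp add: q_pow_def)

lemma q_pow_power: "q_pow c ^ n = q_pow (of_nat n * c)"
  by (simp add: q_pow_def fps_exp_power_mult)

lemma q_pow_inverse [simp]: "q_pow c * q_pow (- c) = 1" "q_pow (- c) * q_pow c = 1"
  by (simp_all flip: q_pow_add)

abbreviation (input) p :: "complex fps" where "p \<equiv> q_pow (- 1)"

text \<open>This is (1 - p^n) / (1 - p), written without division by the non-unit 1 - p.\<close>

definition p_int :: "nat \<Rightarrow> complex fps" where
  "p_int n = (\<Sum>i<n. p ^ i)"

lemma p_int_0 [simp]: "p_int 0 = 0"
  and p_int_1: "p_int (Suc 0) = 1"
  and p_int_Suc: "p_int (Suc n) = p_int n + p ^ n"
  by (simp_all add: p_int_def)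

lemma p_int_add: "p_int (i + j) = p_int i + p ^ i * p_int j"
  by (induction j) (simp_all add: p_int_Suc algebra_simps power_add)

lemma p_int_Suc': "p_int (Suc n) = 1 + p * p_int n"
  using p_int_add[of 1 n] by (simp add: p_int_1)

lemma p_int_nth_0: "fps_nth (p_int n) 0 = of_nat n"
  by (induction n) (simp_all add: p_int_Suc fps_power_zeroth)

lemma p_int_nonzero: "p_int (Suc n) \<noteq> 0"
  using p_int_nth_0[of "Suc n"] by (metis fps_zero_nth of_nat_neq_0)

text \<open>The divisor in \<open>q_int\<close> has order one in h, so exactness of the division is
  shown by exhibiting the quotient: the p-integer up to a power of q.\<close>

lemma q_int_eq: "q_int n = q_pow ((of_nat n - 1) / 2) * p_int n"
proof -
  let ?d = "q_pow (1/2) - q_pow (-1/2)"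
  have "fps_nth ?d 1 = 1" by (simp add: q_pow_def)
  then have d: "?d \<noteq> 0" by force
  have "?d * (q_pow ((of_nat n - 1) / 2) * p_int n) = q_pow (of_nat n / 2) - q_pow (- of_nat n / 2)"
  proof -
    have e: "?d * q_pow ((of_nat n - 1) / 2) = q_pow (of_nat n / 2) * (1 - p)"
      by (simp add: left_diff_distrib right_diff_distrib flip: q_pow_add)
        (simp add: diff_divide_distrib add_divide_distrib algebra_simps)
    have g: "(1 - p) * p_int n = 1 - q_pow (- of_nat n)"
      unfolding p_int_def one_diff_power_eq[symmetric] by (simp add: q_pow_power)
    have "?d * (q_pow ((of_nat n - 1) / 2) * p_int n) = q_pow (of_nat n / 2) * (1 - q_pow (- of_nat n))"
      by (simp only: mult.assoc[symmetric] e) (simp only: mult.assoc g)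
    also have "\<dots> = q_pow (of_nat n / 2) - q_pow (- of_nat n / 2)"
      by (simp add: right_diff_distrib flip: q_pow_add)
    finally show ?thesis .
  qed
  then show ?thesis unfolding q_int_def using d by (metis nonzero_mult_div_cancel_left)
qed

lemma q_int_nth_0: "fps_nth (q_int n) 0 = of_nat n"
  by (simp add: q_int_eq p_int_nth_0)

lemma unit_div_mult: "fps_nth u 0 \<noteq> 0 \<Longrightarrow> u * (a / u) = (a :: complex fps)"
  by (simp add: fps_divide_unit mult_ac inverse_mult_eq_1')

lemma q_fact_nth_0: "fps_nth (q_fact n) 0 \<noteq> 0"
  by (induction n) (simp_all add: q_fact_def q_int_nth_0 del: of_nat_Suc)

lemma R_coeff_0 [simp]: "R_coeff 0 = 1"
  by (simp add: R_coeff_def q_fact_def)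

text \<open>The factor q^(n (n - 1) / 4) cancels the powers of q between [n]! and the p-factorial.
  What is left is (1 - p)^n over the p-factorial, the coefficient of a p-exponential.\<close>

lemma R_coeff_Suc: "p_int (Suc n) * R_coeff (Suc n) = (1 - p) * R_coeff n"
proof -
  let ?s = "\<lambda>n. q_pow (of_nat n * (of_nat n - 1) / 4)"
  have R: "q_fact m * R_coeff m = (1 - p) ^ m * ?s m" for m
    unfolding R_coeff_def using unit_div_mult[OF q_fact_nth_0, of m "(1 - p) ^ m"]
    by (metis mult.assoc)
  have s: "?s (Suc n) = ?s n * q_pow (of_nat n / 2)"
    unfolding q_pow_add[symmetric] by (simp add: field_simps)
  have f: "q_fact (Suc n) = q_fact n * q_int (Suc n)"
    by (simp add: q_fact_def mult_ac)
  have "q_fact n * q_pow (of_nat n / 2) * (p_int (Suc n) * R_coeff (Suc n)) = q_fact (Suc n) * R_coeff (Suc n)"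
    unfolding f q_int_eq by (simp add: mult_ac)
  also have "\<dots> = (1 - p) * q_pow (of_nat n / 2) * ((1 - p) ^ n * ?s n)"
    unfolding R s by (simp add: mult_ac)
  also have "\<dots> = q_fact n * q_pow (of_nat n / 2) * ((1 - p) * R_coeff n)"
    unfolding R[symmetric] by (simp add: mult_ac)
  finally have "q_fact n * q_pow (of_nat n / 2) * (p_int (Suc n) * R_coeff (Suc n)) =
      q_fact n * q_pow (of_nat n / 2) * ((1 - p) * R_coeff n)" .
  moreover have "q_fact n * q_pow (of_nat n / 2) \<noteq> 0"
    using q_fact_nth_0[of n] by (metis fps_zero_nth mult_eq_0_iff q_pow_nonzero)
  ultimately show ?thesis by (metis mult_left_cancel)
qed

section \<open>A product formula for the coefficients\<close>

text \<open>
  The recursion says that \<open>b n\<close> times the \<open>p\<close>-factorial of \<open>n\<close> is a continuous \<open>p\<close>-Hermite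
  polynomial in \<open>\<beta>\<^sub>1\<close>; \<open>coeff_product\<close> below is the inverse of the linearization formula for these.
\<close>

locale hermite_coeffs =
  fixes b :: "nat \<Rightarrow> complex fps" and \<beta>\<^sub>1 :: "complex fps"
  assumes b_0: "b 0 = 1"
    and b_Suc: "\<And>n. p_int (Suc n) * b (Suc n) = \<beta>\<^sub>1 * b n - (1 - p) * (if n = 0 then 0 else b (n - 1))"
begin

definition p_fact :: "nat \<Rightarrow> complex fps" where
  "p_fact n = (\<Prod>k<n. p_int (Suc k))"

definition inv_fact :: "nat \<Rightarrow> complex fps" where
  "inv_fact n = inverse (p_fact n)"

definition g :: "nat \<Rightarrow> complex fps" where
  "g n = p_fact n * b n"

text \<open>Coefficient of y^n x^n in \<theta>(- y x) for x y = p y x. The product is p^(n (n - 1) /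
  2), the cost of sorting (y x)^n.\<close>

definition s :: "nat \<Rightarrow> complex fps" where
  "s n = (-1) ^ n * (\<Prod>i<n. p ^ i) * R_coeff n"

lemma p_fact_inverse: "p_fact n * inv_fact n = 1"
proof -
  have "fps_nth (p_fact n) 0 \<noteq> 0"
    by (induction n) (simp_all add: p_fact_def p_int_nth_0 del: of_nat_Suc)
  then show ?thesis by (simp add: inv_fact_def inverse_mult_eq_1')
qed

lemma inv_fact_0: "inv_fact 0 = 1"
  by (simp add: inv_fact_def p_fact_def)

lemma inv_fact_Suc: "p_int (Suc n) * inv_fact (Suc n) = inv_fact n"
proof -
  have "p_fact n * (p_int (Suc n) * inv_fact (Suc n)) = p_fact n * inv_fact n"
    using p_fact_inverse[of "Suc n"] p_fact_inverse[of n] by (simp add: p_fact_def mult_ac)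
  moreover have "p_fact n \<noteq> 0" using p_fact_inverse[of n] by auto
  ultimately show ?thesis by simp
qed

lemma b_eq: "b n = g n * inv_fact n"
proof -
  have "g n * inv_fact n = b n * (p_fact n * inv_fact n)" by (simp add: g_def mult_ac)
  then show ?thesis by (simp add: p_fact_inverse)
qed

lemma g_Suc: "g (Suc n) = \<beta>\<^sub>1 * g n - (1 - p) * p_int n * g (n - 1)"
proof (cases n)
  case (Suc m)
  have "g (Suc n) = p_fact n * (p_int (Suc n) * b (Suc n))" by (simp add: g_def p_fact_def mult_ac)
  also have "\<dots> = \<beta>\<^sub>1 * g n - (1 - p) * p_int n * g (n - 1)"
    unfolding b_Suc by (simp add: Suc g_def p_fact_def algebra_simps)
  finally show ?thesis .
qed (use b_Suc[of 0] in \<open>simp add: g_def p_fact_def p_int_1\<close>)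

lemma s_0: "s 0 = 1"
  by (simp add: s_def)

lemma s_Suc: "p_int (Suc n) * s (Suc n) = - ((1 - p) * p ^ n * s n)"
proof -
  have "p_int (Suc n) * s (Suc n) = - ((-1) ^ n * (\<Prod>i<n. p ^ i) * p ^ n * (p_int (Suc n) * R_coeff (Suc n)))"
    by (simp add: s_def mult_ac)
  then show ?thesis unfolding R_coeff_Suc by (simp add: s_def mult_ac)
qed

definition b_shift :: "nat \<Rightarrow> nat \<Rightarrow> complex fps" where
  "b_shift j n = (if n \<le> j then b (j - n) else 0)"

text \<open>Coefficient of y^i x^j in b(y) \<theta>(- y x) b(x), with every y to the left;
  \<open>b_shift j n\<close> is the coefficient of z^j in z^n b(z).\<close>

definition conv :: "nat \<Rightarrow> nat \<Rightarrow> complex fps" where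
  "conv i j = (\<Sum>n\<le>i. s n * b (i - n) * b_shift j n)"

text \<open>The p-integer of i + 1 splits along i + 1 = (i + 1 - n) + n. The first part triggers the
  recursion of \<open>b\<close>, the second that of \<open>s\<close>, and there the powers of p
  combine to p^i for every n.\<close>

lemma conv_Suc:
  "p_int (Suc i) * conv (Suc i) j = \<beta>\<^sub>1 * conv i j
     - (1 - p) * (if i = 0 then 0 else conv (i - 1) j)
     - p ^ i * (1 - p) * (if j = 0 then 0 else conv i (j - 1))"
proof -
  let ?u = "\<lambda>n. s n * (p_int (Suc i - n) * b (Suc i - n)) * b_shift j n"
  let ?v = "\<lambda>n. p_int n * s n * p ^ (Suc i - n) * b (Suc i - n) * b_shift j n"
  have "p_int (Suc i) * conv (Suc i) j = (\<Sum>n\<le>Suc i. ?u n + ?v n)"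
    unfolding conv_def sum_distrib_left
  proof (rule sum.cong[OF refl])
    fix n assume "n \<in> {..Suc i}"
    then have *: "p_int (Suc i) = p_int (Suc i - n) + p ^ (Suc i - n) * p_int n"
      using p_int_add[of "Suc i - n" n] by simp
    show "p_int (Suc i) * (s n * b (Suc i - n) * b_shift j n) = ?u n + ?v n"
      unfolding * by (simp only: algebra_simps)
  qed
  also have "\<dots> = (\<Sum>n\<le>i. ?u n) + (\<Sum>n\<le>i. ?v (Suc n))"
    unfolding sum.distrib by (subst (2) sum.atMost_Suc_shift) simp
  also have "(\<Sum>n\<le>i. ?u n) = \<beta>\<^sub>1 * conv i j
      - (1 - p) * (\<Sum>n\<le>i. s n * (if i - n = 0 then 0 else b (i - n - 1)) * b_shift j n)"
    unfolding conv_def sum_distrib_left sum_subtractf[symmetric]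
  proof (rule sum.cong[OF refl])
    fix n assume "n \<in> {..i}"
    then have *: "Suc i - n = Suc (i - n)" by auto
    show "?u n = \<beta>\<^sub>1 * (s n * b (i - n) * b_shift j n)
        - (1 - p) * (s n * (if i - n = 0 then 0 else b (i - n - 1)) * b_shift j n)"
      unfolding * b_Suc by (simp only: algebra_simps)
  qed
  also have "(\<Sum>n\<le>i. s n * (if i - n = 0 then 0 else b (i - n - 1)) * b_shift j n) =
      (if i = 0 then 0 else conv (i - 1) j)"
    by (cases i) (auto simp: conv_def intro!: sum.cong)
  also have "(\<Sum>n\<le>i. ?v (Suc n)) = - (p ^ i * (1 - p) * (if j = 0 then 0 else conv i (j - 1)))"
  proof -
    have "?v (Suc n) = - (p ^ i * (1 - p)) * (if j = 0 then 0 else s n * b (i - n) * b_shift (j - 1) n)"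
      if "n \<le> i" for n
    proof -
      have "p ^ n * p ^ (i - n) = p ^ i" using that by (simp flip: power_add)
      moreover have "b_shift j (Suc n) = (if j = 0 then 0 else b_shift (j - 1) n)"
        by (auto simp: b_shift_def)
      ultimately show ?thesis unfolding s_Suc by (auto simp: mult_ac)
    qed
    then show ?thesis by (simp add: conv_def sum_distrib_left sum_negf)
  qed
  finally show ?thesis by simp
qed

lemma pred_inv_fact: "n \<noteq> 0 \<Longrightarrow> inv_fact (n - 1) = p_int n * inv_fact n"
  using inv_fact_Suc[of "n - 1"] by simp

text \<open>Both sides obey the recurrence \<open>conv_Suc\<close> in i. For the right-hand side
  this is \<open>g_Suc\<close> at k + j, with p_int (k + j) = p_int k + p^k p_int j accounting for
  the two subtracted terms.\<close>

lemma coeff_product: "conv i j = g (i + j) * inv_fact i * inv_fact j"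
proof (induction i arbitrary: j rule: less_induct)
  case (less i)
  show ?case
  proof (cases i)
    case 0
    then show ?thesis by (simp add: conv_def s_0 b_0 b_shift_def inv_fact_0 b_eq[symmetric])
  next
    case (Suc k)
    \<comment> \<open>For k = 0 the truncated subtraction in the argument of \<open>g\<close> is
      harmless, because \<open>p_int 0 = 0\<close>; likewise for j in the next fact.\<close>
    have 1: "(if k = 0 then 0 else conv (k - 1) j) =
        p_int k * g (k + j - 1) * inv_fact k * inv_fact j"
    proof (cases "k = 0")
      case False
      then have "conv (k - 1) j = g (k - 1 + j) * inv_fact (k - 1) * inv_fact j"
        using Suc by (intro less.IH) simp
      moreover have "k - 1 + j = k + j - 1" using False by simp
      ultimately show ?thesis using False by (simp only: pred_inv_fact simp_thms if_False mult_ac)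
    qed simp
    have 2: "(if j = 0 then 0 else conv k (j - 1)) =
        p_int j * g (k + j - 1) * inv_fact k * inv_fact j"
    proof (cases "j = 0")
      case False
      then have "conv k (j - 1) = g (k + (j - 1)) * inv_fact k * inv_fact (j - 1)"
        using Suc by (intro less.IH) simp
      moreover have "k + (j - 1) = k + j - 1" using False by simp
      ultimately show ?thesis using False by (simp only: pred_inv_fact simp_thms if_False mult_ac)
    qed simp
    have 3: "conv k j = g (k + j) * inv_fact k * inv_fact j" using less.IH[of k j] Suc by simp
    have "p_int (Suc k) * conv (Suc k) j = g (Suc (k + j)) * inv_fact k * inv_fact j"
      unfolding conv_Suc 1 2 3 g_Suc p_int_add by (simp only: algebra_simps)
    also have "\<dots> = p_int (Suc k) * (g (i + j) * inv_fact i * inv_fact j)"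
      unfolding inv_fact_Suc[of k, symmetric] by (simp add: Suc mult_ac)
    finally show ?thesis unfolding Suc using p_int_nonzero[of k] by simp
  qed
qed

end

section \<open>Power series in nilpotent operators\<close>

text \<open>Truncation at the order of nilpotency keeps bounds out of the terms; by
  \<open>nil_eval_eq\<close> every larger bound gives the same value.\<close>

definition nil_eval :: "(nat \<Rightarrow> complex fps) \<Rightarrow> linop \<Rightarrow> linop" where
  "nil_eval f u = (\<Sum>n<(LEAST N. u ^ N = 0). scl (f n) (u ^ n))"

lemma power_eq_0_mono: "u ^ N = (0 :: linop) \<Longrightarrow> N \<le> n \<Longrightarrow> u ^ n = 0"
  using power_add[of u N "n - N"] by simp

lemma nil_eval_eq:
  assumes "u ^ N = 0"
  shows "nil_eval f u = (\<Sum>n<N. scl (f n) (u ^ n))"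
proof -
  let ?L = "LEAST N. u ^ N = 0"
  have L: "u ^ ?L = 0" "?L \<le> N" using assms by (auto intro: LeastI Least_le)
  show ?thesis unfolding nil_eval_def
    using L(2) by (intro sum.mono_neutral_left) (auto simp: power_eq_0_mono[OF L(1)])
qed

text \<open>Together with \<open>is_qexp_intertwine\<close> this reduces the exchange of series and
  Cartan elements to the exchange of their arguments.\<close>

lemma nil_eval_intertwine:
  assumes "u * S = S * v" "u ^ N = 0" "v ^ N = 0"
  shows "nil_eval f u * S = S * nil_eval f v"
  using power_intertwine[OF assms(1)[symmetric]]
  by (simp add: nil_eval_eq[OF assms(2)] nil_eval_eq[OF assms(3)] sum_distrib_left sum_distrib_right)

lemma power_mult_commuting:
  fixes a c :: "'a :: monoid_mult"
  assumes "a * c = c * a"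
  shows "(a * c) ^ n = a ^ n * c ^ n"
proof (induction n)
  case (Suc n)
  have "(a * c) ^ Suc n = a * (c * a ^ n) * c ^ n" by (simp add: Suc mult.assoc)
  also have "c * a ^ n = a ^ n * c" by (rule power_intertwine) (simp add: assms)
  finally show ?case by (simp add: mult.assoc)
qed simp

lemma power_q_commuting:
  fixes x y :: linop
  assumes "x * y = scl c (y * x)"
  shows "(y * x) ^ n = scl (\<Prod>i<n. c ^ i) (y ^ n * x ^ n)"
proof (induction n)
  case (Suc n)
  have "x * y ^ n = scl (c ^ n) (y ^ n * x)" by (rule q_commute_power[OF assms])
  have "(y * x) ^ Suc n = scl (\<Prod>i<n. c ^ i) (y * (x * y ^ n) * x ^ n)"
    by (simp add: Suc mult.assoc)
  then show ?case unfolding q_commute_power[OF assms] by (simp add: mult.assoc mult_ac)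
qed simp

section \<open>The addition formula, and the intertwining property of the series of R\<close>

context hermite_coeffs
begin

lemma sum_b_shift:
  assumes "y ^ N = 0"
  shows "(\<Sum>i<N. scl (b_shift i n) (y ^ i)) = nil_eval b y * y ^ n"
proof -
  have "nil_eval b y * y ^ n = (\<Sum>a<N. scl (b a) (y ^ (a + n)))"
    by (simp add: nil_eval_eq[OF assms] sum_distrib_right power_add)
  also have "\<dots> = (\<Sum>i\<in>{n..<N + n}. scl (b_shift i n) (y ^ i))"
    using sum.shift_bounds_nat_ivl[of "\<lambda>i. scl (b_shift i n) (y ^ i)" 0 n N]
    by (simp add: b_shift_def atLeast0LessThan)
  also have "\<dots> = (\<Sum>i<N + n. scl (b_shift i n) (y ^ i))"
    by (rule sum.mono_neutral_left) (auto simp: b_shift_def)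
  also have "\<dots> = (\<Sum>i<N. scl (b_shift i n) (y ^ i))"
    by (intro sum.mono_neutral_right) (auto simp: power_eq_0_mono[OF assms])
  finally show ?thesis by simp
qed

text \<open>Both sides are expanded in the monomials y^i x^j. By \<open>q_binomial\<close> the left
  has the coefficient g (i + j) over the p-factorials of i and j, the right has
  \<open>conv i j\<close>, and \<open>coeff_product\<close> equates the two.\<close>

lemma addition_formula:
  assumes xy: "x * y = scl p (y * x)" and x: "x ^ N = 0" and y: "y ^ N = 0"
  shows "(y + x) ^ (2 * N) = 0"
    and "nil_eval b (y + x) = nil_eval b y * nil_eval R_coeff (- (y * x)) * nil_eval b x"
proof -
  have binom: "scl (inv_fact n) ((y + x) ^ n) =
      (\<Sum>i\<le>n. scl (inv_fact i * inv_fact (n - i)) (y ^ i * x ^ (n - i)))" for n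
    by (rule q_binomial[OF xy, where br = p_int and z = 1])
      (simp_all add: p_int_add p_int_nonzero inv_fact_0 inv_fact_Suc)
  have zero: "y ^ i * x ^ j = 0" if "N \<le> i \<or> N \<le> j" for i j
    using that by (auto simp: power_eq_0_mono[OF x] power_eq_0_mono[OF y])
  have "scl (inv_fact (2 * N)) ((y + x) ^ (2 * N)) = 0"
    unfolding binom
  proof (intro sum.neutral ballI)
    fix i
    have "N \<le> i \<or> N \<le> 2 * N - i" by arith
    then show "scl (inv_fact i * inv_fact (2 * N - i)) (y ^ i * x ^ (2 * N - i)) = 0"
      by (simp add: zero)
  qed
  moreover have "inv_fact (2 * N) \<noteq> 0" using p_fact_inverse[of "2 * N"] by auto
  ultimately show nil: "(y + x) ^ (2 * N) = 0" by (simp add: scl_eq_0_iff)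
  have "nil_eval b (y + x) = (\<Sum>n<2 * N. scl (g n) (scl (inv_fact n) ((y + x) ^ n)))"
    by (simp add: nil_eval_eq[OF nil] b_eq)
  also have "\<dots> = (\<Sum>n<2 * N. \<Sum>i\<le>n. scl (conv i (n - i)) (y ^ i * x ^ (n - i)))"
    unfolding binom scl_sum_right by (intro sum.cong refl) (auto simp: coeff_product mult_ac)
  also have "\<dots> = (\<Sum>(i, j)\<in>{(i, j). i + j < 2 * N}. scl (conv i j) (y ^ i * x ^ j))"
    by (rule sum.triangle_reindex[symmetric])
  \<comment> \<open>The square lies inside the triangle, since i, j < N gives i + j < 2 N, and the
    monomials outside the square vanish.\<close>
  also have "\<dots> = (\<Sum>(i, j)\<in>{..<N} \<times> {..<N}. scl (conv i j) (y ^ i * x ^ j))"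
  proof (rule sum.mono_neutral_right)
    show "finite {(i, j). i + j < 2 * N}"
      by (rule finite_subset[of _ "{..<2 * N} \<times> {..<2 * N}"]) auto
  qed (auto, (metis zero scl_zero_right not_less)+)
  also have "\<dots> = (\<Sum>i<N. \<Sum>j<N. scl (conv i j) (y ^ i * x ^ j))"
    by (simp add: sum.cartesian_product)
  also have "\<dots> = (\<Sum>i<N. \<Sum>j<N. \<Sum>n<N. scl (s n) (scl (b_shift i n) (y ^ i) * scl (b_shift j n) (x ^ j)))"
  proof (intro sum.cong refl)
    fix i j assume "i \<in> {..<N}"
    then have "conv i j = (\<Sum>n<N. s n * b_shift i n * b_shift j n)"
      unfolding conv_def by (intro sum.mono_neutral_cong_left) (auto simp: b_shift_def)
    then show "scl (conv i j) (y ^ i * x ^ j) =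
        (\<Sum>n<N. scl (s n) (scl (b_shift i n) (y ^ i) * scl (b_shift j n) (x ^ j)))"
      by (simp add: scl_sum_left mult_ac)
  qed
  also have "\<dots> = (\<Sum>n<N. \<Sum>i<N. \<Sum>j<N. scl (s n) (scl (b_shift i n) (y ^ i) * scl (b_shift j n) (x ^ j)))"
    by (subst (2) sum.swap, subst sum.swap) (rule refl)
  also have "\<dots> = (\<Sum>n<N. scl (s n) ((\<Sum>i<N. scl (b_shift i n) (y ^ i)) * (\<Sum>j<N. scl (b_shift j n) (x ^ j))))"
    by (simp only: sum_product scl_sum_right)
  also have "\<dots> = (\<Sum>n<N. nil_eval b y * scl (s n) (y ^ n * x ^ n) * nil_eval b x)"
  proof (intro sum.cong refl)
    fix n
    have "x ^ n * nil_eval b x = nil_eval b x * x ^ n"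
      by (rule nil_eval_intertwine[symmetric, OF _ x x]) (metis power_commutes)
    then show "scl (s n) ((\<Sum>i<N. scl (b_shift i n) (y ^ i)) * (\<Sum>j<N. scl (b_shift j n) (x ^ j))) =
        nil_eval b y * scl (s n) (y ^ n * x ^ n) * nil_eval b x"
      unfolding sum_b_shift[OF x] sum_b_shift[OF y] by (simp add: mult.assoc)
  qed
  also have "\<dots> = nil_eval b y * (\<Sum>n<N. scl (s n) (y ^ n * x ^ n)) * nil_eval b x"
    by (simp only: sum_distrib_left sum_distrib_right)
  also have "(\<Sum>n<N. scl (s n) (y ^ n * x ^ n)) = nil_eval R_coeff (- (y * x))"
  proof -
    have pow: "(- (y * x)) ^ n = scl ((-1) ^ n * (\<Prod>i<n. p ^ i)) (y ^ n * x ^ n)" for n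
    proof -
      have "- (y * x) = scl (-1) (y * x)" by (simp add: scl_minus_left)
      then show ?thesis by (simp only: scl_power power_q_commuting[OF xy] scl_scl)
    qed
    then have "(- (y * x)) ^ N = 0" by (simp add: y)
    then show ?thesis by (simp add: nil_eval_eq pow s_def mult_ac)
  qed
  finally show "nil_eval b (y + x) = nil_eval b y * nil_eval R_coeff (- (y * x)) * nil_eval b x" .
qed

end

text \<open>Induction gives (1 - p) [A^(n + 1), B] = p_int (n + 1) (C A^n - A^n D). Multiplied by
  \<open>R_coeff n\<close>, the left scalar becomes R_coeff (n + 1) p_int (n + 1), and p_int (n + 1)
  cancels. Summation yields [\<theta>(A), B] = C \<theta>(A) - \<theta>(A) D.\<close>

lemma R_coeff_intertwine:
  fixes A B C D :: linop
  assumes AB: "scl (1 - p) (A * B - B * A) = C - D"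
    and AC: "A * C = scl p (C * A)" and AD: "A * D = scl (q_pow 1) (D * A)"
    and A: "A ^ N = 0"
  shows "nil_eval R_coeff A * (B + D) = (B + C) * nil_eval R_coeff A"
proof -
  have comm: "scl (1 - p) (A ^ Suc n * B - B * A ^ Suc n) =
      scl (p_int (Suc n)) (C * A ^ n - A ^ n * D)" for n
  proof (induction n)
    case (Suc n)
    have D: "A ^ n * D = scl (q_pow 1 ^ n) (D * A ^ n)" for n
    proof (induction n)
      case (Suc n)
      have "A ^ Suc n * D = scl (q_pow 1 ^ n) (A * D * A ^ n)" by (simp add: mult.assoc Suc)
      then show ?case unfolding AD by (simp add: mult.assoc mult_ac)
    qed simp
    have q: "q_pow 1 ^ n * p ^ n = 1" for n by (simp flip: power_mult_distrib)
    have "scl (1 - p) (A ^ Suc (Suc n) * B - B * A ^ Suc (Suc n)) =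
        A * scl (1 - p) (A ^ Suc n * B - B * A ^ Suc n) + scl (1 - p) (A * B - B * A) * A ^ Suc n"
      by (simp add: scl_diff_right algebra_simps)
    also have "\<dots> = scl (p_int (Suc n)) (A * C * A ^ n) - scl (p_int (Suc n)) (A ^ Suc n * D) + (C - D) * A ^ Suc n"
      unfolding Suc AB by (simp add: algebra_simps scl_diff_right)
    also have "\<dots> = scl (1 + p * p_int (Suc n)) (C * A ^ Suc n) -
        scl (p_int (Suc n)) (A ^ Suc n * D) - scl (q_pow 1 ^ Suc n * p ^ Suc n) (D * A ^ Suc n)"
      unfolding AC q by (simp add: algebra_simps scl_add_left)
    also have "scl (p_int (Suc n)) (A ^ Suc n * D) = scl (p_int (Suc n) * q_pow 1 ^ Suc n) (D * A ^ Suc n)"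
      unfolding D by simp
    finally show ?case unfolding D scl_diff_right p_int_Suc'[symmetric]
      by (simp only: p_int_Suc[of "Suc n"] scl_add_left scl_scl algebra_simps)
  qed (simp add: p_int_1 AB)
  have "R_coeff (Suc n) * p_int (Suc n) = R_coeff n * (1 - p)" for n
    using R_coeff_Suc[of n] by (simp add: mult_ac)
  then have "scl (p_int (Suc n)) (scl (R_coeff (Suc n)) (A ^ Suc n * B - B * A ^ Suc n)) =
      scl (p_int (Suc n)) (scl (R_coeff n) (C * A ^ n - A ^ n * D))" for n
    using arg_cong[OF comm, of "scl (R_coeff n)" n] by (simp add: mult_ac del: power_Suc)
  then have step: "scl (R_coeff (Suc n)) (A ^ Suc n * B - B * A ^ Suc n) =
      scl (R_coeff n) (C * A ^ n - A ^ n * D)" for n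
    using scl_cancel[OF p_int_nonzero] by blast
  \<comment> \<open>With the bound N + 1 on the left, dropping the zero commutator at n = 0 and
    shifting leaves N terms, as many as in \<open>nil_eval_eq[OF A]\<close>.\<close>
  have "A ^ Suc N = 0" using A by simp
  then have "nil_eval R_coeff A * B - B * nil_eval R_coeff A =
      (\<Sum>n<Suc N. scl (R_coeff n) (A ^ n * B - B * A ^ n))"
    by (simp only: nil_eval_eq sum_distrib_left sum_distrib_right flip: sum_subtractf)
      (simp add: scl_diff_right)
  also have "\<dots> = (\<Sum>n<N. scl (R_coeff n) (C * A ^ n - A ^ n * D))"
    unfolding sum.lessThan_Suc_shift step by simp
  also have "\<dots> = C * nil_eval R_coeff A - nil_eval R_coeff A * D"
    by (simp only: nil_eval_eq[OF A] sum_distrib_left sum_distrib_right flip: sum_subtractf)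
      (simp add: scl_diff_right)
  finally show ?thesis by (simp add: algebra_simps)
qed

section \<open>The reflection equation for operators\<close>

lemma is_qexp_commute_op: "is_qexp A Q \<Longrightarrow> S * A = A * S \<Longrightarrow> S * Q = Q * S"
  using is_qexp_intertwine[of A Q A Q S] by simp

lemma is_qexp_commute:
  assumes "is_qexp A Q" "is_qexp B Q'" "A * B = B * A"
  shows "Q * Q' = Q' * Q"
  using is_qexp_commute_op[OF assms(2)] is_qexp_commute_op[OF assms(1), of B] assms(3) by metis

lemma is_qexp_inverse:
  assumes "is_qexp A Q" "is_qexp (- A) Q'"
  shows "Q * Q' = 1"
proof -
  have "is_qexp (A + - A) (Q * Q')" using assms by (intro is_qexp_add) auto
  moreover have "is_qexp 0 1" using is_qexp_scalar[of 0] by simp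
  ultimately show ?thesis by (auto dest: is_qexp_unique)
qed

lemma is_qexp_shift:
  assumes Q: "is_qexp A Q" and F: "F * A = (A + scl (fps_const c) 1) * F"
  shows "F * Q = scl (q_pow c) (Q * F)"
proof -
  have "is_qexp (A + scl (fps_const c) 1) (Q * scl (q_pow c) 1)"
    unfolding q_pow_def using Q is_qexp_scalar by (rule is_qexp_add) simp
  from is_qexp_intertwine[OF Q this F] show ?thesis by simp
qed

lemma nilpotent_mult_commuting:
  fixes a c :: linop
  shows "a * c = c * a \<Longrightarrow> c ^ N = 0 \<Longrightarrow> (a * c) ^ N = 0"
  by (simp add: power_mult_commuting)

lemma left_commute_if: "a * c = c * a \<Longrightarrow> a * (c * d) = c * (a * (d :: linop))"
  by (metis mult.assoc)

text \<open>
  The indices 1 and 2 refer to the legs of a tensor product. In terms of the Cartan elements,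
  \<open>D\<^sub>i\<close> is \<open>q\<^bsup>- H\<^sub>i\<^sup>2 / 8\<^esup>\<close>, \<open>Q\<close> is \<open>q\<^bsup>H\<^sub>1 H\<^sub>2 / 4\<^esup>\<close>, \<open>Qi\<close> is its inverse, and \<open>k\<^sub>1\<close>, \<open>k\<^sub>1'\<close>, \<open>k\<^sub>2'\<close> are
  \<open>K\<^sup>2 \<otimes> 1\<close>, \<open>K\<^sup>-\<^sup>2 \<otimes> 1\<close>, \<open>1 \<otimes> K\<^sup>-\<^sup>2\<close>.
\<close>

locale reflection_operators = hermite_coeffs b \<beta>\<^sub>1
  for b :: "nat \<Rightarrow> complex fps" and \<beta>\<^sub>1 :: "complex fps" +
  fixes W1 W2 H1 H2 E1 E2 F1 F2 D1 D2 Q Qi k1 k1' k2' :: linop and N :: nat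
  assumes D1: "is_qexp (scl (fps_const (-1/8)) (H1 * H1)) D1"
    and D2: "is_qexp (scl (fps_const (-1/8)) (H2 * H2)) D2"
    and Q: "is_qexp (scl (fps_const (1/4)) (H1 * H2)) Q"
    and Qi: "is_qexp (scl (fps_const (-1/4)) (H1 * H2)) Qi"
    and k1: "is_qexp (scl (fps_const (1/2)) H1) k1"
    and k1': "is_qexp (scl (fps_const (-1/2)) H1) k1'"
    and k2': "is_qexp (scl (fps_const (-1/2)) H2) k2'"
    and HE1: "E1 * H1 = H1 * E1 - scl (fps_const 2) E1"
    and HF1: "F1 * H1 = H1 * F1 + scl (fps_const 2) F1" and HF2: "F2 * H2 = H2 * F2 + scl (fps_const 2) F2"
    and EF1: "scl (1 - p) (E1 * F1 - F1 * E1) = k1 - k1'"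
    and WH1: "W1 * H1 = - (H1 * W1)" and WH2: "W2 * H2 = - (H2 * W2)"
    and WE1: "E1 * W1 = scl (- q_pow (1/2)) (W1 * F1)" and WF1: "F1 * W1 = scl (- q_pow (-1/2)) (W1 * E1)"
    and WE2: "E2 * W2 = scl (- q_pow (1/2)) (W2 * F2)"
    and nil: "E1 ^ N = 0" "F1 ^ N = 0" "E2 ^ N = 0" "F2 ^ N = 0"
    and legs: "\<And>x y. x \<in> {W1, H1, E1, F1} \<Longrightarrow> y \<in> {W2, H2, E2, F2} \<Longrightarrow> x * y = y * x"
begin

section \<open>Exchange relations of the Cartan elements with E, F and w\<close>

lemma legs_commute:
  "H2 * H1 = H1 * H2" "W2 * H1 = H1 * W2" "E2 * H1 = H1 * E2" "F2 * H1 = H1 * F2"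
  "H2 * W1 = W1 * H2" "W2 * W1 = W1 * W2" "E2 * W1 = W1 * E2" "F2 * W1 = W1 * F2"
  "H2 * E1 = E1 * H2" "W2 * E1 = E1 * W2" "E2 * E1 = E1 * E2" "F2 * E1 = E1 * F2"
  "H2 * F1 = F1 * H2" "W2 * F1 = F1 * W2" "E2 * F1 = F1 * E2" "F2 * F1 = F1 * F2"
  by (rule legs[symmetric]; simp)+

lemmas sort_legs = mult.assoc legs_commute legs_commute[THEN left_commute_if]

lemma cartan_commute:
  "F2 * k1 = k1 * F2" "F2 * k1' = k1' * F2" "F1 * k2' = k2' * F1" "F2 * D1 = D1 * F2" "F1 * D2 = D2 * F1"
  "W2 * D1 = D1 * W2" "W1 * D2 = D2 * W1"
  by (rule is_qexp_commute_op[OF k1] is_qexp_commute_op[OF k1'] is_qexp_commute_op[OF k2']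
      is_qexp_commute_op[OF D1] is_qexp_commute_op[OF D2]; simp add: sort_legs)+

lemma cartan_commute':
  "k1' * D1 = D1 * k1'" "k2' * D2 = D2 * k2'" "D2 * D1 = D1 * D2" "Q * D1 = D1 * Q" "Q * D2 = D2 * Q"
  "Qi * Q = Q * Qi" "Qi * D1 = D1 * Qi" "Qi * D2 = D2 * Qi" "Q * k2' = k2' * Q" "k1' * D2 = D2 * k1'"
  "k2' * D1 = D1 * k2'" "Q * k1 = k1 * Q" 
  by (rule is_qexp_commute[OF k1' D1] is_qexp_commute[OF k2' D2] is_qexp_commute[OF D2 D1]
      is_qexp_commute[OF Q D1] is_qexp_commute[OF Q D2] is_qexp_commute[OF Qi Q]
      is_qexp_commute[OF Qi D1] is_qexp_commute[OF Qi D2] is_qexp_commute[OF Q k2']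
      is_qexp_commute[OF k1' D2] is_qexp_commute[OF k2' D1] is_qexp_commute[OF Q k1]; simp add: sort_legs)+

lemma Q_Qi: "Q * Qi = 1"
  by (rule is_qexp_inverse[OF Q]) (use Qi in \<open>simp flip: scl_minus_left\<close>)

lemma F1_k1': "F1 * k1' = scl p (k1' * F1)"
  by (rule is_qexp_shift[OF k1']) (simp add: HF1 distrib_right scl_add_right)

lemma F1_k1: "F1 * k1 = scl (q_pow 1) (k1 * F1)"
  by (rule is_qexp_shift[OF k1]) (simp add: HF1 distrib_right scl_add_right)

lemma E1_k1: "E1 * k1 = scl p (k1 * E1)"
  by (rule is_qexp_shift[OF k1]) (simp add: HE1 distrib_right left_diff_distrib scl_diff_right scl_minus_left flip: fps_const_neg)

lemma E1_k1': "E1 * k1' = scl (q_pow 1) (k1' * E1)"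
  by (rule is_qexp_shift[OF k1']) (simp add: HE1 distrib_right left_diff_distrib scl_diff_right scl_minus_left flip: fps_const_neg)

text \<open>Passing F2 replaces H2 by H2 + 2, which adds - H1 / 2 to the exponent - H1 H2 / 4. The
  relations \<open>F1_Qi\<close> and \<open>F2_Q\<close> arise in the same way.\<close>

lemma F2_Qi: "F2 * Qi = Qi * k1' * F2"
proof (rule is_qexp_intertwine[OF Qi])
  show "is_qexp (scl (fps_const (-1/4)) (H1 * H2) + scl (fps_const (-1/2)) H1) (Qi * k1')"
    by (rule is_qexp_add[OF Qi k1']) (simp add: sort_legs)
qed (simp add: sort_legs HF2 distrib_left distrib_right scl_add_right)

lemma F1_Qi: "F1 * Qi = Qi * k2' * F1"
proof (rule is_qexp_intertwine[OF Qi])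
  show "is_qexp (scl (fps_const (-1/4)) (H1 * H2) + scl (fps_const (-1/2)) H2) (Qi * k2')"
    by (rule is_qexp_add[OF Qi k2']) (simp add: sort_legs)
next
  have "F1 * (H1 * H2) = (H1 * H2 + scl (fps_const 2) H2) * F1"
    by (simp add: HF1 distrib_right sort_legs flip: mult.assoc)
       (simp add: sort_legs)
  then show "F1 * scl (fps_const (-1/4)) (H1 * H2) =
      (scl (fps_const (-1/4)) (H1 * H2) + scl (fps_const (-1/2)) H2) * F1"
    by (simp add: distrib_right scl_add_right)
qed

lemma F2_Q: "F2 * Q = Q * k1 * F2"
proof (rule is_qexp_intertwine[OF Q])
  show "is_qexp (scl (fps_const (1/4)) (H1 * H2) + scl (fps_const (1/2)) H1) (Q * k1)"
    by (rule is_qexp_add[OF Q k1]) (simp add: sort_legs)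
qed (simp add: sort_legs HF2 distrib_left distrib_right scl_add_right)

lemma F1_Q: "k2' * F1 * Q = Q * F1"
proof -
  have "Q * F1 = Q * F1 * Qi * Q" by (simp add: mult.assoc cartan_commute' Q_Qi)
  also have "\<dots> = Q * Qi * k2' * F1 * Q" by (simp only: mult.assoc F1_Qi)
  finally show ?thesis by (simp add: Q_Qi)
qed

text \<open>The exponent changes according to (H + 2)^2 = H^2 + 4 H + 4, multiplied by -1/8: the
  linear term gives k, the constant gives q^(-1/2).\<close>

lemma F_D:
  assumes F: "F * H = H * F + scl (fps_const 2) F"
    and D: "is_qexp (scl (fps_const (-1/8)) (H * H)) D" and k: "is_qexp (scl (fps_const (-1/2)) H) k"
  shows "F * D = scl (q_pow (-1/2)) (D * k * F)"
proof -
  have "is_qexp (scl (fps_const (-1/8)) (H * H) + scl (fps_const (-1/2)) H + scl (fps_const (-1/2)) 1)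
      (D * k * scl (q_pow (-1/2)) 1)"
    unfolding q_pow_def by (intro is_qexp_add D k is_qexp_scalar) (simp_all add: mult.assoc)
  moreover have "F * (H * H) = H * H * F + scl (fps_const 4) (H * F) + scl (fps_const 4) F"
  proof -
    have "F * (H * H) = H * H * F + (scl (fps_const 2) (H * F) + scl (fps_const 2) (H * F)) + scl (fps_const 4) F"
      by (simp only: mult.assoc[symmetric] F)
        (simp add: distrib_right distrib_left scl_add_right mult.assoc F)
    then show ?thesis by (simp flip: scl_add_left)
  qed
  then have "F * scl (fps_const (-1/8)) (H * H) =
      (scl (fps_const (-1/8)) (H * H) + scl (fps_const (-1/2)) H + scl (fps_const (-1/2)) 1) * F"
    by (simp add: distrib_right scl_add_right)
  ultimately show ?thesis using is_qexp_intertwine[OF D] by fastforce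
qed

lemmas F1_D1 = F_D[OF HF1 D1 k1'] and F2_D2 = F_D[OF HF2 D2 k2']

text \<open>E1 F2 preserves the total weight H1 + H2, and the product of the three Cartan factors is
  a function of it.\<close>

lemma EF_cartan: "E1 * F2 * (D2 * Qi * D1) = D2 * Qi * D1 * (E1 * F2)"
proof (rule is_qexp_commute_op)
  let ?T = "H1 + H2"
  have T: "E1 * F2 * ?T = ?T * (E1 * F2)"
    by (simp add: sort_legs distrib_left distrib_right HF2 right_diff_distrib)
      (simp add: HE1 left_diff_distrib flip: mult.assoc)
  have TT: "scl (fps_const (-1/8)) (H2 * H2) + scl (fps_const (-1/4)) (H1 * H2) + scl (fps_const (-1/8)) (H1 * H1)
      = scl (fps_const (-1/8)) (?T * ?T)"
    by (simp add: distrib_left distrib_right legs_commute scl_add_right flip: scl_add_left)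
  show "is_qexp (scl (fps_const (-1/8)) (?T * ?T)) (D2 * Qi * D1)"
    unfolding TT[symmetric] by (intro is_qexp_add D1 D2 Qi) (simp_all add: sort_legs distrib_left distrib_right scl_add_right)
  show "E1 * F2 * scl (fps_const (-1/8)) (?T * ?T) = scl (fps_const (-1/8)) (?T * ?T) * (E1 * F2)"
    by (simp add: T mult.assoc) (metis T mult.assoc)
qed

lemma W_Q: "Q * W1 = W1 * Qi" "Qi * W1 = W1 * Q" "Q * W2 = W2 * Qi"
proof -
  have W1: "W1 * (H1 * H2) = - (H1 * (H2 * W1))"
    by (simp add: WH1 flip: mult.assoc) (simp add: sort_legs)
  have W2: "W2 * (H1 * H2) = - (H1 * (H2 * W2))"
    by (simp add: sort_legs WH2)
  show "Q * W1 = W1 * Qi" "Qi * W1 = W1 * Q" "Q * W2 = W2 * Qi"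
    by (rule is_qexp_intertwine[OF Qi Q, symmetric] is_qexp_intertwine[OF Q Qi, symmetric];
        simp add: W1 W2 mult.assoc scl_minus_right flip: scl_minus_left)+
qed

abbreviation "\<Theta> \<equiv> nil_eval R_coeff (E1 * F2)"
abbreviation "\<Theta>\<^sub>2\<^sub>1 \<equiv> nil_eval R_coeff (F1 * E2)"
text \<open>What \<open>\<Theta>\<close> becomes when W1 is moved through it to the left, and also
  \<open>\<Theta>\<^sub>2\<^sub>1\<close> when W2 is; the scalar comes from \<open>WE1\<close> and
  \<open>WE2\<close>.\<close>

abbreviation "\<Psi> \<equiv> nil_eval R_coeff (scl (- q_pow (1/2)) (F1 * F2))"

lemma nilpotent_products:
  "(E1 * F2) ^ N = 0" "(F1 * E2) ^ N = 0" "(F1 * F2) ^ N = 0"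
  "(k1 * F2) ^ N = 0" "(k1' * F2) ^ N = 0" "(k2' * F1) ^ N = 0" "(- (k2' * F1 * F2)) ^ N = 0"
proof -
  show "(E1 * F2) ^ N = 0" "(F1 * E2) ^ N = 0" "(F1 * F2) ^ N = 0"
    "(k1 * F2) ^ N = 0" "(k1' * F2) ^ N = 0" "(k2' * F1) ^ N = 0"
    by (rule nilpotent_mult_commuting; simp add: nil legs_commute cartan_commute)+
  have "F2 * k2' = scl p (k2' * F2)"
    by (rule is_qexp_shift[OF k2']) (simp add: HF2 distrib_right scl_add_right)
  then have "F2 * (k2' * F1) = scl p (k2' * F1 * F2)"
    by (simp add: sort_legs flip: mult.assoc) (simp add: sort_legs)
  then have "(k2' * F1 * F2) ^ N = 0"
    by (simp add: power_q_commuting nil)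
  then show "(- (k2' * F1 * F2)) ^ N = 0" by (simp add: power_minus[of "k2' * F1 * F2"])
qed

text \<open>F1 picks up opposite powers of q from k1' and k1. Hence in
  \<open>addition_formula\<close> it stands to the right of D = k1' F2 but to the left of C = k1
  F2.\<close>

lemma q_commute_D: "F1 * (k1' * F2) = scl p (k1' * F2 * F1)"
  by (simp add: F1_k1' sort_legs flip: mult.assoc) (simp add: sort_legs)

lemma q_commute_C: "k1 * F2 * F1 = scl p (F1 * (k1 * F2))"
  by (simp add: F1_k1 sort_legs flip: mult.assoc) (simp add: sort_legs flip: q_pow_add)

lemma nilpotent_products':
  "(- (k1' * F2 * F1)) ^ N = 0" "(- (F1 * (k1 * F2))) ^ N = 0"
  by (simp_all add: power_minus[of "_ * _"] power_q_commuting[OF q_commute_D]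
      power_q_commuting[OF q_commute_C] nil)

text \<open>This is \<open>R_coeff_intertwine\<close> for A = E1 F2 and B = F1: since F2 commutes
  with E1 and F1, (1 - p) [E1 F2, F1] = (k1 - k1') F2.\<close>

lemma \<Theta>_sum: "\<Theta> * (k1' * F2 + F1) = (F1 + k1 * F2) * \<Theta>"
proof -
  have "scl (1 - p) (E1 * F2 * F1 - F1 * (E1 * F2)) = scl (1 - p) (E1 * F1 - F1 * E1) * F2"
    by (simp add: sort_legs left_diff_distrib)
  then have "scl (1 - p) (E1 * F2 * F1 - F1 * (E1 * F2)) = k1 * F2 - k1' * F2"
    by (simp add: EF1 left_diff_distrib)
  moreover have "E1 * F2 * (k1 * F2) = E1 * k1 * F2 * F2" "E1 * F2 * (k1' * F2) = E1 * k1' * F2 * F2"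
    by (simp_all add: mult.assoc cartan_commute cartan_commute[THEN left_commute_if])
  then have "E1 * F2 * (k1 * F2) = scl p (k1 * F2 * (E1 * F2))"
    "E1 * F2 * (k1' * F2) = scl (q_pow 1) (k1' * F2 * (E1 * F2))"
    by (simp_all add: E1_k1 E1_k1' sort_legs)
  ultimately have "\<Theta> * (F1 + k1' * F2) = (F1 + k1 * F2) * \<Theta>"
    by (rule R_coeff_intertwine) (rule nilpotent_products)
  then show ?thesis by (simp add: add.commute)
qed

text \<open>Collecting Cartan factors on the left brings both sides to Z Q b(F1 + C) \<Theta> with Z
  = D2 Qi D1.\<close>

lemma core_identity:
  "Q * \<Theta> * (D2 * nil_eval b F2) * (Qi * \<Psi>) * (D1 * nil_eval b F1) =
   D1 * nil_eval b F1 * (Qi * \<Psi>) * (D2 * nil_eval b F2) * (Q * \<Theta>)"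
proof -
  let ?b = "nil_eval b" and ?r = "nil_eval R_coeff"
  let ?C = "k1 * F2" and ?D = "k1' * F2" and ?G = "k2' * F1" and ?Z = "D2 * Qi * D1"
  note inter = nil_eval_intertwine[where N = N]
  note np = nilpotent_products nilpotent_products' nil
  have psi: "(scl (- q_pow (1/2)) (F1 * F2)) ^ N = 0" by (simp add: np)
  \<comment> \<open>The scalar in \<Psi> meets the q^(-1/2) produced by \<open>F_D\<close>; only the
    sign required by the addition formula survives.\<close>
  have qq: "- q_pow (1/2) * q_pow (-1/2) = -1" by (simp flip: q_pow_add)
  have c1: "?b F2 * Qi = Qi * ?b ?D" by (rule inter) (simp_all add: F2_Qi np mult.assoc)
  have c2: "\<Psi> * D1 = D1 * ?r (- (?D * F1))"
  proof (rule inter[OF _ psi])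
    have "F1 * F2 * D1 = F1 * D1 * F2" by (simp add: mult.assoc cartan_commute)
    also have "\<dots> = scl (q_pow (-1/2)) (D1 * (?D * F1))" by (simp add: F1_D1 sort_legs)
    finally show "scl (- q_pow (1/2)) (F1 * F2) * D1 = D1 * (- (?D * F1))"
      by (simp only: scl_mult_left scl_scl qq) (simp add: scl_minus_left)
  qed (rule np)
  have c3: "?b ?D * D1 = D1 * ?b ?D"
    by (rule inter) (simp_all add: np mult.assoc cartan_commute cartan_commute'[THEN left_commute_if])
  have c4: "\<Theta> * ?Z = ?Z * \<Theta>" by (rule inter) (simp_all add: EF_cartan np)
  have c4': "Q * ?Z = ?Z * Q"
    by (simp only: mult.assoc cartan_commute'(4) cartan_commute'(5)[THEN left_commute_if]
        cartan_commute'(6)[symmetric, THEN left_commute_if])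
  \<comment> \<open>On the right-hand side D2 and Qi create the factor k2' in \<open>?G\<close>. It
    is removed when Q passes in \<open>c9\<close> and \<open>c10\<close>, while Q turns F2 into
    C.\<close>
  have c5: "\<Psi> * D2 = D2 * ?r (- (?G * F2))"
  proof (rule inter[OF _ psi])
    have "F1 * F2 * D2 = scl (q_pow (-1/2)) (F1 * (D2 * k2' * F2))" by (simp add: mult.assoc F2_D2)
    also have "F1 * (D2 * k2' * F2) = D2 * (?G * F2)"
      by (simp add: mult.assoc cartan_commute[THEN left_commute_if])
    finally show "scl (- q_pow (1/2)) (F1 * F2) * D2 = D2 * (- (?G * F2))"
      by (simp only: scl_mult_left scl_scl qq) (simp add: scl_minus_left)
  qed (rule np)
  have c6: "?b F1 * Qi = Qi * ?b ?G" by (rule inter) (simp_all add: F1_Qi np mult.assoc)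
  have c7: "?b ?G * D2 = D2 * ?b ?G"
    by (rule inter) (simp_all add: np mult.assoc cartan_commute cartan_commute'[THEN left_commute_if])
  have c8: "?b F2 * Q = Q * ?b ?C" by (rule inter) (simp_all add: F2_Q np mult.assoc)
  have c9: "?r (- (?G * F2)) * Q = Q * ?r (- (F1 * ?C))"
  proof (rule inter)
    have "?G * F2 * Q = ?G * Q * ?C" by (simp add: mult.assoc F2_Q)
    then have "?G * F2 * Q = Q * (F1 * ?C)" unfolding F1_Q by (simp only: mult.assoc)
    then show "- (?G * F2) * Q = Q * - (F1 * ?C)" by simp
  qed (rule np)+
  have c10: "?b ?G * Q = Q * ?b F1" by (rule inter) (simp_all add: F1_Q np)
  have sum1: "?b ?D * ?r (- (?D * F1)) * ?b F1 = ?b (?D + F1)"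
    by (rule addition_formula(2)[OF q_commute_D, symmetric]) (rule np)+
  have sum2: "?b F1 * ?r (- (F1 * ?C)) * ?b ?C = ?b (F1 + ?C)"
    by (rule addition_formula(2)[OF q_commute_C, symmetric]) (rule np)+
  have "Q * \<Theta> * (D2 * ?b F2) * (Qi * \<Psi>) * (D1 * ?b F1) =
      Q * \<Theta> * D2 * (?b F2 * Qi) * (\<Psi> * D1) * ?b F1"
    by (simp only: mult.assoc)
  also have "\<dots> = Q * \<Theta> * D2 * Qi * (?b ?D * D1) * ?r (- (?D * F1)) * ?b F1"
    unfolding c1 c2 by (simp only: mult.assoc)
  also have "\<dots> = Q * (\<Theta> * ?Z) * (?b ?D * ?r (- (?D * F1)) * ?b F1)"
    unfolding c3 by (simp only: mult.assoc)
  also have "\<dots> = Q * ?Z * (\<Theta> * ?b (?D + F1))"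
    unfolding c4 sum1 by (simp only: mult.assoc)
  \<comment> \<open>\<Theta> intertwines the two arguments of b, hence the two series; the addition
    formula also supplies the nilpotency of both sums.\<close>
  also have "\<Theta> * ?b (?D + F1) = ?b (F1 + ?C) * \<Theta>"
  proof (rule nil_eval_intertwine[symmetric])
    show "(?D + F1) ^ (2 * N) = 0" by (rule addition_formula(1)[OF q_commute_D]) (rule np)+
    show "(F1 + ?C) ^ (2 * N) = 0" by (rule addition_formula(1)[OF q_commute_C]) (rule np)+
  qed (rule \<Theta>_sum[symmetric])
  finally have L: "Q * \<Theta> * (D2 * ?b F2) * (Qi * \<Psi>) * (D1 * ?b F1) = ?Z * Q * ?b (F1 + ?C) * \<Theta>"
    unfolding c4' by (simp only: mult.assoc)
  have "D1 * ?b F1 * (Qi * \<Psi>) * (D2 * ?b F2) * (Q * \<Theta>) =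
      D1 * (?b F1 * Qi) * (\<Psi> * D2) * (?b F2 * Q) * \<Theta>"
    by (simp only: mult.assoc)
  also have "\<dots> = D1 * Qi * (?b ?G * D2) * (?r (- (?G * F2)) * Q) * ?b ?C * \<Theta>"
    unfolding c5 c6 c8 by (simp only: mult.assoc)
  also have "\<dots> = D1 * Qi * D2 * (?b ?G * Q) * ?r (- (F1 * ?C)) * ?b ?C * \<Theta>"
    unfolding c7 c9 by (simp only: mult.assoc)
  also have "\<dots> = D1 * Qi * D2 * Q * (?b F1 * ?r (- (F1 * ?C)) * ?b ?C) * \<Theta>"
    unfolding c10 by (simp only: mult.assoc)
  also have "D1 * Qi * D2 = ?Z"
    by (simp add: mult.assoc cartan_commute' cartan_commute'[THEN left_commute_if])
  finally show ?thesis unfolding L sum2 by simp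
qed

text \<open>\<open>Qi * \<Psi>\<close> is R conjugated by W1 and at the same time R21 conjugated by
  W2. The third equation restores R, the scalars - q^(1/2) and - q^(-1/2) being inverse to each
  other.\<close>

lemma R_W: "Q * \<Theta> * W1 = W1 * (Qi * \<Psi>)" "Q * \<Theta>\<^sub>2\<^sub>1 * W2 = W2 * (Qi * \<Psi>)"
  "Qi * \<Psi> * W1 = W1 * (Q * \<Theta>)"
proof -
  note inter = nil_eval_intertwine[where N = N]
  have psi: "(scl (- q_pow (1/2)) (F1 * F2)) ^ N = 0" by (simp add: nilpotent_products)
  have "E1 * F2 * W1 = scl (- q_pow (1/2)) (W1 * (F1 * F2))"
  proof -
    have "E1 * F2 * W1 = E1 * W1 * F2" by (simp add: sort_legs)
    then show ?thesis by (simp add: WE1 mult.assoc)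
  qed
  then have t1: "\<Theta> * W1 = W1 * \<Psi>"
    by (intro inter psi nilpotent_products) simp
  have "F1 * E2 * W2 = scl (- q_pow (1/2)) (W2 * (F1 * F2))"
    by (simp add: mult.assoc WE2 sort_legs)
  then have t2: "\<Theta>\<^sub>2\<^sub>1 * W2 = W2 * \<Psi>"
    by (intro inter psi nilpotent_products) simp
  have "F1 * F2 * W1 = F1 * W1 * F2" by (simp add: sort_legs)
  then have "scl (- q_pow (1/2)) (F1 * F2) * W1 = W1 * (E1 * F2)"
    by (simp add: WF1 sort_legs flip: q_pow_add)
  then have t3: "\<Psi> * W1 = W1 * \<Theta>"
    by (intro inter psi nilpotent_products) simp
  show "Q * \<Theta> * W1 = W1 * (Qi * \<Psi>)" "Q * \<Theta>\<^sub>2\<^sub>1 * W2 = W2 * (Qi * \<Psi>)"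
    "Qi * \<Psi> * W1 = W1 * (Q * \<Theta>)"
    by (metis t1 t2 t3 W_Q mult.assoc)+
qed

theorem reflection_equation:
  "(Q * \<Theta>\<^sub>2\<^sub>1) * (W2 * D2 * nil_eval b F2) * (Q * \<Theta>) * (W1 * D1 * nil_eval b F1) =
   (W1 * D1 * nil_eval b F1) * (Q * \<Theta>\<^sub>2\<^sub>1) * (W2 * D2 * nil_eval b F2) * (Q * \<Theta>)"
proof -
  let ?B1 = "D1 * nil_eval b F1" and ?B2 = "D2 * nil_eval b F2"
  have b1: "nil_eval b F1 * W2 = W2 * nil_eval b F1" and b2: "nil_eval b F2 * W1 = W1 * nil_eval b F2"
    by (rule nil_eval_intertwine[where N = N]; simp add: nil legs_commute)+
  have B1: "?B1 * W2 = W2 * ?B1" and B2: "?B2 * W1 = W1 * ?B2"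
    by (simp_all only: mult.assoc b1 b2) (simp_all only: mult.assoc[symmetric] cartan_commute)
  have "(Q * \<Theta>\<^sub>2\<^sub>1) * (W2 * D2 * nil_eval b F2) * (Q * \<Theta>) * (W1 * D1 * nil_eval b F1) =
      (Q * \<Theta>\<^sub>2\<^sub>1 * W2) * ?B2 * (Q * \<Theta> * W1) * ?B1"
    by (simp only: mult.assoc)
  also have "\<dots> = W2 * (Qi * \<Psi>) * (?B2 * W1) * (Qi * \<Psi>) * ?B1"
    unfolding R_W by (simp only: mult.assoc)
  also have "\<dots> = W2 * (Qi * \<Psi> * W1) * ?B2 * (Qi * \<Psi>) * ?B1"
    unfolding B2 by (simp only: mult.assoc)
  also have "\<dots> = W2 * W1 * (Q * \<Theta> * ?B2 * (Qi * \<Psi>) * ?B1)"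
    unfolding R_W by (simp only: mult.assoc)
  also have "\<dots> = W1 * W2 * (?B1 * (Qi * \<Psi>) * ?B2 * (Q * \<Theta>))"
    unfolding core_identity legs_commute ..
  also have "\<dots> = W1 * (W2 * ?B1) * (Qi * \<Psi>) * ?B2 * (Q * \<Theta>)"
    by (simp only: mult.assoc)
  also have "\<dots> = W1 * ?B1 * (W2 * (Qi * \<Psi>)) * ?B2 * (Q * \<Theta>)"
    unfolding B1[symmetric] by (simp only: mult.assoc)
  also have "\<dots> = (W1 * D1 * nil_eval b F1) * (Q * \<Theta>\<^sub>2\<^sub>1) * (W2 * D2 * nil_eval b F2) * (Q * \<Theta>)"
    unfolding R_W[symmetric] by (simp only: mult.assoc)
  finally show ?thesis .
qed

end

section \<open>Kronecker products\<close>

lemma sum_div_mod: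
  fixes f :: "nat \<Rightarrow> nat \<Rightarrow> 'a :: comm_monoid_add"
  shows "(\<Sum>k<m * n. f (k div n) (k mod n)) = (\<Sum>a<m. \<Sum>c<n. f a c)"
proof -
  have "(\<Sum>k<m * n. f (k div n) (k mod n)) = (\<Sum>a<m. \<Sum>k\<in>{a * n..<a * n + n}. f (k div n) (k mod n))"
    by (rule sum.nat_group[symmetric])
  also have "\<dots> = (\<Sum>a<m. \<Sum>c<n. f a c)"
  proof (rule sum.cong[OF refl])
    fix a
    have "(\<Sum>k\<in>{a * n..<a * n + n}. f (k div n) (k mod n)) =
        (\<Sum>c\<in>{0..<n}. f ((c + a * n) div n) ((c + a * n) mod n))"
      using sum.shift_bounds_nat_ivl[of "\<lambda>k. f (k div n) (k mod n)" 0 "a * n" n]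
      by (simp add: add.commute)
    then show "(\<Sum>k\<in>{a * n..<a * n + n}. f (k div n) (k mod n)) = (\<Sum>c<n. f a c)"
      by (simp add: atLeast0LessThan)
  qed
  finally show ?thesis .
qed

lemma div_mod_less:
  fixes i :: nat
  assumes "i < m * n"
  shows "i div n < m" "i mod n < n"
  using assms by (simp_all add: less_mult_imp_div_less) (metis gr_implies_not0 mod_less_divisor mult_0_right not_gr_zero)

lemma kron_carrier [simp]:
  "A \<in> carrier_mat m m \<Longrightarrow> B \<in> carrier_mat n n \<Longrightarrow> A \<otimes>\<^sub>m B \<in> carrier_mat (m * n) (m * n)"
  by (simp add: kron_def)

lemma kron_dim [simp]:
  "dim_row (A \<otimes>\<^sub>m B) = dim_row A * dim_row B" "dim_col (A \<otimes>\<^sub>m B) = dim_col A * dim_col B"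
  by (simp_all add: kron_def)

lemma kron_index:
  assumes "A \<in> carrier_mat m m" "B \<in> carrier_mat n n" "i < m * n" "j < m * n"
  shows "(A \<otimes>\<^sub>m B) $$ (i, j) = A $$ (i div n, j div n) * B $$ (i mod n, j mod n)"
  using assms by (simp add: kron_def)

lemma eq_mat_carrierI:
  assumes "A \<in> carrier_mat n n" "B \<in> carrier_mat n n"
    and "\<And>i j. i < n \<Longrightarrow> j < n \<Longrightarrow> A $$ (i, j) = B $$ (i, j)"
  shows "A = B"
  using assms by (intro eq_matI) simp_all

lemma kron_eqI:
  assumes "X \<in> carrier_mat (m * n) (m * n)" "Y \<in> carrier_mat (m * n) (m * n)"
    and "\<And>i j. i < m * n \<Longrightarrow> j < m * n \<Longrightarrow> i div n < m \<Longrightarrow> i mod n < n \<Longrightarrow>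
      j div n < m \<Longrightarrow> j mod n < n \<Longrightarrow> X $$ (i, j) = Y $$ (i, j)"
  shows "X = Y"
  using assms(1,2) by (rule eq_mat_carrierI) (use assms(3) div_mod_less in blast)

lemma kron_mult:
  assumes A: "A \<in> carrier_mat m m" and B: "B \<in> carrier_mat n n"
    and C: "C \<in> carrier_mat m m" and D: "D \<in> carrier_mat n n"
  shows "(A \<otimes>\<^sub>m B) * (C \<otimes>\<^sub>m D) = (A * C) \<otimes>\<^sub>m (B * D)"
proof (rule eq_mat_carrierI[of _ "m * n"])
  fix i j assume ij: "i < m * n" "j < m * n"
  let ?t = "\<lambda>a c. (A $$ (i div n, a) * B $$ (i mod n, c)) * (C $$ (a, j div n) * D $$ (c, j mod n))"
  have "((A \<otimes>\<^sub>m B) * (C \<otimes>\<^sub>m D)) $$ (i, j) = (\<Sum>k<m * n. ?t (k div n) (k mod n))"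
    using assms ij by (subst mat_mult_index[of _ "m * n"]) (simp_all add: kron_index)
  also have "\<dots> = (\<Sum>a<m. \<Sum>c<n. ?t a c)" by (rule sum_div_mod)
  also have "\<dots> = (\<Sum>a<m. A $$ (i div n, a) * C $$ (a, j div n)) * (\<Sum>c<n. B $$ (i mod n, c) * D $$ (c, j mod n))"
    by (simp only: sum_product mult_ac)
  also have "\<dots> = (A * C) $$ (i div n, j div n) * (B * D) $$ (i mod n, j mod n)"
    using div_mod_less[OF ij(1)] div_mod_less[OF ij(2)]
    by (simp only: mat_mult_index[OF A C] mat_mult_index[OF B D])
  also have "\<dots> = ((A * C) \<otimes>\<^sub>m (B * D)) $$ (i, j)"
    using assms ij by (subst kron_index[of _ m _ n]) simp_all
  finally show "((A \<otimes>\<^sub>m B) * (C \<otimes>\<^sub>m D)) $$ (i, j) = ((A * C) \<otimes>\<^sub>m (B * D)) $$ (i, j)" .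
qed (rule mult_carrier_mat kron_carrier assms)+

lemma div_mod_eq_iff: "i div n = j div n \<and> i mod n = j mod n \<longleftrightarrow> i = (j :: nat)"
  by (metis div_mult_mod_eq)

lemma kron_one: "1\<^sub>m m \<otimes>\<^sub>m 1\<^sub>m n = 1\<^sub>m (m * n)"
proof (rule kron_eqI)
  fix i j assume "i < m * n" "j < m * n" "i div n < m" "i mod n < n" "j div n < m" "j mod n < n"
  then show "(1\<^sub>m m \<otimes>\<^sub>m 1\<^sub>m n) $$ (i, j) = 1\<^sub>m (m * n) $$ (i, j)"
    using div_mod_eq_iff[of i n j] by (auto simp: kron_index[of _ m _ n])
qed simp_all

lemma kron_diff:
  assumes "A \<in> carrier_mat m m" "B \<in> carrier_mat n n"
  shows "A' \<in> carrier_mat m m \<Longrightarrow> (A - A') \<otimes>\<^sub>m B = A \<otimes>\<^sub>m B - A' \<otimes>\<^sub>m B"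
    and "B' \<in> carrier_mat n n \<Longrightarrow> A \<otimes>\<^sub>m (B - B') = A \<otimes>\<^sub>m B - A \<otimes>\<^sub>m B'"
  by (rule kron_eqI[of _ m n];
      use assms in \<open>simp add: minus_carrier_mat kron_index[of _ m _ n] algebra_simps\<close>)+

lemma kron_smult:
  assumes "A \<in> carrier_mat m m" "B \<in> carrier_mat n n"
  shows "(c \<cdot>\<^sub>m A) \<otimes>\<^sub>m B = c \<cdot>\<^sub>m (A \<otimes>\<^sub>m B)" "A \<otimes>\<^sub>m (c \<cdot>\<^sub>m B) = c \<cdot>\<^sub>m (A \<otimes>\<^sub>m B)"
    and "(- A) \<otimes>\<^sub>m B = - (A \<otimes>\<^sub>m B)" "A \<otimes>\<^sub>m (- B) = - (A \<otimes>\<^sub>m B)"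
  by (rule kron_eqI[of _ m n]; use assms in \<open>simp add: kron_index[of _ m _ n] algebra_simps\<close>)+

lemma kron_zero: 
  assumes "A \<in> carrier_mat m m" "B \<in> carrier_mat n n"
  shows "0\<^sub>m m m \<otimes>\<^sub>m B = 0\<^sub>m (m * n) (m * n)" "A \<otimes>\<^sub>m 0\<^sub>m n n = 0\<^sub>m (m * n) (m * n)"
  by (rule kron_eqI[of _ m n]; use assms in \<open>simp add: kron_index[of _ m _ n]\<close>)+

lemma kron_pow:
  assumes "A \<in> carrier_mat m m" "B \<in> carrier_mat n n"
  shows "(A \<otimes>\<^sub>m B) ^\<^sub>m k = (A ^\<^sub>m k) \<otimes>\<^sub>m (B ^\<^sub>m k)"
proof (induction k)
  case 0
  then show ?case using assms kron_one[of m n] by (simp add: kron_def)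
next
  case (Suc k)
  then show ?case using assms by (simp add: kron_mult[of _ m _ n])
qed

lemma one_pow_mat: "1\<^sub>m n ^\<^sub>m k = (1\<^sub>m n :: 'a :: semiring_1 mat)"
  by (induction k) simp_all

text \<open>The entries of the identity are 0 or 1, so they leave the infinite sum without any
  convergence argument.\<close>

lemma kron_suminf_left:
  assumes "\<And>k. f k \<in> carrier_mat m m"
  shows "mat_suminf m f \<otimes>\<^sub>m 1\<^sub>m n = mat_suminf (m * n) (\<lambda>k. f k \<otimes>\<^sub>m 1\<^sub>m n)"
proof (rule eq_mat_carrierI[of _ "m * n"])
  fix i j assume ij: "i < m * n" "j < m * n"
  note less = div_mod_less[OF ij(1)] div_mod_less[OF ij(2)]
  have "mat_suminf (m * n) (\<lambda>k. f k \<otimes>\<^sub>m 1\<^sub>m n) $$ (i, j) =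
      (\<Sum>k. f k $$ (i div n, j div n) * 1\<^sub>m n $$ (i mod n, j mod n))"
    using ij assms by (simp add: mat_suminf_def kron_index[of _ m _ n])
  then show "(mat_suminf m f \<otimes>\<^sub>m 1\<^sub>m n) $$ (i, j) = mat_suminf (m * n) (\<lambda>k. f k \<otimes>\<^sub>m 1\<^sub>m n) $$ (i, j)"
    using ij less by (cases "i mod n = j mod n") (simp_all add: kron_index[of _ m _ n] mat_suminf_def)
qed simp_all

lemma kron_suminf_right:
  assumes "\<And>k. f k \<in> carrier_mat n n"
  shows "1\<^sub>m m \<otimes>\<^sub>m mat_suminf n f = mat_suminf (m * n) (\<lambda>k. 1\<^sub>m m \<otimes>\<^sub>m f k)"
proof (rule eq_mat_carrierI[of _ "m * n"])
  fix i j assume ij: "i < m * n" "j < m * n"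
  note less = div_mod_less[OF ij(1)] div_mod_less[OF ij(2)]
  have "mat_suminf (m * n) (\<lambda>k. 1\<^sub>m m \<otimes>\<^sub>m f k) $$ (i, j) =
      (\<Sum>k. 1\<^sub>m m $$ (i div n, j div n) * f k $$ (i mod n, j mod n))"
    using ij assms by (simp add: mat_suminf_def kron_index[of _ m _ n])
  then show "(1\<^sub>m m \<otimes>\<^sub>m mat_suminf n f) $$ (i, j) = mat_suminf (m * n) (\<lambda>k. 1\<^sub>m m \<otimes>\<^sub>m f k) $$ (i, j)"
    using ij less by (cases "i div n = j div n") (simp_all add: kron_index[of _ m _ n] mat_suminf_def)
qed simp_all

lemma kron_qpow:
  assumes "A \<in> carrier_mat m m" "B \<in> carrier_mat n n"
  shows "mat_qpow A \<otimes>\<^sub>m 1\<^sub>m n = mat_qpow (A \<otimes>\<^sub>m 1\<^sub>m n)"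
    and "1\<^sub>m m \<otimes>\<^sub>m mat_qpow B = mat_qpow (1\<^sub>m m \<otimes>\<^sub>m B)"
proof -
  have d: "dim_row (A \<otimes>\<^sub>m 1\<^sub>m n) = m * n" "dim_row (1\<^sub>m m \<otimes>\<^sub>m B) = m * n"
    using assms by simp_all
  show "mat_qpow A \<otimes>\<^sub>m 1\<^sub>m n = mat_qpow (A \<otimes>\<^sub>m 1\<^sub>m n)"
    using assms unfolding mat_qpow_def d
    by (simp add: kron_suminf_left kron_smult[of _ m _ n] kron_pow[of _ m _ n] one_pow_mat)
  show "1\<^sub>m m \<otimes>\<^sub>m mat_qpow B = mat_qpow (1\<^sub>m m \<otimes>\<^sub>m B)"
    using assms unfolding mat_qpow_def d
    by (simp add: kron_suminf_right kron_smult[of _ m _ n] kron_pow[of _ m _ n] one_pow_mat)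
qed

section \<open>The interchange of tensor factors\<close>

lemma swap_carrier [simp]: "swap_mat m n \<in> carrier_mat (m * n) (m * n)"
  by (simp add: swap_mat_def mult.commute)

lemma swap_index:
  "i < m * n \<Longrightarrow> j < m * n \<Longrightarrow>
    swap_mat m n $$ (i, j) = (if i div m = j mod n \<and> i mod m = j div n then 1 else 0)"
  by (simp add: swap_mat_def mult.commute)

lemma sum_delta2:
  fixes f :: "nat \<Rightarrow> nat \<Rightarrow> 'a :: comm_monoid_add"
  assumes "a0 < m" "c0 < n"
  shows "(\<Sum>a<m. \<Sum>c<n. if a = a0 \<and> c = c0 then f a c else 0) = f a0 c0"
proof -
  have "(\<Sum>c<n. if a = a0 \<and> c = c0 then f a c else 0) = (if a = a0 then f a0 c0 else 0)" for a
    using assms(2) by (cases "a = a0") simp_all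
  then show ?thesis using assms(1) by simp
qed

lemma swap_kron:
  assumes A: "A \<in> carrier_mat n n" and B: "B \<in> carrier_mat m m"
  shows "swap_mat n m * (A \<otimes>\<^sub>m B) = (B \<otimes>\<^sub>m A) * swap_mat n m"
proof (rule eq_mat_carrierI[of _ "m * n"])
  have AB: "A \<otimes>\<^sub>m B \<in> carrier_mat (m * n) (m * n)" and S: "swap_mat n m \<in> carrier_mat (m * n) (m * n)"
    using kron_carrier[OF A B] swap_carrier[of n m] by (simp_all add: mult.commute)
  show "swap_mat n m * (A \<otimes>\<^sub>m B) \<in> carrier_mat (m * n) (m * n)"
    "(B \<otimes>\<^sub>m A) * swap_mat n m \<in> carrier_mat (m * n) (m * n)"
    using AB S kron_carrier[OF B A] by auto
  fix i j assume ij: "i < m * n" "j < m * n"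
  then have ij': "i < n * m" "j < n * m" by (simp_all add: mult.commute)
  note less = div_mod_less[OF ij(1)] div_mod_less[OF ij'(2)]
  have "(swap_mat n m * (A \<otimes>\<^sub>m B)) $$ (i, j) =
      (\<Sum>k<n * m. if k div m = i mod n \<and> k mod m = i div n
        then A $$ (k div m, j div m) * B $$ (k mod m, j mod m) else 0)"
    using AB S ij ij' A B
    by (subst mat_mult_index[of _ "m * n"]) (auto simp: swap_index kron_index[of _ n _ m] mult.commute intro!: sum.cong)
  also have "\<dots> = A $$ (i mod n, j div m) * B $$ (i div n, j mod m)"
    unfolding sum_div_mod[where f = "\<lambda>a c. if a = i mod n \<and> c = i div n then A $$ (a, j div m) * B $$ (c, j mod m) else 0"]
    using less by (rule_tac sum_delta2)
  also have "\<dots> = (\<Sum>k<m * n. if k div n = j mod m \<and> k mod n = j div m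
        then B $$ (i div n, k div n) * A $$ (i mod n, k mod n) else 0)"
    unfolding sum_div_mod[where f = "\<lambda>c a. if c = j mod m \<and> a = j div m then B $$ (i div n, c) * A $$ (i mod n, a) else 0"]
    using less by (subst sum_delta2) (simp_all add: mult.commute)
  also have "\<dots> = ((B \<otimes>\<^sub>m A) * swap_mat n m) $$ (i, j)"
    using AB S ij ij' A B
    by (subst mat_mult_index[of _ "m * n"]) (auto simp: swap_index kron_index[of _ m _ n] mult.commute intro!: sum.cong)
  finally show "(swap_mat n m * (A \<otimes>\<^sub>m B)) $$ (i, j) = ((B \<otimes>\<^sub>m A) * swap_mat n m) $$ (i, j)" .
qed

lemma swap_swap: "swap_mat n m * swap_mat m n = 1\<^sub>m (m * n)"
proof (rule eq_mat_carrierI[of _ "m * n"])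
  have S: "swap_mat n m \<in> carrier_mat (m * n) (m * n)" "swap_mat m n \<in> carrier_mat (m * n) (m * n)"
    using swap_carrier[of n m] by (simp_all add: mult.commute)
  then show "swap_mat n m * swap_mat m n \<in> carrier_mat (m * n) (m * n)" by auto
  fix i j assume ij: "i < m * n" "j < m * n"
  then have ij': "i < n * m" "j < n * m" by (simp_all add: mult.commute)
  note less = div_mod_less[OF ij(1)]
  have "(swap_mat n m * swap_mat m n) $$ (i, j) =
      (\<Sum>k<n * m. if k div m = i mod n \<and> k mod m = i div n
        then (if k div m = j mod n \<and> k mod m = j div n then 1 else 0) else 0)"
    using S ij ij'
    by (subst mat_mult_index[of _ "m * n"]) (auto simp: swap_index mult.commute intro!: sum.cong)
  also have "\<dots> = (if i mod n = j mod n \<and> i div n = j div n then 1 else 0)"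
    unfolding sum_div_mod[where f = "\<lambda>a c. if a = i mod n \<and> c = i div n then (if a = j mod n \<and> c = j div n then 1 else 0) else 0"]
    using less by (rule_tac sum_delta2)
  also have "\<dots> = 1\<^sub>m (m * n) $$ (i, j)"
    using ij div_mod_eq_iff[of i n j] by auto
  finally show "(swap_mat n m * swap_mat m n) $$ (i, j) = 1\<^sub>m (m * n) $$ (i, j)" .
qed simp

section \<open>The legs of a tensor product\<close>

text \<open>Common interface of A \<mapsto> A \<otimes> 1 and B \<mapsto> 1 \<otimes> B, so that the
  relations of a representation are derived once for both legs. The map need not be unital, whence
  the projection in \<open>hom_qpow\<close>.\<close>

locale leg =
  fixes m :: nat and \<phi> :: "complex fps mat \<Rightarrow> linop"
  assumes hom_mult: "A \<in> carrier_mat m m \<Longrightarrow> B \<in> carrier_mat m m \<Longrightarrow> \<phi> (A * B) = \<phi> A * \<phi> B"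
    and hom_diff: "A \<in> carrier_mat m m \<Longrightarrow> B \<in> carrier_mat m m \<Longrightarrow> \<phi> (A - B) = \<phi> A - \<phi> B"
    and hom_smult: "A \<in> carrier_mat m m \<Longrightarrow> \<phi> (c \<cdot>\<^sub>m A) = scl c (\<phi> A)"
    and hom_uminus: "A \<in> carrier_mat m m \<Longrightarrow> \<phi> (- A) = - \<phi> A"
    and hom_zero: "\<phi> (0\<^sub>m m m) = 0"
    and hom_suminf: "\<And>f M. (\<And>k. f k \<in> carrier_mat m m) \<Longrightarrow> (\<And>k. k \<ge> M \<Longrightarrow> f k = 0\<^sub>m m m) \<Longrightarrow>
      \<phi> (mat_suminf m f) = (\<Sum>k<M. \<phi> (f k))"
    and hom_qpow: "A \<in> carrier_mat m m \<Longrightarrow> \<exists>Q. is_qexp (\<phi> A) Q \<and> \<phi> (mat_qpow A) = Q * \<phi> (1\<^sub>m m)"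
begin

abbreviation P :: linop where "P \<equiv> \<phi> (1\<^sub>m m)"

lemma P_mult: "A \<in> carrier_mat m m \<Longrightarrow> P * \<phi> A = \<phi> A" "A \<in> carrier_mat m m \<Longrightarrow> \<phi> A * P = \<phi> A"
  by (simp_all flip: hom_mult)

lemma P_idem: "P * P = P"
  by (rule P_mult) simp

lemma hom_pow: "A \<in> carrier_mat m m \<Longrightarrow> \<phi> (A ^\<^sub>m k) = \<phi> A ^ k * P"
proof (induction k)
  case (Suc k)
  then have "\<phi> (A ^\<^sub>m Suc k) = \<phi> A ^ k * (P * \<phi> A)"
    by (simp add: hom_mult mult.assoc)
  also have "\<dots> = \<phi> A ^ Suc k * P"
    using Suc.prems by (simp add: P_mult mult.assoc power_Suc2 del: power_Suc)
  finally show ?case .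
qed simp

end

section \<open>One-parameter groups of Cartan elements\<close>

lemma cartan_family:
  assumes k: "\<And>c. is_qexp (scl (fps_const c) h) (k c)"
  shows "k (c + d) = k c * k d" and "k 0 = 1"
proof -
  have "is_qexp (scl (fps_const c) h + scl (fps_const d) h) (k c * k d)"
    by (rule is_qexp_add[OF k k]) (simp add: mult.commute)
  moreover have "scl (fps_const c) h + scl (fps_const d) h = scl (fps_const (c + d)) h"
    by (simp flip: scl_add_left)
  ultimately show "k (c + d) = k c * k d" using is_qexp_unique[OF k] by metis
  have "is_qexp 0 1" using is_qexp_scalar[of 0] by simp
  with k[of 0] show "k 0 = 1" by (auto dest: is_qexp_unique)
qed

text \<open>Each exchange of y with q^(c h) costs q^(c d), and sorting the j-th power takes j (j -
  1) / 2 exchanges. For F, c = -1/4 and d = 2, which is the origin of the factor q^(m (m - 1) / 4)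
  in b.\<close>

lemma power_cartan_mult:
  assumes k: "\<And>c. is_qexp (scl (fps_const c) h) (k c)"
    and y: "y * h = h * y + scl (fps_const d) y"
  shows "(k c * y) ^ j = scl (q_pow (c * d * of_nat j * (of_nat j - 1) / 2)) (k (of_nat j * c) * y ^ j)"
proof (induction j)
  case 0
  show ?case by (simp add: cartan_family(2)[of h k, OF k])
next
  case (Suc j)
  have "of_nat (Suc j) * c = of_nat j * c + c" by (simp add: algebra_simps)
  then have kk: "k (of_nat (Suc j) * c) = k (of_nat j * c) * k c"
    by (simp only: cartan_family(1)[of h k, OF k])
  have "y * k c = scl (q_pow (c * d)) (k c * y)"
    by (rule is_qexp_shift[OF k]) (simp add: y distrib_right scl_add_right)
  then have yk: "y ^ j * k c = scl (q_pow (c * d) ^ j) (k c * y ^ j)"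
  proof (induction j)
    case (Suc j)
    have "y ^ Suc j * k c = y ^ j * (y * k c)" by (simp add: power_Suc2 mult.assoc del: power_Suc)
    also have "\<dots> = scl (q_pow (c * d)) (y ^ j * k c * y)" unfolding Suc.prems by (simp add: mult.assoc)
    also have "\<dots> = scl (q_pow (c * d) ^ Suc j) (k c * (y ^ j * y))"
      unfolding Suc.IH[OF Suc.prems] by (simp add: mult.assoc)
    finally show ?case by (simp add: power_Suc2 del: power_Suc)
  qed simp
  have e: "q_pow (c * d * of_nat j * (of_nat j - 1) / 2) * q_pow (c * d) ^ j =
      q_pow (c * d * of_nat (Suc j) * (of_nat (Suc j) - 1) / 2)"
    by (simp add: q_pow_power flip: q_pow_add) (simp add: field_simps)
  have "(k c * y) ^ Suc j = scl (q_pow (c * d * of_nat j * (of_nat j - 1) / 2)) (k (of_nat j * c) * (y ^ j * k c) * y)"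
    by (simp only: power_Suc2 Suc scl_mult_left mult.assoc)
  also have "\<dots> = scl (q_pow (c * d * of_nat (Suc j) * (of_nat (Suc j) - 1) / 2)) (k (of_nat j * c) * k c * (y ^ j * y))"
    unfolding yk by (simp only: scl_mult_left scl_mult_right scl_scl e) (simp only: mult.assoc)
  finally show ?case unfolding kk by (simp only: power_Suc2)
qed

lemma is_qexp_reflect:
  assumes "w * h = - (h * w)" "\<And>c. is_qexp (scl (fps_const c) h) (k c)"
  shows "w * k c = k (- c) * w"
  by (rule is_qexp_intertwine[OF assms(2) assms(2)])
    (simp add: assms(1) scl_minus_right scl_minus_left flip: fps_const_neg)

text \<open>\<open>k c\<close> stands for \<open>q\<^bsup>c H\<^esup>\<close>, extended by the identity to the complement of the image of \<open>P\<close>.\<close>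

locale rep_leg = leg m \<phi> for m \<phi> +
  fixes V :: qw_rep and k :: "complex \<Rightarrow> linop"
  assumes rep: "is_qw_rep V" and dim: "rdim V = m"
    and k: "\<And>c. is_qexp (scl (fps_const c) (\<phi> (opH V))) (k c)"
    and hom_qH: "\<And>c. \<phi> (qH V c) = k c * P"
begin

abbreviation "h \<equiv> \<phi> (opH V)"
abbreviation "x \<equiv> \<phi> (opX V)"
abbreviation "y \<equiv> \<phi> (opY V)"
abbreviation "w \<equiv> \<phi> (opW V)"
abbreviation "e \<equiv> \<phi> (opE V)"
abbreviation "f \<equiv> \<phi> (opF V)"

lemma carriers [simp]:
  "opH V \<in> carrier_mat m m" "opX V \<in> carrier_mat m m" "opY V \<in> carrier_mat m m" "opW V \<in> carrier_mat m m"
  using rep dim by (simp_all add: is_qw_rep_def is_uq_rep_def)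

lemma carriers_K [simp]: "qH V c \<in> carrier_mat m m" "opE V \<in> carrier_mat m m" "opF V \<in> carrier_mat m m"
proof -
  show *: "qH V c \<in> carrier_mat m m" for c by (simp add: qH_def)
  show "opE V \<in> carrier_mat m m" "opF V \<in> carrier_mat m m"
    by (simp_all add: opE_def opF_def opK_def opK_inv_def mult_carrier_mat[OF * carriers(2)]
        mult_carrier_mat[OF * carriers(3)])
qed

lemma P_k: "P * k c = k c * P"
  by (rule is_qexp_commute_op[OF k]) (simp add: P_mult)

lemmas k_add = cartan_family(1)[of h k, OF k] and k_0 = cartan_family(2)[of h k, OF k]

text \<open>On the complement of P the exponent is zero. Differences of Cartan elements therefore
  need no projection, as used in \<open>ef_commutator\<close>.\<close>

lemma k_complement: "k c * (1 - P) = 1 - P"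
proof -
  have "is_qexp 0 1" using is_qexp_scalar[of 0] by simp
  then have "(1 - P) * 1 = k c * (1 - P)"
    by (rule is_qexp_intertwine[OF _ k]) (simp add: right_diff_distrib P_mult)
  then show ?thesis by simp
qed

lemma e_eq: "e = k (1/4) * x" and f_eq: "f = k (-1/4) * y"
  by (simp_all add: opE_def opF_def opK_def opK_inv_def hom_mult hom_qH mult.assoc P_mult)

lemma x_h: "x * h = h * x + scl (fps_const (- 2)) x" and y_h: "y * h = h * y + scl (fps_const 2) y"
proof -
  have two: "fps_const (2 :: complex) = 2" by (simp add: numeral_fps_const)
  have "opH V * opX V - opX V * opH V = 2 \<cdot>\<^sub>m opX V" "opH V * opY V - opY V * opH V = (-2) \<cdot>\<^sub>m opY V"
    using rep by (simp_all add: is_qw_rep_def is_uq_rep_def)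
  from this[THEN arg_cong[of _ _ \<phi>]] have "h * x - x * h = scl 2 x" "h * y - y * h = scl (- 2) y"
    by (simp_all add: hom_diff hom_mult hom_smult mult_carrier_mat[of _ m m])
  then show "x * h = h * x + scl (fps_const (- 2)) x" "y * h = h * y + scl (fps_const 2) y"
    by (simp_all add: two scl_minus_left algebra_simps flip: fps_const_neg)
qed

lemma h_k: "h * k c = k c * h"
  by (rule is_qexp_commute_op[OF k]) simp

lemma e_h: "e * h = h * e - scl (fps_const 2) e" and f_h: "f * h = h * f + scl (fps_const 2) f"
proof -
  have "k c * (h * z) = h * (k c * z)" for c z by (metis h_k mult.assoc)
  then show "e * h = h * e - scl (fps_const 2) e" "f * h = h * f + scl (fps_const 2) f"
    by (simp_all add: e_eq f_eq mult.assoc x_h y_h distrib_left right_diff_distrib scl_minus_left flip: fps_const_neg)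
qed

lemma x_k: "x * k c = scl (q_pow (- 2 * c)) (k c * x)" and y_k: "y * k c = scl (q_pow (2 * c)) (k c * y)"
  by (rule is_qexp_shift[OF k]; simp add: x_h y_h distrib_right scl_add_right mult.commute)+

lemma w_h: "w * h = - (h * w)"
  and w_x: "w * x = scl (- q_pow (1/2)) (y * w)"
  and w_y: "w * y = scl (- q_pow (-1/2)) (x * w)"
proof -
  have "opW V * opH V = - (opH V * opW V)" "opW V * opX V = (- q_pow (1/2)) \<cdot>\<^sub>m (opY V * opW V)"
    "opW V * opY V = (- q_pow (-1/2)) \<cdot>\<^sub>m (opX V * opW V)"
    using rep by (simp_all add: is_qw_rep_def)
  from this[THEN arg_cong[of _ _ \<phi>]] show "w * h = - (h * w)"
    "w * x = scl (- q_pow (1/2)) (y * w)" "w * y = scl (- q_pow (-1/2)) (x * w)"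
    by (simp_all add: hom_uminus hom_mult hom_smult mult_carrier_mat[of _ m m])
qed

lemma e_w: "e * w = scl (- q_pow (1/2)) (w * f)" and f_w: "f * w = scl (- q_pow (-1/2)) (w * e)"
proof -
  have qq: "- q_pow (1/2) * - q_pow (-1/2) = 1" "- q_pow (-1/2) * - q_pow (1/2) = 1"
    by (simp_all flip: q_pow_add)
  have xw: "x * w = scl (- q_pow (1/2)) (w * y)" and yw: "y * w = scl (- q_pow (-1/2)) (w * x)"
    unfolding w_x w_y scl_scl qq by simp_all
  have kw: "k c * w = w * k (- c)" for c
    using is_qexp_reflect[of w h k "- c", OF w_h k] by simp
  have "e * w = scl (- q_pow (1/2)) (k (1/4) * w * y)"
    by (simp add: e_eq mult.assoc xw)
  then show "e * w = scl (- q_pow (1/2)) (w * f)" by (simp add: kw f_eq mult.assoc)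
  have "f * w = scl (- q_pow (-1/2)) (k (-1/4) * w * x)"
    by (simp add: f_eq mult.assoc yw)
  then show "f * w = scl (- q_pow (-1/2)) (w * e)" by (simp add: kw e_eq mult.assoc)
qed

text \<open>Passing to E and F multiplies both x y and y x by the same q^(1/2), and (1 - p) q^(1/2)
  is the denominator of the relation for [X, Y].\<close>

lemma ef_commutator: "scl (1 - p) (e * f - f * e) = k (1/2) - k (-1/2)"
proof -
  have K: "opK V \<in> carrier_mat m m" "opK_inv V \<in> carrier_mat m m"
    by (simp_all add: opK_def opK_inv_def)
  have "(q_pow (1/2) - q_pow (-1/2)) \<cdot>\<^sub>m (opX V * opY V - opY V * opX V) =
      opK V * opK V - opK_inv V * opK_inv V"
    using rep by (simp add: is_qw_rep_def is_uq_rep_def)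
  from this[THEN arg_cong[of _ _ \<phi>]]
  have "scl (q_pow (1/2) - q_pow (-1/2)) (x * y - y * x) =
      \<phi> (opK V) * \<phi> (opK V) - \<phi> (opK_inv V) * \<phi> (opK_inv V)"
    using K by (simp add: hom_diff hom_mult hom_smult mult_carrier_mat[of _ m m] minus_carrier_mat)
  also have "\<phi> (opK V) * \<phi> (opK V) = k (1/4) * (P * k (1/4)) * P"
    by (simp add: opK_def hom_qH mult.assoc)
  also have "\<dots> = k (1/2) * P"
    unfolding P_k using k_add[of "1/4" "1/4"] by (simp add: mult.assoc P_idem)
  also have "\<phi> (opK_inv V) * \<phi> (opK_inv V) = k (-1/4) * (P * k (-1/4)) * P"
    by (simp add: opK_inv_def hom_qH mult.assoc)
  also have "\<dots> = k (-1/2) * P"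
    unfolding P_k using k_add[of "-1/4" "-1/4"] by (simp add: mult.assoc P_idem)
  also have "k (1/2) * P - k (-1/2) * P = k (1/2) - k (-1/2)"
  proof -
    have "k c * P = k c - k c * (1 - P)" for c by (simp add: right_diff_distrib)
    then have "k c * P = k c - (1 - P)" for c by (simp only: k_complement)
    then show ?thesis by simp
  qed
  finally have xy: "scl (q_pow (1/2) - q_pow (-1/2)) (x * y - y * x) = k (1/2) - k (-1/2)" .
  have kk: "k (1/4) * (k (- (1/4)) * z) = z" "k (- (1/4)) * (k (1/4) * z) = z" for z
    using k_add[of "1/4" "- (1/4)"] k_add[of "- (1/4)" "1/4"] by (simp_all add: k_0 flip: mult.assoc)
  have "e * f = k (1/4) * (x * k (-1/4)) * y" "f * e = k (-1/4) * (y * k (1/4)) * x"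
    by (simp_all add: e_eq f_eq mult.assoc)
  then have "e * f - f * e = scl (q_pow (1/2)) (x * y - y * x)"
    unfolding x_k y_k by (simp add: mult.assoc kk scl_diff_right)
  then have "scl (1 - p) (e * f - f * e) = scl ((1 - p) * q_pow (1/2)) (x * y - y * x)" by simp
  also have "(1 - p) * q_pow (1/2) = q_pow (1/2) - q_pow (-1/2)"
    by (simp add: left_diff_distrib flip: q_pow_add)
  finally show ?thesis unfolding xy .
qed

lemma y_nilpotent: "\<exists>M. \<forall>j\<ge>M. opY V ^\<^sub>m j = 0\<^sub>m m m"
  by (rule nilpotent_if_commutator[of _ _ "opH V" "-2"])
    (use rep in \<open>simp_all add: is_qw_rep_def is_uq_rep_def\<close>)

lemma x_nilpotent: "\<exists>M. \<forall>j\<ge>M. opX V ^\<^sub>m j = 0\<^sub>m m m"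
  by (rule nilpotent_if_commutator[of _ _ "opH V" 2])
    (use rep in \<open>simp_all add: is_qw_rep_def is_uq_rep_def\<close>)

lemma power_eq_0_if_mat:
  assumes A: "A \<in> carrier_mat m m" and "\<forall>j\<ge>M. A ^\<^sub>m j = 0\<^sub>m m m"
  shows "\<phi> A ^ Suc M = 0"
proof -
  \<comment> \<open>One spare factor absorbs the projection that \<open>hom_pow\<close> leaves
    behind.\<close>
  have "A ^\<^sub>m Suc M = 0\<^sub>m m m" using assms(2) le_SucI[OF order_refl] by blast
  then have "0 = \<phi> (A ^\<^sub>m Suc M)" using hom_zero by (simp only:)
  also have "\<dots> = \<phi> A ^ M * (\<phi> A * P)"
    unfolding hom_pow[OF A] by (simp only: power_Suc2 mult.assoc)
  also have "\<dots> = \<phi> A ^ Suc M" unfolding P_mult(2)[OF A] by (simp only: power_Suc2)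
  finally show ?thesis ..
qed

lemma e_nilpotent: "\<exists>M. e ^ M = 0" and f_nilpotent: "\<exists>M. f ^ M = 0"
proof -
  obtain M where "\<forall>j\<ge>M. opX V ^\<^sub>m j = 0\<^sub>m m m" using x_nilpotent by blast
  from power_eq_0_if_mat[OF _ this] have "x ^ Suc M = 0" by simp
  then show "\<exists>M. e ^ M = 0"
    by (intro exI[of _ "Suc M"]) (simp only: e_eq power_cartan_mult[OF k x_h] mult_zero_right scl_zero_right)
  obtain M where "\<forall>j\<ge>M. opY V ^\<^sub>m j = 0\<^sub>m m m" using y_nilpotent by blast
  from power_eq_0_if_mat[OF _ this] have "y ^ Suc M = 0" by simp
  then show "\<exists>M. f ^ M = 0"
    by (intro exI[of _ "Suc M"]) (simp only: f_eq power_cartan_mult[OF k y_h] mult_zero_right scl_zero_right)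
qed

lemma hom_t:
  fixes \<beta> :: "nat \<Rightarrow> complex fps"
  defines "b \<equiv> \<lambda>n. q_pow (of_nat n * (of_nat n - 1) / 4) * \<beta> n"
  assumes D: "is_qexp (scl (fps_const (-1/8)) (h * h)) D"
  shows "\<phi> (qw_t \<beta> V) = w * D * nil_eval b f * P"
proof -
  have V: "V \<in> qw_reps" using rep by (simp add: qw_reps_def)
  have HH: "fps_const (-1/8) \<cdot>\<^sub>m (opH V * opH V) \<in> carrier_mat m m"
    by (simp add: mult_carrier_mat[of _ m m])
  obtain Q' where Q': "is_qexp (scl (fps_const (-1/8)) (h * h)) Q'"
    "\<phi> (mat_qpow (fps_const (-1/8) \<cdot>\<^sub>m (opH V * opH V))) = Q' * P"
    using hom_qpow[OF HH] by (auto simp: hom_smult hom_mult mult_carrier_mat[of _ m m])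
  have D': "\<phi> (mat_qpow (fps_const (-1/8) \<cdot>\<^sub>m (opH V * opH V))) = D * P"
    using Q' is_qexp_unique[OF D] by metis
  obtain M where M: "\<forall>j\<ge>M. opY V ^\<^sub>m j = 0\<^sub>m m m" using y_nilpotent by blast
  have f_pow: "f ^ j = scl (q_pow (- (of_nat j * (of_nat j - 1) / 4))) (k (- of_nat j / 4) * y ^ j)" for j
    unfolding f_eq power_cartan_mult[OF k y_h] by (simp add: mult.commute)
  have y0: "y ^ Suc M = 0" using power_eq_0_if_mat[OF _ M] by simp
  then have f0: "f ^ Suc M = 0" unfolding f_pow by (simp only: mult_zero_right scl_zero_right)
  let ?s = "\<lambda>j. \<beta> j \<cdot>\<^sub>m (qH V (- of_nat j / 4) * (opY V ^\<^sub>m j))"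
  have s: "?s j \<in> carrier_mat m m" for j by (simp add: mult_carrier_mat[of _ m m])
  have "\<phi> (?s j) = scl (b j) (f ^ j) * P" for j
  proof -
    have "\<phi> (?s j) = scl (\<beta> j) (k (- of_nat j / 4) * (P * \<phi> (opY V ^\<^sub>m j)))"
      by (simp add: hom_smult hom_mult mult_carrier_mat[of _ m m] hom_qH mult.assoc)
    also have "\<dots> = scl (\<beta> j) (k (- of_nat j / 4) * y ^ j) * P"
      by (simp add: P_mult) (simp add: hom_pow mult.assoc)
    also have "scl (\<beta> j) (k (- of_nat j / 4) * y ^ j) = scl (b j) (f ^ j)"
      by (simp add: f_pow b_def mult_ac)
    finally show ?thesis .
  qed
  moreover have "\<phi> (mat_suminf m ?s) = (\<Sum>j<Suc M. \<phi> (?s j))"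
  proof (rule hom_suminf[OF s])
    fix j assume "Suc M \<le> j"
    then show "?s j = 0\<^sub>m m m" using M by (simp add: right_mult_zero_mat[of _ m m])
  qed
  ultimately have S: "\<phi> (mat_suminf m ?s) = nil_eval b f * P"
    by (simp add: nil_eval_eq[OF f0] sum_distrib_right distrib_right)
  define B where "B = mat_qpow (fps_const (-1/8) \<cdot>\<^sub>m (opH V * opH V))"
  have B: "B \<in> carrier_mat m m" using HH by (simp add: B_def)
  have "qw_t \<beta> V = opW V * B * mat_suminf m ?s" using V by (simp add: qw_t_def dim B_def)
  then have "\<phi> (qw_t \<beta> V) = w * \<phi> B * \<phi> (mat_suminf m ?s)"
    using B by (simp only: hom_mult mult_carrier_mat[of _ m m] carriers mat_suminf_carrier)
  then have "\<phi> (qw_t \<beta> V) = w * (D * P) * (nil_eval b f * P)"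
    unfolding S by (simp only: B_def D')
  also have "\<dots> = w * D * (P * nil_eval b f) * P" by (simp only: mult.assoc)
  also have "P * nil_eval b f = nil_eval b f * P"
    by (rule nil_eval_intertwine[symmetric, OF _ f0 f0]) (simp add: P_mult)
  also have "w * D * (nil_eval b f * P) * P = w * D * nil_eval b f * P"
    by (simp add: mult.assoc P_idem)
  finally show ?thesis .
qed

end

section \<open>The two legs as instances\<close>

lemma (in leg) ex_rep_leg:
  assumes "is_qw_rep V" "rdim V = m"
  shows "\<exists>k. rep_leg m \<phi> V k"
proof -
  have H: "opH V \<in> carrier_mat m m" using assms by (simp add: is_qw_rep_def is_uq_rep_def)
  have "\<exists>Q. is_qexp (scl (fps_const c) (\<phi> (opH V))) Q \<and> \<phi> (qH V c) = Q * P" for c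
    using hom_qpow[of "fps_const c \<cdot>\<^sub>m opH V"] H by (simp add: qH_def hom_smult)
  then obtain k where "\<And>c. is_qexp (scl (fps_const c) (\<phi> (opH V))) (k c) \<and> \<phi> (qH V c) = k c * P"
    by metis
  then have "rep_leg m \<phi> V k" using assms by unfold_locales auto
  then show ?thesis by blast
qed

lemma leg_left: "leg m (\<lambda>A. emb (m * n) (A \<otimes>\<^sub>m 1\<^sub>m n))"
proof
  fix A B :: "complex fps mat" and c assume A: "A \<in> carrier_mat m m"
  show "emb (m * n) ((c \<cdot>\<^sub>m A) \<otimes>\<^sub>m 1\<^sub>m n) = scl c (emb (m * n) (A \<otimes>\<^sub>m 1\<^sub>m n))"
    "emb (m * n) (- A \<otimes>\<^sub>m 1\<^sub>m n) = - emb (m * n) (A \<otimes>\<^sub>m 1\<^sub>m n)"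
    using A by (simp_all add: kron_smult[of _ m _ n] emb_smult emb_uminus)
  have "is_qexp (emb (m * n) (A \<otimes>\<^sub>m 1\<^sub>m n)) (qexp_op (m * n) (A \<otimes>\<^sub>m 1\<^sub>m n))"
    using A by (intro is_qexp_qexp_op) simp
  then show "\<exists>Q. is_qexp (emb (m * n) (A \<otimes>\<^sub>m 1\<^sub>m n)) Q \<and>
      emb (m * n) (mat_qpow A \<otimes>\<^sub>m 1\<^sub>m n) = Q * emb (m * n) (1\<^sub>m m \<otimes>\<^sub>m 1\<^sub>m n)"
    using A emb_mat_qpow(2)[of "A \<otimes>\<^sub>m 1\<^sub>m n" "m * n"]
    by (auto simp: kron_qpow(1)[of _ m "1\<^sub>m n" n] kron_one)
  assume B: "B \<in> carrier_mat m m"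
  show "emb (m * n) ((A * B) \<otimes>\<^sub>m 1\<^sub>m n) = emb (m * n) (A \<otimes>\<^sub>m 1\<^sub>m n) * emb (m * n) (B \<otimes>\<^sub>m 1\<^sub>m n)"
    using A B kron_mult[of A m "1\<^sub>m n" n B "1\<^sub>m n"] emb_mult[of "A \<otimes>\<^sub>m 1\<^sub>m n" "m * n" "B \<otimes>\<^sub>m 1\<^sub>m n"] by simp
  show "emb (m * n) ((A - B) \<otimes>\<^sub>m 1\<^sub>m n) = emb (m * n) (A \<otimes>\<^sub>m 1\<^sub>m n) - emb (m * n) (B \<otimes>\<^sub>m 1\<^sub>m n)"
    using A B by (simp add: kron_diff(1)[of _ m _ n] emb_diff)
next
  show "emb (m * n) (0\<^sub>m m m \<otimes>\<^sub>m 1\<^sub>m n) = 0"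
    by (simp add: kron_zero(1)[of "1\<^sub>m m" m "1\<^sub>m n" n] emb_zero)
next
  fix f :: "nat \<Rightarrow> complex fps mat" and M
  assume "\<And>k. f k \<in> carrier_mat m m" "\<And>k. M \<le> k \<Longrightarrow> f k = 0\<^sub>m m m"
  then show "emb (m * n) (mat_suminf m f \<otimes>\<^sub>m 1\<^sub>m n) = (\<Sum>k<M. emb (m * n) (f k \<otimes>\<^sub>m 1\<^sub>m n))"
    by (subst kron_suminf_left, simp, subst mat_suminf_finite[of _ "m * n" M])
      (simp_all add: kron_zero(1)[of "1\<^sub>m m" m "1\<^sub>m n" n])
qed

lemma leg_right: "leg n (\<lambda>B. emb (m * n) (1\<^sub>m m \<otimes>\<^sub>m B))"
proof
  fix A B :: "complex fps mat" and c assume A: "A \<in> carrier_mat n n"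
  show "emb (m * n) (1\<^sub>m m \<otimes>\<^sub>m (c \<cdot>\<^sub>m A)) = scl c (emb (m * n) (1\<^sub>m m \<otimes>\<^sub>m A))"
    "emb (m * n) (1\<^sub>m m \<otimes>\<^sub>m - A) = - emb (m * n) (1\<^sub>m m \<otimes>\<^sub>m A)"
    using A by (simp_all add: kron_smult[of _ m _ n] emb_smult emb_uminus)
  have "is_qexp (emb (m * n) (1\<^sub>m m \<otimes>\<^sub>m A)) (qexp_op (m * n) (1\<^sub>m m \<otimes>\<^sub>m A))"
    using A by (intro is_qexp_qexp_op) simp
  then show "\<exists>Q. is_qexp (emb (m * n) (1\<^sub>m m \<otimes>\<^sub>m A)) Q \<and>
      emb (m * n) (1\<^sub>m m \<otimes>\<^sub>m mat_qpow A) = Q * emb (m * n) (1\<^sub>m m \<otimes>\<^sub>m 1\<^sub>m n)"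
    using A emb_mat_qpow(2)[of "1\<^sub>m m \<otimes>\<^sub>m A" "m * n"]
    by (auto simp: kron_qpow(2)[of "1\<^sub>m m" m _ n] kron_one)
  assume B: "B \<in> carrier_mat n n"
  show "emb (m * n) (1\<^sub>m m \<otimes>\<^sub>m (A * B)) = emb (m * n) (1\<^sub>m m \<otimes>\<^sub>m A) * emb (m * n) (1\<^sub>m m \<otimes>\<^sub>m B)"
    using A B kron_mult[of "1\<^sub>m m" m A n "1\<^sub>m m" B] emb_mult[of "1\<^sub>m m \<otimes>\<^sub>m A" "m * n" "1\<^sub>m m \<otimes>\<^sub>m B"] by simp
  show "emb (m * n) (1\<^sub>m m \<otimes>\<^sub>m (A - B)) = emb (m * n) (1\<^sub>m m \<otimes>\<^sub>m A) - emb (m * n) (1\<^sub>m m \<otimes>\<^sub>m B)"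
    using A B by (simp add: kron_diff(2)[of _ m _ n] emb_diff)
next
  show "emb (m * n) (1\<^sub>m m \<otimes>\<^sub>m 0\<^sub>m n n) = 0"
    by (simp add: kron_zero(2)[of _ m "1\<^sub>m n" n] emb_zero)
next
  fix f :: "nat \<Rightarrow> complex fps mat" and M
  assume "\<And>k. f k \<in> carrier_mat n n" "\<And>k. M \<le> k \<Longrightarrow> f k = 0\<^sub>m n n"
  then show "emb (m * n) (1\<^sub>m m \<otimes>\<^sub>m mat_suminf n f) = (\<Sum>k<M. emb (m * n) (1\<^sub>m m \<otimes>\<^sub>m f k))"
    by (subst kron_suminf_right, simp, subst mat_suminf_finite[of _ "m * n" M])
      (simp_all add: kron_zero(2)[of _ m "1\<^sub>m n" n])
qed

lemma emb_legs:
  assumes "A \<in> carrier_mat m m" "B \<in> carrier_mat n n"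
  shows "emb (m * n) (A \<otimes>\<^sub>m 1\<^sub>m n) * emb (m * n) (1\<^sub>m m \<otimes>\<^sub>m B) = emb (m * n) (A \<otimes>\<^sub>m B)"
    and "emb (m * n) (1\<^sub>m m \<otimes>\<^sub>m B) * emb (m * n) (A \<otimes>\<^sub>m 1\<^sub>m n) = emb (m * n) (A \<otimes>\<^sub>m B)"
  using assms by (simp_all add: kron_mult[of _ m _ n] flip: emb_mult)

section \<open>The universal \<open>R\<close>-matrix on a pair of representations\<close>

text \<open>The two tensor factors commute as operators, so nilpotency of F in its leg is
  enough.\<close>

lemma kron_EF_nilpotent:
  assumes V: "is_qw_rep V" and W: "is_qw_rep W"
  shows "\<exists>M. emb (rdim V * rdim W) (opE V \<otimes>\<^sub>m opF W) ^ M = 0"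
proof -
  let ?m = "rdim V" and ?n = "rdim W"
  obtain k where "rep_leg ?m (\<lambda>A. emb (?m * ?n) (A \<otimes>\<^sub>m 1\<^sub>m ?n)) V k"
    using leg.ex_rep_leg[OF leg_left V refl] by blast
  then interpret L: rep_leg ?m "\<lambda>A. emb (?m * ?n) (A \<otimes>\<^sub>m 1\<^sub>m ?n)" V k .
  obtain k' where "rep_leg ?n (\<lambda>B. emb (?m * ?n) (1\<^sub>m ?m \<otimes>\<^sub>m B)) W k'"
    using leg.ex_rep_leg[OF leg_right W refl] by blast
  then interpret R: rep_leg ?n "\<lambda>B. emb (?m * ?n) (1\<^sub>m ?m \<otimes>\<^sub>m B)" W k' .
  let ?e = "emb (?m * ?n) (opE V \<otimes>\<^sub>m 1\<^sub>m ?n)" and ?f = "emb (?m * ?n) (1\<^sub>m ?m \<otimes>\<^sub>m opF W)"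
  have EF: "?e * ?f = emb (?m * ?n) (opE V \<otimes>\<^sub>m opF W)" "?f * ?e = emb (?m * ?n) (opE V \<otimes>\<^sub>m opF W)"
    using emb_legs[OF L.carriers_K(2) R.carriers_K(3)] by simp_all
  obtain M where "?f ^ M = 0" using R.f_nilpotent by blast
  then have "(?e * ?f) ^ M = 0" using EF by (intro nilpotent_mult_commuting) simp_all
  then show ?thesis unfolding EF by blast
qed

lemma emb_nil_series:
  assumes A: "A \<in> carrier_mat n n" and nil: "emb n A ^ M = 0"
  shows "emb n (mat_suminf n (\<lambda>k. f k \<cdot>\<^sub>m (A ^\<^sub>m k))) = nil_eval f (emb n A) * emb n (1\<^sub>m n)"
proof -
  have "A ^\<^sub>m k = 0\<^sub>m n n" if "M \<le> k" for k
  proof (rule emb_inject)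
    show "emb n (A ^\<^sub>m k) = emb n (0\<^sub>m n n)"
      by (simp add: emb_pow[OF A] emb_zero power_eq_0_mono[OF nil that])
  qed (use A in simp_all)
  then have "emb n (mat_suminf n (\<lambda>k. f k \<cdot>\<^sub>m (A ^\<^sub>m k))) = (\<Sum>k<M. emb n (f k \<cdot>\<^sub>m (A ^\<^sub>m k)))"
    using A by (intro mat_suminf_finite) simp_all
  then show ?thesis
    using A by (simp add: nil_eval_eq[OF nil] emb_smult emb_pow sum_distrib_right)
qed

lemma rep_carriers:
  assumes "is_qw_rep V"
  shows "opH V \<in> carrier_mat (rdim V) (rdim V)" "opE V \<in> carrier_mat (rdim V) (rdim V)"
    "opF V \<in> carrier_mat (rdim V) (rdim V)"
proof -
  \<comment> \<open>A one-dimensional second tensor factor makes the facts of \<open>rep_leg\<close>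
    available for a single representation.\<close>
  obtain k where "rep_leg (rdim V) (\<lambda>A. emb (rdim V * 1) (A \<otimes>\<^sub>m 1\<^sub>m 1)) V k"
    using leg.ex_rep_leg[OF leg_left assms refl] by blast
  then interpret rep_leg "rdim V" "\<lambda>A. emb (rdim V * 1) (A \<otimes>\<^sub>m 1\<^sub>m 1)" V k .
  show "opH V \<in> carrier_mat (rdim V) (rdim V)" "opE V \<in> carrier_mat (rdim V) (rdim V)"
    "opF V \<in> carrier_mat (rdim V) (rdim V)"
    by simp_all
qed

lemma emb_R:
  fixes V W :: qw_rep
  defines "N \<equiv> rdim V * rdim W"
  assumes V: "is_qw_rep V" and W: "is_qw_rep W"
  shows "emb N (uq_R V W) = qexp_op N (fps_const (1/4) \<cdot>\<^sub>m (opH V \<otimes>\<^sub>m opH W)) *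
      nil_eval R_coeff (emb N (opE V \<otimes>\<^sub>m opF W)) * emb N (1\<^sub>m N)"
    and "uq_R V W \<in> carrier_mat N N"
proof -
  note c = rep_carriers[OF V] rep_carriers[OF W]
  let ?H = "fps_const (1/4) \<cdot>\<^sub>m (opH V \<otimes>\<^sub>m opH W)" and ?A = "opE V \<otimes>\<^sub>m opF W"
  have H: "?H \<in> carrier_mat N N" and A: "?A \<in> carrier_mat N N" using c by (simp_all add: N_def)
  let ?S = "mat_suminf N (\<lambda>n. R_coeff n \<cdot>\<^sub>m ?A ^\<^sub>m n)"
  have R: "uq_R V W = mat_qpow ?H * ?S"
    using c by (simp add: uq_R_def N_def kron_pow)
  show "uq_R V W \<in> carrier_mat N N"
    unfolding R by (rule mult_carrier_mat[OF mat_qpow_carrier[OF H] mat_suminf_carrier])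
  obtain M where M: "emb N ?A ^ M = 0" using kron_EF_nilpotent[OF V W] by (auto simp: N_def)
  let ?P = "emb N (1\<^sub>m N)"
  have "?P * nil_eval R_coeff (emb N ?A) = nil_eval R_coeff (emb N ?A) * ?P"
    by (rule nil_eval_intertwine[symmetric, OF _ M M]) (simp add: emb_one_mult[OF A])
  moreover have "?P * ?P = ?P" by (rule emb_one_mult(1)) simp
  moreover have "emb N (uq_R V W) = qexp_op N ?H * ?P * (nil_eval R_coeff (emb N ?A) * ?P)"
    unfolding R by (simp add: emb_mult[OF mat_qpow_carrier[OF H] mat_suminf_carrier]
        emb_mat_qpow(2)[OF H] emb_nil_series[OF A M])
  ultimately show "emb N (uq_R V W) = qexp_op N ?H * nil_eval R_coeff (emb N ?A) * ?P"
    by (metis mult.assoc)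
qed

text \<open>The interchange carries H \<otimes> H and E \<otimes> F over to the other order of legs,
  hence also the exponential and the series built from them.\<close>

lemma emb_flip_R:
  fixes V W :: qw_rep
  defines "m \<equiv> rdim V" and "n \<equiv> rdim W"
  assumes V: "is_qw_rep V" and W: "is_qw_rep W"
  shows "emb (m * n) (swap_mat n m * uq_R W V * swap_mat m n) =
      qexp_op (m * n) (fps_const (1/4) \<cdot>\<^sub>m (opH V \<otimes>\<^sub>m opH W)) *
      nil_eval R_coeff (emb (m * n) (opF V \<otimes>\<^sub>m opE W)) * emb (m * n) (1\<^sub>m (m * n))"
proof -
  let ?N = "m * n"
  let ?s = "emb ?N (swap_mat n m)" and ?s' = "emb ?N (swap_mat m n)" and ?P = "emb ?N (1\<^sub>m ?N)"
  let ?H = "fps_const (1/4) \<cdot>\<^sub>m (opH V \<otimes>\<^sub>m opH W)" and ?H' = "fps_const (1/4) \<cdot>\<^sub>m (opH W \<otimes>\<^sub>m opH V)"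
  let ?A = "opF V \<otimes>\<^sub>m opE W" and ?A' = "opE W \<otimes>\<^sub>m opF V"
  have cV: "opH V \<in> carrier_mat m m" "opF V \<in> carrier_mat m m"
    and cW: "opH W \<in> carrier_mat n n" "opE W \<in> carrier_mat n n"
    using rep_carriers[OF V] rep_carriers[OF W] by (simp_all add: m_def n_def)
  have nm: "n * m = ?N" by simp
  have S: "swap_mat n m \<in> carrier_mat ?N ?N" "swap_mat m n \<in> carrier_mat ?N ?N"
    using swap_carrier[of n m] by (simp_all add: mult.commute)
  have H: "?H \<in> carrier_mat ?N ?N" "opH V \<otimes>\<^sub>m opH W \<in> carrier_mat ?N ?N"
    and A: "?A \<in> carrier_mat ?N ?N" using cV cW by simp_all
  have H': "?H' \<in> carrier_mat ?N ?N" "opH W \<otimes>\<^sub>m opH V \<in> carrier_mat ?N ?N"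
    and A': "?A' \<in> carrier_mat ?N ?N"
    using kron_carrier[OF cW(1) cV(1)] kron_carrier[OF cW(2) cV(2)] by (simp_all add: nm)
  have R: "uq_R W V \<in> carrier_mat ?N ?N"
    "emb ?N (uq_R W V) = qexp_op ?N ?H' * nil_eval R_coeff (emb ?N ?A') * ?P"
    using emb_R[OF W V] by (simp_all only: m_def[symmetric] n_def[symmetric] nm)
  have sH: "?s * emb ?N ?H' = emb ?N ?H * ?s"
    using swap_kron[OF cW(1) cV(1)] by (simp add: emb_smult[OF H(2)] emb_smult[OF H'(2)] flip: emb_mult[OF S(1) H'(2)] emb_mult[OF H(2) S(1)])
  have sQ: "?s * qexp_op ?N ?H' = qexp_op ?N ?H * ?s"
    by (rule is_qexp_intertwine[OF is_qexp_qexp_op[OF H'(1)] is_qexp_qexp_op[OF H(1)] sH])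
  have ss: "?s * ?s' = ?P"
    using swap_swap[of n m] by (simp flip: emb_mult[OF S])
  have sA: "?s * emb ?N ?A' = emb ?N ?A * ?s"
    using swap_kron[OF cW(2) cV(2)] by (simp flip: emb_mult[OF S(1) A'] emb_mult[OF A S(1)])
  obtain M where M: "emb ?N ?A' ^ M = 0"
    using kron_EF_nilpotent[OF W V] by (auto simp only: m_def[symmetric] n_def[symmetric] nm)
  have As: "emb ?N ?A = ?s * emb ?N ?A' * ?s'"
    unfolding sA by (simp add: mult.assoc ss emb_one_mult[OF A])
  \<comment> \<open>The two interchanges multiply to the projection and not to 1; one further factor
    of A absorbs it, which raises the exponent by one.\<close>
  have "emb ?N ?A ^ Suc M = 0"
  proof -
    have "?s * emb ?N ?A' ^ M = emb ?N ?A ^ M * ?s" by (rule power_intertwine[OF sA])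
    then have "emb ?N ?A ^ M * ?s = 0" by (simp add: M)
    then have "emb ?N ?A ^ M * (?s * ?s') = 0" by (simp flip: mult.assoc)
    then have "emb ?N ?A ^ M * (?P * emb ?N ?A) = 0" by (simp add: ss flip: mult.assoc)
    then show ?thesis by (simp add: emb_one_mult[OF A] power_Suc2 del: power_Suc)
  qed
  then have s\<Theta>: "nil_eval R_coeff (emb ?N ?A) * ?s = ?s * nil_eval R_coeff (emb ?N ?A')"
    using M by (intro nil_eval_intertwine[OF sA[symmetric], of "Suc M"]) simp_all
  have "emb ?N (swap_mat n m * uq_R W V * swap_mat m n) = ?s * emb ?N (uq_R W V) * ?s'"
    using emb_mult[OF S(1) R(1)] emb_mult[OF mult_carrier_mat[OF S(1) R(1)] S(2)] by simp
  also have "\<dots> = ?s * qexp_op ?N ?H' * nil_eval R_coeff (emb ?N ?A') * (?P * ?s')"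
    unfolding R(2) by (simp only: mult.assoc)
  also have "\<dots> = qexp_op ?N ?H * (?s * nil_eval R_coeff (emb ?N ?A')) * ?s'"
    unfolding sQ emb_one_mult[OF S(2)] by (simp only: mult.assoc)
  also have "\<dots> = qexp_op ?N ?H * nil_eval R_coeff (emb ?N ?A) * (?s * ?s')"
    unfolding s\<Theta>[symmetric] by (simp only: mult.assoc)
  finally show ?thesis unfolding ss .
qed

section \<open>From the recursion for \<beta> to the reflection equation\<close>

lemma hermite_coeffs_beta:
  fixes \<beta> :: "nat \<Rightarrow> complex fps"
  assumes "\<beta> 0 = 1"
    and rec: "\<And>a. a \<ge> 1 \<Longrightarrow>
      \<beta> (a + 1) =
        (\<beta> a * \<beta> 1 + \<beta> (a - 1) * (q_pow (-1) - 1) * q_pow ((1 - of_nat a) / 2)) / q_int (a + 1)"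
  shows "hermite_coeffs (\<lambda>n. q_pow (of_nat n * (of_nat n - 1) / 4) * \<beta> n) (\<beta> 1)"
proof
  let ?q = "\<lambda>n. q_pow (of_nat n * (of_nat n - 1) / 4)"
  show "?q 0 * \<beta> 0 = 1" using assms(1) by simp
  fix n
  show "p_int (Suc n) * (?q (Suc n) * \<beta> (Suc n)) =
      \<beta> 1 * (?q n * \<beta> n) - (1 - p) * (if n = 0 then 0 else ?q (n - 1) * \<beta> (n - 1))"
  proof (cases n)
    \<comment> \<open>The given recursion starts at a = 1; here the claim is just \<beta>1 =
      \<beta>1.\<close>
    case 0
    then show ?thesis using assms(1) by (simp add: p_int_1)
  next
    case (Suc a)
    have "q_int (n + 1) * \<beta> (n + 1) = \<beta> n * \<beta> 1 + \<beta> (n - 1) * (p - 1) * q_pow ((1 - of_nat n) / 2)"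
    proof -
      have "n \<ge> 1" using Suc by simp
      show ?thesis unfolding rec[OF \<open>n \<ge> 1\<close>]
        by (rule unit_div_mult) (simp add: q_int_nth_0 del: of_nat_add of_nat_Suc)
    qed
    then have q: "q_pow (of_nat n / 2) * p_int (Suc n) * \<beta> (Suc n) =
        \<beta> n * \<beta> 1 + \<beta> (n - 1) * (p - 1) * q_pow ((1 - of_nat n) / 2)"
      by (simp add: q_int_eq)
    \<comment> \<open>The increment q^(n / 2) of the weight is the factor between [n + 1] and its
      p-integer; by \<open>e2\<close> the same weight absorbs the power q^((1 - n) / 2) of the
      recursion.\<close>
    have e1: "?q (Suc n) = ?q n * q_pow (of_nat n / 2)"
      unfolding q_pow_add[symmetric] by (simp add: field_simps)
    have e2: "?q n * q_pow ((1 - of_nat n) / 2) = ?q (n - 1)"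
    proof -
      have "of_nat n * (of_nat n - 1) / 4 + (1 - of_nat n) / 2 =
          (of_nat (n - 1) * (of_nat (n - 1) - 1) / 4 :: complex)"
        using Suc by (simp add: field_simps)
      then show ?thesis unfolding q_pow_add[symmetric] by (simp only:)
    qed
    have "p_int (Suc n) * (?q (Suc n) * \<beta> (Suc n)) = ?q n * (q_pow (of_nat n / 2) * p_int (Suc n) * \<beta> (Suc n))"
      unfolding e1 by (simp only: mult_ac)
    also have "\<dots> = \<beta> 1 * (?q n * \<beta> n) - (1 - p) * (?q n * q_pow ((1 - of_nat n) / 2) * \<beta> (n - 1))"
      unfolding q by (simp only: algebra_simps)
    finally show ?thesis unfolding e2 using Suc by simp
  qed
qed

theorem matrix_reflection_equation:
  fixes \<beta> :: "nat \<Rightarrow> complex fps" and V W :: qw_rep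
  defines "m \<equiv> rdim V" and "n \<equiv> rdim W"
  defines "b \<equiv> \<lambda>n. q_pow (of_nat n * (of_nat n - 1) / 4) * \<beta> n"
  assumes herm: "hermite_coeffs b (\<beta> 1)" and V: "is_qw_rep V" and W: "is_qw_rep W"
  shows "(swap_mat n m * uq_R W V * swap_mat m n) * (1\<^sub>m m \<otimes>\<^sub>m qw_t \<beta> W) * uq_R V W * (qw_t \<beta> V \<otimes>\<^sub>m 1\<^sub>m n) =
    (qw_t \<beta> V \<otimes>\<^sub>m 1\<^sub>m n) * (swap_mat n m * uq_R W V * swap_mat m n) * (1\<^sub>m m \<otimes>\<^sub>m qw_t \<beta> W) * uq_R V W"
    (is "?R21 * ?T2 * ?R * ?T1 = ?T1 * ?R21 * ?T2 * ?R")
proof -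
  let ?N = "m * n"
  let ?P = "emb ?N (1\<^sub>m ?N)"
  obtain k where "rep_leg m (\<lambda>A. emb ?N (A \<otimes>\<^sub>m 1\<^sub>m n)) V k"
    using leg.ex_rep_leg[OF leg_left V] m_def by blast
  then interpret L: rep_leg m "\<lambda>A. emb ?N (A \<otimes>\<^sub>m 1\<^sub>m n)" V k .
  obtain k' where "rep_leg n (\<lambda>B. emb ?N (1\<^sub>m m \<otimes>\<^sub>m B)) W k'"
    using leg.ex_rep_leg[OF leg_right W] n_def by blast
  then interpret R: rep_leg n "\<lambda>B. emb ?N (1\<^sub>m m \<otimes>\<^sub>m B)" W k' .
  let ?H1 = "emb ?N (opH V \<otimes>\<^sub>m 1\<^sub>m n)" and ?H2 = "emb ?N (1\<^sub>m m \<otimes>\<^sub>m opH W)"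
  let ?E1 = "emb ?N (opE V \<otimes>\<^sub>m 1\<^sub>m n)" and ?E2 = "emb ?N (1\<^sub>m m \<otimes>\<^sub>m opE W)"
  let ?F1 = "emb ?N (opF V \<otimes>\<^sub>m 1\<^sub>m n)" and ?F2 = "emb ?N (1\<^sub>m m \<otimes>\<^sub>m opF W)"
  let ?W1 = "emb ?N (opW V \<otimes>\<^sub>m 1\<^sub>m n)" and ?W2 = "emb ?N (1\<^sub>m m \<otimes>\<^sub>m opW W)"
  have HH1: "opH V * opH V \<in> carrier_mat m m" and HH2: "opH W * opH W \<in> carrier_mat n n"
    by (simp_all add: mult_carrier_mat[of _ m m] mult_carrier_mat[of _ n n])
  have HH: "opH V \<otimes>\<^sub>m opH W \<in> carrier_mat ?N ?N" by simp
  obtain D1 where D1: "is_qexp (scl (fps_const (-1/8)) (?H1 * ?H1)) D1"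
    using L.hom_qpow[of "fps_const (-1/8) \<cdot>\<^sub>m (opH V * opH V)"] HH1 by (auto simp: L.hom_smult L.hom_mult)
  obtain D2 where D2: "is_qexp (scl (fps_const (-1/8)) (?H2 * ?H2)) D2"
    using R.hom_qpow[of "fps_const (-1/8) \<cdot>\<^sub>m (opH W * opH W)"] HH2 by (auto simp: R.hom_smult R.hom_mult)
  define Q where "Q = qexp_op ?N (fps_const (1/4) \<cdot>\<^sub>m (opH V \<otimes>\<^sub>m opH W))"
  define Qi where "Qi = qexp_op ?N (fps_const (-1/4) \<cdot>\<^sub>m (opH V \<otimes>\<^sub>m opH W))"
  have H12: "?H1 * ?H2 = emb ?N (opH V \<otimes>\<^sub>m opH W)" by (rule emb_legs) simp_all
  have Q: "is_qexp (scl (fps_const c) (?H1 * ?H2)) (qexp_op ?N (fps_const c \<cdot>\<^sub>m (opH V \<otimes>\<^sub>m opH W)))" for c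
    using is_qexp_qexp_op[of "fps_const c \<cdot>\<^sub>m (opH V \<otimes>\<^sub>m opH W)" ?N] HH
    by (simp add: H12 emb_smult[OF HH])
  \<comment> \<open>The sum of the four orders serves as the common bound.\<close>
  obtain M1 M2 M3 M4 where M: "?E1 ^ M1 = 0" "?F1 ^ M2 = 0" "?E2 ^ M3 = 0" "?F2 ^ M4 = 0"
    using L.e_nilpotent L.f_nilpotent R.e_nilpotent R.f_nilpotent by blast
  have legs: "emb ?N (A \<otimes>\<^sub>m 1\<^sub>m n) * emb ?N (1\<^sub>m m \<otimes>\<^sub>m B) = emb ?N (1\<^sub>m m \<otimes>\<^sub>m B) * emb ?N (A \<otimes>\<^sub>m 1\<^sub>m n)"
    if "A \<in> carrier_mat m m" "B \<in> carrier_mat n n" for A B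
    using emb_legs[OF that] by simp
  interpret reflection_operators b "\<beta> 1" ?W1 ?W2 ?H1 ?H2 ?E1 ?E2 ?F1 ?F2 D1 D2 Q Qi
    "k (1/2)" "k (-1/2)" "k' (-1/2)" "M1 + M2 + M3 + M4"
  proof (unfold_locales)
    show "?E1 ^ (M1 + M2 + M3 + M4) = 0" "?F1 ^ (M1 + M2 + M3 + M4) = 0"
      "?E2 ^ (M1 + M2 + M3 + M4) = 0" "?F2 ^ (M1 + M2 + M3 + M4) = 0"
      using M by (simp_all add: power_eq_0_mono[of _ _ "M1 + M2 + M3 + M4"])
    show "b 0 = 1" by (rule hermite_coeffs.b_0[OF herm])
    show "p_int (Suc n) * b (Suc n) = \<beta> 1 * b n - (1 - p) * (if n = 0 then 0 else b (n - 1))" for n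
      by (rule hermite_coeffs.b_Suc[OF herm])
    show "x * y = y * x" if "x \<in> {?W1, ?H1, ?E1, ?F1}" "y \<in> {?W2, ?H2, ?E2, ?F2}" for x y
      using that by (auto simp: legs)
  qed (use D1 D2 Q L.k R.k L.e_h L.f_h R.f_h L.ef_commutator L.w_h R.w_h L.e_w L.f_w R.e_w
      in \<open>simp_all only: Q_def Qi_def\<close>)
  have P: "emb ?N (1\<^sub>m m \<otimes>\<^sub>m 1\<^sub>m n) = ?P" by (simp add: kron_one)
  have EF: "?E1 * ?F2 = emb ?N (opE V \<otimes>\<^sub>m opF W)" "?F1 * ?E2 = emb ?N (opF V \<otimes>\<^sub>m opE W)"
    by (rule emb_legs; simp)+
  define r where "r = Q * nil_eval R_coeff (?E1 * ?F2)"
  define r' where "r' = Q * nil_eval R_coeff (?F1 * ?E2)"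
  define t1 where "t1 = ?W1 * D1 * nil_eval b ?F1"
  define t2 where "t2 = ?W2 * D2 * nil_eval b ?F2"
  have core: "r' * t2 * r * t1 = t1 * r' * t2 * r"
    unfolding r_def r'_def t1_def t2_def by (rule reflection_equation)
  have tV: "qw_t \<beta> V \<in> carrier_mat m m" and tW: "qw_t \<beta> W \<in> carrier_mat n n"
  proof -
    have "qw_t \<beta> U \<in> carrier_mat (rdim U) (rdim U)" if "is_qw_rep U" for U
      using that unfolding qw_t_def qw_reps_def
      by (auto simp: is_qw_rep_def intro!: mult_carrier_mat[OF mult_carrier_mat[OF _ mat_qpow_carrier]]
          smult_carrier_mat mult_carrier_mat[OF rep_carriers(1) rep_carriers(1)])
    then show "qw_t \<beta> V \<in> carrier_mat m m" "qw_t \<beta> W \<in> carrier_mat n n"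
      using V W by (simp_all add: m_def n_def)
  qed
  have c: "?R21 \<in> carrier_mat ?N ?N" "?T2 \<in> carrier_mat ?N ?N" "?R \<in> carrier_mat ?N ?N" "?T1 \<in> carrier_mat ?N ?N"
  proof -
    have nm: "n * m = ?N" by simp
    have S: "swap_mat n m \<in> carrier_mat ?N ?N" "swap_mat m n \<in> carrier_mat ?N ?N"
      using swap_carrier[of n m] by (simp_all add: mult.commute)
    have "uq_R W V \<in> carrier_mat ?N ?N"
      using emb_R(2)[OF W V] by (simp only: m_def[symmetric] n_def[symmetric] nm)
    then show "?R21 \<in> carrier_mat ?N ?N"
      by (rule mult_carrier_mat[OF mult_carrier_mat[OF S(1)] S(2)])
    show "?R \<in> carrier_mat ?N ?N" using emb_R(2)[OF V W] by (simp only: m_def n_def)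
  qed (use tV tW in simp_all)
  have e: "emb ?N ?R21 = r' * ?P" "emb ?N ?T2 = t2 * ?P" "emb ?N ?R = r * ?P" "emb ?N ?T1 = t1 * ?P"
    using emb_flip_R[OF V W] emb_R(1)[OF V W] L.hom_t[OF D1, of \<beta>] R.hom_t[OF D2, of \<beta>]
    by (simp_all only: r_def r'_def t1_def t2_def b_def m_def[symmetric] n_def[symmetric] EF Q_def P)
  have corner: "?P * (r' * ?P) = r' * ?P" "?P * (t2 * ?P) = t2 * ?P" "?P * (r * ?P) = r * ?P" "?P * (t1 * ?P) = t1 * ?P"
    unfolding e[symmetric] by (rule emb_one_mult c)+
  have four: "emb ?N (A * B * C * D) = a * b * c * d * ?P"
    if "A \<in> carrier_mat ?N ?N" "B \<in> carrier_mat ?N ?N" "C \<in> carrier_mat ?N ?N" "D \<in> carrier_mat ?N ?N"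
      and "emb ?N A = a * ?P" "emb ?N B = b * ?P" "emb ?N C = c * ?P" "emb ?N D = d * ?P"
      and "?P * (b * ?P) = b * ?P" "?P * (c * ?P) = c * ?P" "?P * (d * ?P) = d * ?P" for A B C D a b c d
  proof -
    have "emb ?N (A * B * C * D) = emb ?N A * emb ?N B * emb ?N C * emb ?N D"
      using that(1-4) by (simp add: emb_mult mult_carrier_mat[of _ ?N ?N] mult.assoc)
    also have "\<dots> = a * (?P * (b * ?P)) * (c * ?P) * (d * ?P)" unfolding that(5-8) by (simp only: mult.assoc)
    also have "\<dots> = a * b * (?P * (c * ?P)) * (d * ?P)" unfolding that(9) by (simp only: mult.assoc)
    also have "\<dots> = a * b * c * (?P * (d * ?P))" unfolding that(10) by (simp only: mult.assoc)
    finally show ?thesis unfolding that(11) by (simp only: mult.assoc)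
  qed
  show ?thesis
  proof (rule emb_inject)
    show "emb ?N (?R21 * ?T2 * ?R * ?T1) = emb ?N (?T1 * ?R21 * ?T2 * ?R)"
      using four[OF c(1,2,3,4) e(1,2,3,4) corner(2,3,4)] four[OF c(4,1,2,3) e(4,1,2,3) corner(1,2,3)] core
      by simp
  qed (rule mult_carrier_mat c)+
qed

theorem proposition2:
  fixes \<beta> :: "nat \<Rightarrow> complex fps"
  assumes "\<beta> 0 = 1"
    and "\<And>a. a \<ge> 1 \<Longrightarrow>
      \<beta> (a + 1) =
        (\<beta> a * \<beta> 1 + \<beta> (a - 1) * (q_pow (-1) - 1) * q_pow ((1 - of_nat a) / 2)) / q_int (a + 1)"
  defines "t \<equiv> qw_t \<beta>"
  shows "flip2 qw_R \<otimes>\<^bsub>qw_compl2\<^esub> leg2 t \<otimes>\<^bsub>qw_compl2\<^esub> qw_R \<otimes>\<^bsub>qw_compl2\<^esub> leg1 t =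
    leg1 t \<otimes>\<^bsub>qw_compl2\<^esub> flip2 qw_R \<otimes>\<^bsub>qw_compl2\<^esub> leg2 t \<otimes>\<^bsub>qw_compl2\<^esub> qw_R"
proof
  fix VW :: "qw_rep \<times> qw_rep"
  obtain V W where VW: "VW = (V, W)" by (cases VW)
  let ?l = "flip2 qw_R \<otimes>\<^bsub>qw_compl2\<^esub> leg2 t \<otimes>\<^bsub>qw_compl2\<^esub> qw_R \<otimes>\<^bsub>qw_compl2\<^esub> leg1 t"
  let ?r = "leg1 t \<otimes>\<^bsub>qw_compl2\<^esub> flip2 qw_R \<otimes>\<^bsub>qw_compl2\<^esub> leg2 t \<otimes>\<^bsub>qw_compl2\<^esub> qw_R"
  show "?l VW = ?r VW"
  proof (cases "V \<in> qw_reps \<and> W \<in> qw_reps")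
    case True
    then have reps: "is_qw_rep V" "is_qw_rep W" by (simp_all add: qw_reps_def)
    from matrix_reflection_equation[OF hermite_coeffs_beta[OF assms(1,2)] this] True show ?thesis
      by (simp add: VW qw_compl2_def flip2_def leg1_def leg2_def qw_R_def t_def)
  next
    \<comment> \<open>Off the pairs of representations both products take the default value of a
      restricted function.\<close>
    case False
    then show ?thesis by (auto simp: VW qw_compl2_def)
  qed
qed

end
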